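(* For every $\alpha\in(0,1)$ there exists a symmetric probability distribution $\widetilde\mu_\alpha$ supported on $[-1,1]$, depending only on $\alpha$, such that the following holds: if $\mathcal{L}\in\mathbb{H}_\alpha$ and $K$ is the $n\times n$ random reversible Markov matrix built from i.i.d. weights of law $\mathcal{L}$, then almost surely $$\mu_K:=\frac1n\sum_{k=1}^n\delta_{\lambda_k(K)}\ \longrightarrow\ \widetilde\mu_\alpha\qquad\text{weakly as } n\to\infty .$$
   Context: For $\alpha>0$, $\mathbb{H}_\alpha$ is the class of probability laws $\mathcal{L}$ supported in $[0,\infty)$ whose tail is regularly varying of index $\alpha$: $\mathcal{L}((t,\infty))=L(t)t^{-\alpha}$ for all $t>0$, with $L$ slowly varying at $\infty$ (i.e. $L(xt)/L(t)\to1$ as $t\to\infty$ for every $x>0$). Let $(U_{i,j})_{1\le i\le j}$ be an infinite table of i.i.d. random variables of law $\mathcal{L}$, with $U_{j,i}=U_{i,j}$. For each $n$, $K=K^{(n)}$ is the $n\times n$ matrix $K_{i,j}=U_{i,j}/\rho_i$ with $\rho_i=\sum_{j=1}^nU_{i,j}$ (and $K_{i,j}=\delta_{i,j}$ for all $j$ if $\rho_i=0$). $K$ is self-adjoint in $L^2(\rho)$, so its eigenvalues $\lambda_1\ge\dots\ge\lambda_n$ are real. Weak convergence is with respect to bounded continuous functions. *)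

theory Defs
  imports "HOL-Probability.Probability" "Jordan_Normal_Form.Char_Poly"
begin

definition slowly_varying :: "(real \<Rightarrow> real) \<Rightarrow> bool" where
  "slowly_varying l \<longleftrightarrow> (\<forall>x>0. ((\<lambda>t. l (x * t) / l t) \<longlongrightarrow> 1) at_top)"

definition heavy_tailed_laws :: "real \<Rightarrow> real measure set" where
  "heavy_tailed_laws \<alpha> =
     {D. real_distribution D \<and> measure D {0..} = 1 \<and>
         (\<exists>l. slowly_varying l \<and> (\<forall>t>0. measure D {t<..} = l t * t powr (-\<alpha>)))}"

definition iid_weights ::
    "'w measure \<Rightarrow> real measure \<Rightarrow> (nat \<Rightarrow> nat \<Rightarrow> 'w \<Rightarrow> real) \<Rightarrow> bool" where
  "iid_weights M D U \<longleftrightarrow>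
     prob_space M \<and>
     prob_space.indep_vars M (\<lambda>_. borel) (\<lambda>(i, j). U i j) {(i, j). i \<le> j} \<and>
     (\<forall>i j. i \<le> j \<longrightarrow> distr M borel (U i j) = D) \<and>
     (\<forall>i j. \<forall>\<omega>\<in>space M. U j i \<omega> = U i j \<omega>)"

text \<open>A limit law chosen for all tables over a type \<open>'w\<close> of sample points could formally depend
  on \<open>'w\<close>, since HOL cannot quantify over \<open>'w\<close> inside a formula. Requiring the same limit on the
  coordinate space below, whose type is concrete, rules this out.\<close>

definition canonical_space :: "real measure \<Rightarrow> (nat \<times> nat \<Rightarrow> real) measure" where
  "canonical_space D = PiM {(i, j). i \<le> j} (\<lambda>_. D)"

definition canonical_weights :: "nat \<Rightarrow> nat \<Rightarrow> (nat \<times> nat \<Rightarrow> real) \<Rightarrow> real" where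
  "canonical_weights i j u = u (min i j, max i j)"

text \<open>Rows and columns are numbered from \<open>0\<close>, so the matrix of size \<open>n\<close> uses the weights with
  indices \<open>i, j < n\<close>.\<close>

definition markov_matrix :: "nat \<Rightarrow> (nat \<Rightarrow> nat \<Rightarrow> real) \<Rightarrow> real mat" where
  "markov_matrix n u =
     mat n n (\<lambda>(i, j).
       let \<rho> = (\<Sum>k<n. u i k)
       in if \<rho> = 0 then (if i = j then 1 else 0) else u i j / \<rho>)"

text \<open>The real eigenvalues in decreasing order, repeated according to algebraic multiplicity. If
  all eigenvalues of \<open>A\<close> are real, as for \<open>markov_matrix n u\<close> with symmetric \<open>u \<ge> 0\<close>, the
  list has length \<open>dim_row A\<close>; the empirical spectral distribution below is meant for such \<open>A\<close>.\<close>

definition eigenvalues :: "real mat \<Rightarrow> real list" where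
  "eigenvalues A = rev (sorted_list_of_multiset (proots (char_poly A)))"

definition empirical_spectral_distribution :: "real mat \<Rightarrow> real measure" where
  "empirical_spectral_distribution A =
     distr (uniform_count_measure {..<dim_row A}) borel (\<lambda>k. eigenvalues A ! k)"

text \<open>The library's \<open>weak_conv_m\<close> is formulated through distribution functions; this is weak
  convergence against bounded continuous test functions.\<close>

definition converges_weakly :: "(nat \<Rightarrow> real measure) \<Rightarrow> real measure \<Rightarrow> bool" where
  "converges_weakly \<mu>s \<mu> \<longleftrightarrow>
     (\<forall>f :: real \<Rightarrow> real. continuous_on UNIV f \<and> bounded (range f) \<longrightarrow>
        (\<lambda>n. \<integral>x. f x \<partial>\<mu>s n) \<longlonglongrightarrow> (\<integral>x. f x \<partial>\<mu>))"

definition spectra_converge_as ::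
    "'w measure \<Rightarrow> (nat \<Rightarrow> nat \<Rightarrow> 'w \<Rightarrow> real) \<Rightarrow> real measure \<Rightarrow> bool" where
  "spectra_converge_as M U \<mu> \<longleftrightarrow>
     (AE \<omega> in M. converges_weakly
        (\<lambda>n. empirical_spectral_distribution (markov_matrix n (\<lambda>i j. U i j \<omega>))) \<mu>)"

end

theory Submission
  imports Defs "Jordan_Normal_Form.Schur_Decomposition"
begin

text \<open>
  The method of moments: the \<open>k\<close>-th moment of the spectral distribution is the normalised trace
  of \<open>K ^ k\<close>, a sum over closed walks.

  Fluctuations. Replacing one weight by zero changes two rows of \<open>K\<close>, by an amount controlled by
  the entries themselves, so the sum over all weights of the squared changes of the moment is
  \<open>O(1/n)\<close> deterministically. Two applications of the Efron-Stein inequality bound the fourth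
  central moment by \<open>O(1/n^2)\<close>, which gives almost sure convergence along the whole sequence.

  Means. Adding \<open>n\<close> to each row sum does not change the limit. Writing \<open>1/\<rho>^d\<close> as a Gamma
  integral makes the mean weight of a walk with \<open>v\<close> vertices an integral over \<open>v\<close> variables of a
  product over independent weights, which involves the law only through its Laplace transform
  and the functions \<open>E[(x U)^m exp (- x U)]\<close>. Their ratio to \<open>1 - E exp (- x U)\<close> tends, as
  \<open>x \<rightarrow> 0\<close>, to a constant depending on \<open>\<alpha>\<close> only. By dominated convergence only walks whose
  edges form a tree survive; these have even length, whence the symmetry of the limit law.
\<close>


section \<open>Regular variation and Laplace transforms\<close>

text \<open>Since \<alpha> < 1, the weights have infinite mean and a row sum is comparable with its
  largest entry. The denominators obey no law of large numbers and stay correlated with the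
  numerators in the limit; the Gamma integrals decouple them. Their variables are measured in units
  of b = \<open>norming n\<close>, the solution of n (1 - E exp (- b U)) = 1, so that row sums have
  order 1 / b. The powers of b cancel: visits to vertices and traversals of edges of a closed walk
  both add up to its length. A shape with v vertices and e edges has about n^v labelled copies, each
  of mean weight at most of order n^(-e). With the normalisation 1 / n only e = v - 1 survives, and
  e >= v - 1 always holds. That n b tends to 0, again by \<alpha> < 1, makes the damping by n
  harmless. The analytic obstacle is a majorant uniform in n: the edge factors blow up when the
  variables tend to 0, and decay at infinity is only of the kind exp (- y^(\<alpha>/2)). The moment
  problem is avoided: the limit law is a cluster point of the spectra of one single outcome.\<close>

text \<open>A Potter bound. Near 0 one halving of the argument costs at most the factor
  (1/2)^\<eta>; this is iterated along x / 2^j, and monotonicity bridges the gaps between powers of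
  two.\<close>

lemma potter_lower:
  fixes g :: "real \<Rightarrow> real"
  assumes mono: "\<And>x y. 0 < x \<Longrightarrow> x \<le> y \<Longrightarrow> g x \<le> g y"
    and pos: "\<And>x. 0 < x \<Longrightarrow> 0 < g x"
    and lim: "((\<lambda>x. g (1/2 * x) / g x) \<longlongrightarrow> (1/2) powr a) (at_right 0)"
    and \<eta>: "a < \<eta>" "0 < \<eta>"
  obtains c x0 where "c > 0" "x0 > 0"
    "\<And>x s. 0 < x \<Longrightarrow> x \<le> x0 \<Longrightarrow> 0 < s \<Longrightarrow> s \<le> 1 \<Longrightarrow> c * s powr \<eta> * g x \<le> g (x * s)"
proof -
  have "(1/2) powr \<eta> < (1/2::real) powr a"
    using \<eta> by (simp add: powr_less_mono')
  with lim have "eventually (\<lambda>x. (1/2) powr \<eta> < g (1/2 * x) / g x) (at_right 0)"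
    by (rule order_tendstoD)
  then obtain b where b: "b > 0" "\<And>x. 0 < x \<Longrightarrow> x < b \<Longrightarrow> (1/2) powr \<eta> < g (1/2 * x) / g x"
    by (auto simp: eventually_at_right[of 0 1])
  have step: "(1/2) powr \<eta> * g x \<le> g (1/2 * x)" if "0 < x" "x < b" for x
    using b(2)[OF that] pos[OF that(1)] by (simp add: field_simps)
  have iter: "(1/2) powr (\<eta> * real j) * g x \<le> g (x * (1/2) ^ j)" if "0 < x" "x < b" for x j
  proof (induction j)
    case (Suc j)
    have half: "1/2 * (x * (1/2)^j) = x * (1/2) ^ Suc j" by simp
    have "x * (1/2)^j \<le> x * 1" using that by (intro mult_left_mono) (auto simp: power_le_one)
    then have "x * (1/2)^j < b" using that by linarith
    then have "(1/2) powr \<eta> * g (x * (1/2)^j) \<le> g (1/2 * (x * (1/2)^j))"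
      using that by (intro step) auto
    moreover have "(1/2) powr \<eta> * ((1/2) powr (\<eta> * real j) * g x) \<le> (1/2) powr \<eta> * g (x * (1/2)^j)"
      by (intro mult_left_mono Suc) auto
    moreover have "(1/2) powr (\<eta> * real (Suc j)) = (1/2) powr \<eta> * (1/2::real) powr (\<eta> * real j)"
      by (simp add: powr_add [symmetric] algebra_simps)
    ultimately show ?case unfolding half by (simp only: mult_ac)
  qed simp
  show thesis
  proof (rule that)
    fix x s :: real assume *: "0 < x" "x \<le> b/2" "0 < s" "s \<le> 1"
    \<comment> \<open>Rounding up makes 2^(-j) at most s, so monotonicity points the right way; the
      overshoot of at most one halving is the constant c = (1/2)^\<eta>.\<close>
    define j where "j = nat \<lceil>log (1/2) s\<rceil>"
    have l0: "log (1/2) s \<ge> 0" using * by (simp add: log_def divide_nonpos_neg)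
    have j: "log (1/2) s \<le> real j" "real j \<le> log (1/2) s + 1"
      unfolding j_def using l0 by linarith+
    have s: "s = (1/2) powr log (1/2) s" using * by simp
    have "(1/2)^j = (1/2) powr real j" by (simp add: powr_realpow)
    also have "\<dots> \<le> (1/2) powr log (1/2) s" using j by (intro powr_mono') auto
    also have "\<dots> = s" using s by simp
    finally have js: "(1/2)^j \<le> s" .
    have "(1/2) powr \<eta> * s powr \<eta> = (1/2) powr \<eta> * ((1/2) powr log (1/2) s) powr \<eta>"
      using s by simp
    also have "\<dots> = (1/2) powr (\<eta> * (log (1/2) s + 1))"
      by (subst powr_powr) (simp add: powr_add[symmetric] algebra_simps)
    also have "\<dots> \<le> (1/2) powr (\<eta> * real j)"
      using j \<eta> by (intro powr_mono') (auto intro!: mult_left_mono)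
    finally have "(1/2) powr \<eta> * s powr \<eta> * g x \<le> (1/2) powr (\<eta> * real j) * g x"
      using pos[of x] * by (intro mult_right_mono) auto
    also have "\<dots> \<le> g (x * (1/2)^j)" using * b(1) by (intro iter) auto
    also have "\<dots> \<le> g (x * s)" using * js by (intro mono mult_left_mono) auto
    finally show "(1/2) powr \<eta> * s powr \<eta> * g x \<le> g (x * s)" .
  qed (use b(1) in auto)
qed

text \<open>The mirror image of \<open>potter_lower\<close>, with an exponent below the index. The
  number of halvings is now rounded down, which costs the constant C = (1/2)^(-\<epsilon>).\<close>

lemma potter_upper:
  fixes g :: "real \<Rightarrow> real"
  assumes mono: "\<And>x y. 0 < x \<Longrightarrow> x \<le> y \<Longrightarrow> g x \<le> g y"
    and pos: "\<And>x. 0 < x \<Longrightarrow> 0 < g x"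
    and lim: "((\<lambda>x. g (1/2 * x) / g x) \<longlongrightarrow> (1/2) powr a) (at_right 0)"
    and \<epsilon>: "\<epsilon> < a" "0 < \<epsilon>"
  obtains C x0 where "C > 0" "x0 > 0"
    "\<And>x s. 0 < x \<Longrightarrow> x \<le> x0 \<Longrightarrow> 0 < s \<Longrightarrow> s \<le> 1 \<Longrightarrow> g (x * s) \<le> C * s powr \<epsilon> * g x"
proof -
  have "(1/2::real) powr a < (1/2) powr \<epsilon>"
    using \<epsilon> by (simp add: powr_less_mono')
  with lim have "eventually (\<lambda>x. g (1/2 * x) / g x < (1/2) powr \<epsilon>) (at_right 0)"
    by (rule order_tendstoD)
  then obtain b where b: "b > 0" "\<And>x. 0 < x \<Longrightarrow> x < b \<Longrightarrow> g (1/2 * x) / g x < (1/2) powr \<epsilon>"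
    by (auto simp: eventually_at_right[of 0 1])
  have step: "g (1/2 * x) \<le> (1/2) powr \<epsilon> * g x" if "0 < x" "x < b" for x
    using b(2)[OF that] pos[OF that(1)] by (simp add: field_simps)
  have iter: "g (x * (1/2) ^ j) \<le> (1/2) powr (\<epsilon> * real j) * g x" if "0 < x" "x < b" for x j
  proof (induction j)
    case (Suc j)
    have half: "1/2 * (x * (1/2)^j) = x * (1/2) ^ Suc j" by simp
    have "x * (1/2)^j \<le> x * 1" using that by (intro mult_left_mono) (auto simp: power_le_one)
    then have "x * (1/2)^j < b" using that by linarith
    then have "g (1/2 * (x * (1/2)^j)) \<le> (1/2) powr \<epsilon> * g (x * (1/2)^j)"
      using that by (intro step) auto
    moreover have "(1/2) powr \<epsilon> * g (x * (1/2)^j) \<le> (1/2) powr \<epsilon> * ((1/2) powr (\<epsilon> * real j) * g x)"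
      by (intro mult_left_mono Suc) auto
    moreover have "(1/2) powr (\<epsilon> * real (Suc j)) = (1/2) powr \<epsilon> * (1/2::real) powr (\<epsilon> * real j)"
      by (simp add: powr_add [symmetric] algebra_simps)
    ultimately show ?case unfolding half by (simp only: mult_ac)
  qed simp
  show thesis
  proof (rule that)
    fix x s :: real assume *: "0 < x" "x \<le> b/2" "0 < s" "s \<le> 1"
    define j where "j = nat \<lfloor>log (1/2) s\<rfloor>"
    have l0: "log (1/2) s \<ge> 0" using * by (simp add: log_def divide_nonpos_neg)
    have j: "real j \<le> log (1/2) s" "log (1/2) s - 1 \<le> real j"
      unfolding j_def using l0 by linarith+
    have s: "s = (1/2) powr log (1/2) s" using * by simp
    have "s = (1/2) powr log (1/2) s" using * by simp
    also have "\<dots> \<le> (1/2) powr real j" using j by (intro powr_mono') auto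
    also have "\<dots> = (1/2)^j" by (simp add: powr_realpow)
    finally have js: "s \<le> (1/2)^j" .
    have "g (x * s) \<le> g (x * (1/2)^j)" using * js by (intro mono mult_left_mono) auto
    also have "\<dots> \<le> (1/2) powr (\<epsilon> * real j) * g x" using * b(1) by (intro iter) auto
    also have "\<dots> \<le> (1/2) powr (\<epsilon> * (log (1/2) s - 1)) * g x"
      using j \<epsilon> pos[of x] * by (intro mult_right_mono powr_mono') (auto intro!: mult_left_mono)
    also have "(1/2) powr (\<epsilon> * (log (1/2) s - 1)) = (1/2) powr (-\<epsilon>) * ((1/2::real) powr log (1/2) s) powr \<epsilon>"
      by (subst powr_powr) (simp add: powr_add[symmetric] algebra_simps)
    also have "(1/2::real) powr log (1/2) s = s" using s by simp
    finally show "g (x * s) \<le> (1/2) powr (-\<epsilon>) * s powr \<epsilon> * g x" .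
  qed (use b(1) in auto)
qed

text \<open>The majorant of both dominated convergences: for the tail integrals with a = - (\<alpha>
  + 1) / 2, and for each Gamma variable with a = \<alpha>/4 - 1.\<close>

definition two_power :: "real \<Rightarrow> real \<Rightarrow> real" where
  "two_power a s = indicator {0<..1} s * s powr a + indicator {1<..} s * s powr (- 2)"

lemma two_power_nonneg [simp]: "0 \<le> two_power a s"
  by (simp add: two_power_def)

lemma two_power_borel [measurable]: "two_power a \<in> borel_measurable borel"
  unfolding two_power_def[abs_def] by measurable

lemma two_power_integrable: "a > -1 \<Longrightarrow> integrable lborel (two_power a)"
proof -
  assume a: "a > -1"
  have "(\<integral>\<^sup>+s. indicator {0<..1} s * (s powr a) \<partial>lborel) \<le> (\<integral>\<^sup>+s. indicator {0..1} s * (s powr a) \<partial>lborel)"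
    by (intro nn_integral_mono) (auto simp: indicator_def)
  also have "\<dots> = ennreal (1 powr (a + 1) / (a + 1))"
    by (intro nn_integral_has_integral_lebesgue has_integral_powr_from_0) (use a in auto)
  finally have 1: "(\<integral>\<^sup>+s. indicator {0<..1} s * (s powr a) \<partial>lborel) < \<infinity>"
    by (rule le_less_trans) auto
  have "(\<integral>\<^sup>+s. indicator {1<..} s * (s powr -2) \<partial>lborel) \<le> (\<integral>\<^sup>+s. indicator {1..} s * (s powr -2) \<partial>lborel)"
    by (intro nn_integral_mono) (auto simp: indicator_def)
  also have "\<dots> = ennreal (- (1 powr (-2 + 1)) / (-2 + 1))"
    using nn_integral_has_integral_lebesgue[OF _ has_integral_powr_to_inf[of "-2" 1]]
    by (simp add: ennreal_indicator ennreal_mult')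
  finally have 2: "(\<integral>\<^sup>+s. indicator {1<..} s * (s powr -2) \<partial>lborel) < \<infinity>"
    by (rule le_less_trans) auto
  have "integrable lborel (\<lambda>s. indicator {0<..1} s * (s powr a))"
    using 1 by (intro integrableI_nonneg) (auto simp: ennreal_mult' ennreal_indicator)
  moreover have "integrable lborel (\<lambda>s::real. indicator {1<..} s * (s powr -2))"
  proof (rule integrableI_nonneg)
    show "(\<integral>\<^sup>+s. ennreal (indicator {1<..} s * (s powr -2)) \<partial>lborel) < \<infinity>"
      using 2 by (simp add: ennreal_mult' ennreal_indicator)
  qed auto
  ultimately show ?thesis unfolding two_power_def[abs_def] by (rule Bochner_Integration.integrable_add)
qed

lemma power_le_fact_exp: "0 \<le> t \<Longrightarrow> t ^ j \<le> fact j * exp (t::real)"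
proof -
  assume t: "0 \<le> t"
  have "(\<Sum>i\<in>{j}. t ^ i /\<^sub>R fact i) \<le> (\<Sum>i. t ^ i /\<^sub>R fact i)"
    using t by (intro sum_le_suminf summable_exp_generic) auto
  also have "\<dots> = exp t" by (simp add: exp_def)
  finally show ?thesis by (simp add: field_simps)
qed

text \<open>The derivative of \<open>tail_primitive m\<close>; it turns a mean over the law into an
  integral against the tail.\<close>

definition tail_kernel :: "nat \<Rightarrow> real \<Rightarrow> real" where
  "tail_kernel m s = (if m = 0 then exp (- s) else (real m * s ^ (m - 1) - s ^ m) * exp (- s))"

text \<open>For m = 0 the function exp (- s) is replaced by 1 - exp (- s), which vanishes at 0 as
  the integration by parts requires.\<close>

definition tail_primitive :: "nat \<Rightarrow> real \<Rightarrow> real" where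
  "tail_primitive m s = (if m = 0 then 1 - exp (- s) else s ^ m * exp (- s))"

lemma tail_primitive_deriv: "(tail_primitive m has_real_derivative tail_kernel m s) (at s)"
proof (cases "m = 0")
  case False
  have "((\<lambda>s. s ^ m * exp (- s)) has_real_derivative (real m * s ^ (m - 1) - s ^ m) * exp (- s)) (at s)"
    by (auto intro!: derivative_eq_intros simp: algebra_simps)
  then show ?thesis using False by (simp add: tail_primitive_def[abs_def] tail_kernel_def)
next
  case True
  have "((\<lambda>s. 1 - exp (- s)) has_real_derivative exp (- s)) (at s)"
    by (auto intro!: derivative_eq_intros)
  then show ?thesis using True by (simp add: tail_primitive_def[abs_def] tail_kernel_def)
qed

lemma tail_primitive_0 [simp]: "tail_primitive m 0 = 0"
  by (auto simp: tail_primitive_def)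

lemma tail_primitive_nonneg: "0 \<le> s \<Longrightarrow> 0 \<le> tail_primitive m s"
  by (auto simp: tail_primitive_def)

lemma tail_kernel_cont: "isCont (tail_kernel m) s"
  unfolding tail_kernel_def[abs_def] by (cases "m = 0") (auto intro!: continuous_intros)

lemma tail_kernel_borel [measurable]: "tail_kernel m \<in> borel_measurable borel"
  unfolding tail_kernel_def[abs_def] by measurable

lemma tail_primitive_borel [measurable]: "tail_primitive m \<in> borel_measurable borel"
  unfolding tail_primitive_def[abs_def] by measurable

text \<open>From (1 + s) exp (- s) <= 1 one gets s <= (1 + s) (1 - exp (- s)). One factor s is spent
  on this, and the remaining polynomial is absorbed by exp (- s). As a consequence all moments below
  are bounded by the one for m = 0.\<close>

lemma tail_primitive_le:
  assumes "0 \<le> s" shows "tail_primitive m s \<le> 2 * fact m * (1 - exp (- s))"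
proof (cases m)
  case 0
  then show ?thesis using assms by (simp add: tail_primitive_def)
next
  case (Suc j)
  have "s ^ j + s ^ Suc j \<le> fact j * exp s + fact (Suc j) * exp s"
    using assms by (intro add_mono power_le_fact_exp)
  also have "\<dots> \<le> 2 * fact m * exp s"
    using Suc by (simp add: algebra_simps)
  finally have 1: "(1 + s) * s ^ j * exp (- s) \<le> 2 * fact m"
    by (simp add: exp_minus field_simps)
  have "(1 + s) * exp (- s) \<le> 1"
    using exp_ge_add_one_self[of s] by (simp add: exp_minus field_simps)
  then have 2: "s \<le> (1 + s) * (1 - exp (- s))" by (simp add: algebra_simps)
  have "s ^ m * exp (- s) = s * (s ^ j * exp (- s))" using Suc by simp
  also have "\<dots> \<le> (1 + s) * (1 - exp (- s)) * (s ^ j * exp (- s))"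
    using 2 assms by (intro mult_right_mono) auto
  also have "\<dots> = ((1 + s) * s ^ j * exp (- s)) * (1 - exp (- s))" by simp
  also have "\<dots> \<le> 2 * fact m * (1 - exp (- s))"
    using 1 assms by (intro mult_right_mono) auto
  finally show ?thesis using Suc by (simp add: tail_primitive_def)
qed

lemma tail_kernel_le:
  assumes "0 < s" shows "\<bar>tail_kernel m s\<bar> \<le> fact (m + 3) * min 1 (s powr (- 2))"
proof -
  have F: "s ^ j * exp (- s) \<le> fact j" for j
    using power_le_fact_exp[of s j] assms by (simp add: exp_minus field_simps)
  \<comment> \<open>The power i = 0 yields boundedness near 0, the power i = 2 the decay
    s^(-2).\<close>
  have A: "s ^ i * \<bar>tail_kernel m s\<bar> \<le> fact (m + 3)" if i: "i = 0 \<or> i = 2" for i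
  proof (cases m)
    case 0
    have "fact i \<le> (fact 3 :: real)" using i by (auto simp: fact_numeral)
    then show ?thesis using F[of i] 0
      by (simp add: tail_kernel_def)
  next
    case (Suc j)
    have "\<bar>tail_kernel m s\<bar> = \<bar>real m * s ^ j - s ^ m\<bar> * exp (- s)"
      using Suc by (simp add: tail_kernel_def abs_mult)
    also have "\<dots> \<le> (real m * s ^ j + s ^ m) * exp (- s)"
      using assms by (intro mult_right_mono) (auto simp: abs_if)
    finally have "s ^ i * \<bar>tail_kernel m s\<bar> \<le> s ^ i * ((real m * s ^ j + s ^ m) * exp (- s))"
      using assms by (intro mult_left_mono) auto
    also have "\<dots> = real m * (s ^ (i + j) * exp (- s)) + s ^ (i + m) * exp (- s)"
      by (simp add: algebra_simps power_add)
    also have "\<dots> \<le> real m * fact (i + j) + fact (i + m)"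
      by (intro add_mono mult_left_mono F) auto
    also have "\<dots> \<le> real m * fact (m + 2) + fact (m + 2)"
    proof -
      have "i + j \<le> m + 2" "i + m \<le> m + 2" using i Suc by auto
      then show ?thesis by (intro add_mono[of "real m * fact (i + j)"] mult_left_mono fact_mono) auto
    qed
    also have "\<dots> \<le> fact (m + 3)"
      by (simp add: algebra_simps eval_nat_numeral)
    finally show ?thesis .
  qed
  have "s powr (- 2) = inverse (s ^ 2)"
    using assms by (simp add: powr_minus powr_numeral)
  then have "\<bar>tail_kernel m s\<bar> \<le> fact (m + 3) * s powr (- 2)"
    using A[of 2] assms by (simp add: pos_le_divide_eq[of "s ^ 2", symmetric] mult.commute divide_inverse)
  then show ?thesis using A[of 0] by (simp add: min_def)
qed

section \<open>Regularly varying tails and the Abelian theorem\<close>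

locale heavy_tail =
  fixes D :: "real measure" and \<alpha> :: real
  assumes heavy: "D \<in> heavy_tailed_laws \<alpha>" and alpha: "0 < \<alpha>" "\<alpha> < 1"
begin

sublocale D: real_distribution D
  using heavy by (simp add: heavy_tailed_laws_def)

lemma AE_nonneg: "AE u in D. 0 \<le> u"
proof -
  have "D.prob {0..} = 1" using heavy by (simp add: heavy_tailed_laws_def)
  then have "AE u in D. u \<in> {0..}" by (subst (asm) D.prob_eq_1) auto
  then show ?thesis by simp
qed

text \<open>The tail as a function of the inverse level, so that it is regularly varying at \<open>0\<close> with
  index \<open>\<alpha>\<close>.\<close>

definition "tail x = measure D {1 / x<..}"

lemma tail_mono: "0 < x \<Longrightarrow> x \<le> y \<Longrightarrow> tail x \<le> tail y"
  unfolding tail_def by (intro D.finite_measure_mono) (auto simp: frac_le intro: order_le_less_trans[of "1/y" "1/x"])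

lemma tail_le_1: "tail x \<le> 1"
  unfolding tail_def by simp

text \<open>Substituting x = 1 / t turns the ratio into slow variation of l at the scale 1 / s,
  times (1 / s)^(-\<alpha>).\<close>

lemma tail_ratio: assumes "0 < s" shows "((\<lambda>x. tail (s * x) / tail x) \<longlongrightarrow> s powr \<alpha>) (at_right 0)"
proof -
  obtain l where l: "slowly_varying l" "\<And>t. t > 0 \<Longrightarrow> measure D {t<..} = l t * t powr (-\<alpha>)"
    using heavy by (auto simp: heavy_tailed_laws_def)
  have "1 / s > 0" using assms by simp
  then have "((\<lambda>t. l (1 / s * t) / l t) \<longlongrightarrow> 1) at_top"
    using l(1) unfolding slowly_varying_def by blast
  then have "((\<lambda>t. s powr \<alpha> * (l (1 / s * t) / l t)) \<longlongrightarrow> s powr \<alpha> * 1) at_top"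
    by (intro tendsto_intros)
  moreover have "\<forall>\<^sub>F t in at_top. s powr \<alpha> * (l (1 / s * t) / l t) = tail (s * inverse t) / tail (inverse t)"
    using eventually_gt_at_top[of 0]
  proof eventually_elim
    case (elim t)
    have "tail (s * inverse t) = l (1 / s * t) * (1 / s * t) powr (-\<alpha>)"
      unfolding tail_def using l(2)[of "1 / s * t"] elim assms by (simp add: field_simps)
    also have "(1 / s * t) powr (-\<alpha>) = s powr \<alpha> * t powr (-\<alpha>)"
      using assms elim by (simp add: powr_divide powr_minus field_simps)
    finally have "tail (s * inverse t) = s powr \<alpha> * l (1 / s * t) * t powr (-\<alpha>)" by simp
    moreover have "tail (inverse t) = l t * t powr (-\<alpha>)"
      unfolding tail_def using l(2)[OF elim] by (simp add: field_simps)
    ultimately show ?case using elim by simp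
  qed
  ultimately have "((\<lambda>t. tail (s * inverse t) / tail (inverse t)) \<longlongrightarrow> s powr \<alpha> * 1) at_top"
    by (rule Lim_transform_eventually)
  then show ?thesis by (simp add: filterlim_at_right_to_top)
qed

lemma tail_pos: assumes "0 < x" shows "0 < tail x"
proof -
  \<comment> \<open>Division by zero yields 0, so a ratio y |-> tail y / tail y with limit 1 already
    forces \<open>tail\<close> to be nonzero near 0; monotonicity does the rest.\<close>
  have "\<forall>\<^sub>F y in at_right 0. 0 < tail (1 * y) / tail y"
    using tail_ratio[of 1] by (rule order_tendstoD) simp_all
  moreover have "\<forall>\<^sub>F y in at_right 0. y < x" "\<forall>\<^sub>F y in at_right 0. 0 < (y::real)"
    using assms by (auto simp: eventually_at_right[of 0 x] eventually_at_right[of 0 1])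
  ultimately have "\<forall>\<^sub>F y in at_right 0. 0 < tail y \<and> y < x \<and> 0 < y"
    by eventually_elim (auto simp: tail_def zero_less_measure_iff intro: ccontr)
  then obtain y where "0 < tail y" "y < x" "0 < y"
    using eventually_happens' trivial_limit_at_right_real by blast
  then show ?thesis using tail_mono[of y x] by simp
qed

definition "tail_moment m x = (\<integral>u. tail_primitive m (x * \<bar>u\<bar>) \<partial>D)"

text \<open>The layer-cake formula: the mean of g (x U) with g 0 = 0 is the integral of g' (s) P (x
  U > s), and P (U > s / x) is \<open>tail (x / s)\<close>. Fubini applies because the kernel is
  absolutely integrable.\<close>

lemma tail_moment_eq:
  assumes x: "0 < x"
  shows "tail_moment m x = (\<integral>s. indicator {0<..} s * tail_kernel m s * tail (x / s) \<partial>lborel)"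
    and "integrable lborel (\<lambda>s. indicator {0<..} s * tail_kernel m s * tail (x / s))"
proof -
  interpret pair_sigma_finite D lborel ..
  let ?b = "\<lambda>s. indicator {0<..} s * tail_kernel m s"
  let ?h = "\<lambda>u s. ?b s * indicator {(u, s). s < x * u} (u, s)"
  have b: "integrable lborel ?b"
  proof (rule Bochner_Integration.integrable_bound)
    show "integrable lborel (\<lambda>s. fact (m + 3) * two_power 0 s)"
      by (intro integrable_mult_right two_power_integrable) simp
    show "AE s in lborel. norm (?b s) \<le> norm (fact (m + 3) * two_power 0 s)"
    proof (rule AE_I2)
      fix s :: real
      show "norm (?b s) \<le> norm (fact (m + 3) * two_power 0 s)"
      proof (cases "0 < s")
        case True
        have "min 1 (s powr (-2)) \<le> two_power 0 s"
          using True by (auto simp: two_power_def split: split_indicator)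
        then have "fact (m + 3) * min 1 (s powr (-2)) \<le> fact (m + 3) * two_power 0 s"
          by (intro mult_left_mono) auto
        with tail_kernel_le[OF True, of m]
        have "\<bar>tail_kernel m s\<bar> \<le> fact (m + 3) * two_power 0 s" by (rule order_trans)
        then show ?thesis using True by (simp add: abs_mult)
      qed simp
    qed
  qed measurable
  have meas: "case_prod ?h \<in> borel_measurable (D \<Otimes>\<^sub>M lborel)"
    by measurable
  have int: "integrable (D \<Otimes>\<^sub>M lborel) (case_prod ?h)"
  proof (rule Fubini_integrable[OF meas])
    show "AE u in D. integrable lborel (\<lambda>s. case_prod ?h (u, s))"
      by (auto intro!: Bochner_Integration.integrable_bound[OF b] split: split_indicator)
    show "integrable D (\<lambda>u. \<integral>s. norm (case_prod ?h (u, s)) \<partial>lborel)"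
    proof (rule D.integrable_const_bound)
      show "AE u in D. norm (\<integral>s. norm (case_prod ?h (u, s)) \<partial>lborel) \<le> (\<integral>s. norm (?b s) \<partial>lborel)"
        by (intro AE_I2, subst real_norm_def, subst abs_of_nonneg)
          (auto intro!: integral_mono_AE' integrable_norm b split: split_indicator)
    qed measurable
  qed
  have inner1: "(\<integral>s. ?h u s \<partial>lborel) = tail_primitive m (x * u)" if "0 \<le> u" for u
  proof -
    have "(\<integral>s. ?h u s \<partial>lborel) = (\<integral>s. tail_kernel m s * indicator {0..x * u} s \<partial>lborel)"
    proof (rule integral_cong_AE)
      have "AE s in lborel. s \<noteq> 0 \<and> s \<noteq> x * u"
        using AE_lborel_singleton[of 0] AE_lborel_singleton[of "x * u"] by eventually_elim simp
      then show "AE s in lborel. ?h u s = tail_kernel m s * indicator {0..x * u} s"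
        by eventually_elim (auto split: split_indicator)
    qed measurable
    also have "\<dots> = tail_primitive m (x * u) - tail_primitive m 0"
      using that x by (intro integral_FTC_Icc_real tail_primitive_deriv tail_kernel_cont) auto
    finally show ?thesis by simp
  qed
  have inner2: "(\<integral>u. ?h u s \<partial>D) = indicator {0<..} s * tail_kernel m s * tail (x / s)" for s
  proof -
    have "(\<integral>u. ?h u s \<partial>D) = ?b s * (\<integral>u. indicator {s / x<..} u \<partial>D)"
      unfolding integral_mult_right_zero[symmetric]
      using x by (intro Bochner_Integration.integral_cong) (auto simp: field_simps split: split_indicator)
    then show ?thesis by (simp add: tail_def)
  qed
  have "tail_moment m x = (\<integral>u. (\<integral>s. ?h u s \<partial>lborel) \<partial>D)"
    unfolding tail_moment_def
  proof (rule integral_cong_AE)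
    show "AE u in D. tail_primitive m (x * \<bar>u\<bar>) = (\<integral>s. ?h u s \<partial>lborel)"
      using AE_nonneg by eventually_elim (simp only: inner1 abs_of_nonneg)
  qed measurable
  also have "\<dots> = (\<integral>s. (\<integral>u. ?h u s \<partial>D) \<partial>lborel)"
    using Fubini_integral[OF int] by simp
  finally show "tail_moment m x = (\<integral>s. indicator {0<..} s * tail_kernel m s * tail (x / s) \<partial>lborel)"
    unfolding inner2 .
  show "integrable lborel (\<lambda>s. indicator {0<..} s * tail_kernel m s * tail (x / s))"
    using integrable_snd[OF int] unfolding inner2 .
qed

lemma tail_half: "((\<lambda>x. tail (1/2 * x) / tail x) \<longlongrightarrow> (1/2) powr \<alpha>) (at_right 0)"
  by (rule tail_ratio) simp

text \<open>The Potter bound is read backwards, at the argument x / s with ratio s. The exponent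
  (\<alpha> + 1) / 2 exceeds \<alpha>, as Potter requires, and is below 1, so that the bound is
  integrable at 0.\<close>

lemma tail_dominated:
  obtains C x0 where "C > 0" "x0 > 0"
    "\<And>x s. 0 < x \<Longrightarrow> x \<le> x0 \<Longrightarrow> 0 < s \<Longrightarrow> s \<le> 1 \<Longrightarrow> tail (x / s) / tail x \<le> C * s powr (- ((\<alpha> + 1) / 2))"
proof -
  let ?\<eta> = "(\<alpha> + 1) / 2"
  obtain c x0 where c: "c > 0" "x0 > 0"
    "\<And>x s. 0 < x \<Longrightarrow> x \<le> x0 \<Longrightarrow> 0 < s \<Longrightarrow> s \<le> 1 \<Longrightarrow> c * s powr ?\<eta> * tail x \<le> tail (x * s)"
    by (rule potter_lower[of tail \<alpha> ?\<eta>]) (use tail_mono tail_pos tail_half alpha in auto)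
  have "tail (x / s) / tail x \<le> (1 / (c * tail x0)) * s powr (- ?\<eta>)" if *: "0 < x" "x \<le> x0" "0 < s" "s \<le> 1" for x s
  proof -
    have "c * tail x0 * s powr ?\<eta> * tail (x / s) \<le> tail x"
    proof (cases "x / s \<le> x0")
      case True
      have "c * tail x0 * s powr ?\<eta> * tail (x / s) = tail x0 * (c * s powr ?\<eta> * tail (x / s))" by simp
      also have "\<dots> \<le> 1 * tail (x / s * s)"
        using c * True tail_pos by (intro mult_mono c(3) tail_le_1) (auto intro: less_imp_le)
      finally show ?thesis using * by simp
    next
      \<comment> \<open>Here x / s has left the range of the Potter bound. The tail there is at most
        1, and Potter is applied at x0 instead, with the ratio x / x0, which exceeds s.\<close>
      case False
      have "c * tail x0 * s powr ?\<eta> * tail (x / s) \<le> c * tail x0 * s powr ?\<eta> * 1"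
        using c * tail_pos[of x0] by (intro mult_left_mono tail_le_1) auto
      also have "\<dots> = c * s powr ?\<eta> * tail x0" by simp
      also have "\<dots> \<le> c * (x / x0) powr ?\<eta> * tail x0"
      proof -
        have "s \<le> x / x0" using False * c by (simp add: field_simps)
        then show ?thesis
          using c * tail_pos[of x0] alpha by (intro mult_right_mono mult_left_mono powr_mono2) auto
      qed
      also have "\<dots> \<le> tail (x0 * (x / x0))"
        using c * by (intro c(3)) auto
      finally show ?thesis using c by simp
    qed
    then have "c * tail x0 * (s powr ?\<eta> * (tail (x / s) / tail x)) \<le> 1"
      using tail_pos[OF *(1)] by (simp add: field_simps)
    then show ?thesis
      using tail_pos[OF c(2)] c * by (simp only: powr_minus) (simp add: field_simps)
  qed
  then show thesis using c tail_pos[of x0] by (intro that[of "1 / (c * tail x0)" x0]) auto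
qed

text \<open>In terms of the Gamma function this is \<Gamma>(1 - \<alpha>) for m = 0 and \<alpha>
  \<Gamma>(m - \<alpha>) for m > 0. The body mentions \<alpha> but not the law, and this is what
  makes the limit universal.\<close>

definition "tail_const m = (\<integral>s. indicator {0<..} s * tail_kernel m s * s powr (- \<alpha>) \<partial>lborel)"

text \<open>An Abelian theorem. Divided by \<open>tail x\<close>, the integrand of the layer-cake
  formula converges to the kernel times s^(-\<alpha>). It is dominated by the Potter bound for s <=
  1 and by monotonicity of the tail for s > 1.\<close>

lemma tail_moment_asymp: "((\<lambda>x. tail_moment m x / tail x) \<longlongrightarrow> tail_const m) (at_right 0)"
proof -
  let ?\<eta> = "(\<alpha> + 1) / 2"
  obtain C x0 where C: "C > 0" "x0 > 0"
    "\<And>x s. 0 < x \<Longrightarrow> x \<le> x0 \<Longrightarrow> 0 < s \<Longrightarrow> s \<le> 1 \<Longrightarrow> tail (x / s) / tail x \<le> C * s powr (- ?\<eta>)"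
    using tail_dominated by blast
  let ?f = "\<lambda>t s. indicator {0<..} s * tail_kernel m s * (tail (inverse t / s) / tail (inverse t))"
  let ?w = "\<lambda>s. fact (m + 3) * (1 + C) * two_power (- ?\<eta>) s"
  have [measurable]: "(\<lambda>s. tail (a / s)) \<in> borel_measurable borel" for a
  proof -
    have "tail (a / s) = measure D {s / a<..}" for s by (simp add: tail_def)
    moreover have "mono (\<lambda>s. - measure D {s<..})"
      by (auto intro!: monoI D.finite_measure_mono)
    then have "(\<lambda>s. - measure D {s<..}) \<in> borel_measurable borel" by (rule borel_measurable_mono)
    then have [measurable]: "(\<lambda>s. measure D {s<..}) \<in> borel_measurable borel" by simp
    ultimately show ?thesis by simp
  qed
  have bound: "norm (?f t s) \<le> ?w s" if t: "inverse t \<le> x0" "0 < t" for t s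
  proof (cases "0 < s")
    case True
    have p: "0 < tail (inverse t)" using t by (intro tail_pos) auto
    have "norm (?f t s) = \<bar>tail_kernel m s\<bar> * (tail (inverse t / s) / tail (inverse t))"
      using True p t tail_pos[of "inverse t / s"] by (simp add: abs_mult)
    also have "\<dots> \<le> (fact (m + 3) * min 1 (s powr (- 2))) * ((1 + C) * (if s \<le> 1 then s powr (- ?\<eta>) else 1))"
    proof (intro mult_mono tail_kernel_le True)
      show "tail (inverse t / s) / tail (inverse t) \<le> (1 + C) * (if s \<le> 1 then s powr (- ?\<eta>) else 1)"
      proof (cases "s \<le> 1")
        case s1: True
        have "tail (inverse t / s) / tail (inverse t) \<le> C * s powr (- ?\<eta>)"
          using t True s1 by (intro C(3)) auto
        also have "\<dots> \<le> (1 + C) * s powr (- ?\<eta>)" by (intro mult_right_mono) auto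
        finally show ?thesis using s1 by simp
      next
        case False
        have "tail (inverse t / s) \<le> tail (inverse t)"
          using t False by (intro tail_mono) (auto simp: field_simps)
        then have "tail (inverse t / s) / tail (inverse t) \<le> 1" using p by simp
        then show ?thesis using False C(1) by simp
      qed
    qed (use p tail_pos[of "inverse t / s"] t True C in auto)
    also have "\<dots> = (fact (m + 3) * (1 + C)) * (min 1 (s powr (- 2)) * (if s \<le> 1 then s powr (- ?\<eta>) else 1))"
      by simp
    also have "\<dots> \<le> (fact (m + 3) * (1 + C)) * two_power (- ?\<eta>) s"
      using True C(1) by (intro mult_left_mono) (auto simp: two_power_def split: split_indicator intro!: mult_left_le_one_le)
    finally show ?thesis .
  qed (use C in simp)
  have "((\<lambda>t. \<integral>s. ?f t s \<partial>lborel) \<longlongrightarrow> tail_const m) at_top"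
    unfolding tail_const_def
  proof (rule integral_dominated_convergence_at_top)
    show "integrable lborel ?w"
      using alpha by (intro integrable_mult_right two_power_integrable) (simp add: field_simps)
    have "\<forall>\<^sub>F t in at_top. inverse t \<le> x0 \<and> 0 < t"
      using C(2) by (intro eventually_at_top_linorderI[of "max 1 (1 / x0)"]) (auto simp: field_simps)
    then show "\<forall>\<^sub>F t in at_top. AE s in lborel. norm (?f t s) \<le> ?w s"
      by eventually_elim (intro AE_I2 bound, auto)
    show "AE s in lborel. ((\<lambda>t. ?f t s) \<longlongrightarrow> indicator {0<..} s * tail_kernel m s * s powr (- \<alpha>)) at_top"
    proof (rule AE_I2)
      fix s :: real
      show "((\<lambda>t. ?f t s) \<longlongrightarrow> indicator {0<..} s * tail_kernel m s * s powr (- \<alpha>)) at_top"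
      proof (cases "0 < s")
        case True
        have "((\<lambda>x. tail (1 / s * x) / tail x) \<longlongrightarrow> (1 / s) powr \<alpha>) (at_right 0)"
          using True by (intro tail_ratio) simp
        then have "((\<lambda>t. tail (inverse t / s) / tail (inverse t)) \<longlongrightarrow> s powr (- \<alpha>)) at_top"
          using True by (simp add: filterlim_at_right_to_top powr_divide powr_minus_divide)
        then show ?thesis by (intro tendsto_intros)
      qed simp
    qed
  qed measurable
  moreover have "\<forall>\<^sub>F t in at_top. (\<integral>s. ?f t s \<partial>lborel) = tail_moment m (inverse t) / tail (inverse t)"
    using eventually_gt_at_top[of 0]
  proof eventually_elim
    case (elim t)
    have "(\<integral>s. ?f t s \<partial>lborel) = (\<integral>s. (indicator {0<..} s * tail_kernel m s * tail (inverse t / s)) / tail (inverse t) \<partial>lborel)"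
      by (simp add: mult.assoc)
    also have "\<dots> = tail_moment m (inverse t) / tail (inverse t)"
      using elim by (subst tail_moment_eq(1)) auto
    finally show ?case .
  qed
  ultimately have "((\<lambda>t. tail_moment m (inverse t) / tail (inverse t)) \<longlongrightarrow> tail_const m) at_top"
    by (rule Lim_transform_eventually)
  then show ?thesis by (simp add: filterlim_at_right_to_top)
qed


section \<open>One minus the Laplace transform, and the norming sequence\<close>

text \<open>This is 1 - E exp (- x U), a reference scale asymptotically proportional to
  \<open>tail\<close>. Unlike the tail it is continuous, so an equation in it can be solved
  exactly.\<close>

definition "exponent x = tail_moment 0 x"

lemma exponent_eq: "exponent x = (\<integral>u. 1 - exp (- (x * \<bar>u\<bar>)) \<partial>D)"
  by (simp add: exponent_def tail_moment_def tail_primitive_def)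

lemma integrable_primitive: "0 \<le> x \<Longrightarrow> integrable D (\<lambda>u. tail_primitive m (x * \<bar>u\<bar>))"
proof (rule D.integrable_const_bound)
  assume x: "0 \<le> x"
  show "AE u in D. norm (tail_primitive m (x * \<bar>u\<bar>)) \<le> 2 * fact m"
  proof (rule AE_I2)
    fix u
    have "tail_primitive m (x * \<bar>u\<bar>) \<le> 2 * fact m * (1 - exp (- (x * \<bar>u\<bar>)))"
      using x by (intro tail_primitive_le) simp
    also have "\<dots> \<le> 2 * fact m * 1" by (intro mult_left_mono) auto
    finally show "norm (tail_primitive m (x * \<bar>u\<bar>)) \<le> 2 * fact m"
      using tail_primitive_nonneg[of "x * \<bar>u\<bar>" m] x by simp
  qed
qed measurable

lemma integrable_exponent: "0 \<le> x \<Longrightarrow> integrable D (\<lambda>u. 1 - exp (- (x * \<bar>u\<bar>)))"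
  using integrable_primitive[of x 0] by (simp add: tail_primitive_def)

lemma tail_moment_nonneg: "0 \<le> x \<Longrightarrow> 0 \<le> tail_moment m x"
  unfolding tail_moment_def by (intro Bochner_Integration.integral_nonneg tail_primitive_nonneg) simp

lemma tail_moment_le: "0 \<le> x \<Longrightarrow> tail_moment m x \<le> 2 * fact m * exponent x"
  unfolding exponent_eq tail_moment_def integral_mult_right_zero[symmetric]
  by (intro integral_mono integrable_mult_right integrable_exponent integrable_primitive tail_primitive_le) auto

lemma exponent_mono: "0 \<le> x \<Longrightarrow> x \<le> y \<Longrightarrow> exponent x \<le> exponent y"
  unfolding exponent_eq by (intro integral_mono integrable_exponent) (auto intro: mult_right_mono)

lemma exponent_le_1: "0 \<le> x \<Longrightarrow> exponent x \<le> 1"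
proof -
  assume "0 \<le> x"
  then have "exponent x \<le> (\<integral>u. 1 \<partial>D)"
    unfolding exponent_eq by (intro integral_mono integrable_exponent) auto
  then show ?thesis using D.prob_space by simp
qed

lemma exponent_nonneg: "0 \<le> x \<Longrightarrow> 0 \<le> exponent x"
  unfolding exponent_def by (rule tail_moment_nonneg)

text \<open>The function 1 - exp (- x u) of x is concave and vanishes at 0; the proof uses convexity
  of exp between 0 and the point - x s u.\<close>

lemma exponent_scale:
  assumes "0 \<le> x" "1 \<le> s" shows "exponent (x * s) \<le> s * exponent x"
proof -
  have "1 - exp (- (x * s * \<bar>u\<bar>)) \<le> s * (1 - exp (- (x * \<bar>u\<bar>)))" for u
  proof -
    have "exp ((1 - 1 / s) *\<^sub>R 0 + (1 / s) *\<^sub>R (- (x * s * \<bar>u\<bar>))) \<le> (1 - 1 / s) * exp 0 + (1 / s) * exp (- (x * s * \<bar>u\<bar>))"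
      using assms by (intro convex_onD[OF exp_convex]) auto
    then have "exp (- (x * \<bar>u\<bar>)) \<le> (1 - 1 / s) + (1 / s) * exp (- (x * s * \<bar>u\<bar>))"
      using assms by simp
    then have "s * exp (- (x * \<bar>u\<bar>)) \<le> s * ((1 - 1 / s) + (1 / s) * exp (- (x * s * \<bar>u\<bar>)))"
      using assms by (intro mult_left_mono) auto
    also have "\<dots> = s - 1 + exp (- (x * s * \<bar>u\<bar>))" using assms by (simp add: field_simps)
    finally show ?thesis by (simp add: algebra_simps)
  qed
  then have "exponent (x * s) \<le> (\<integral>u. s * (1 - exp (- (x * \<bar>u\<bar>))) \<partial>D)"
    unfolding exponent_eq using assms
    by (intro integral_mono integrable_mult_right integrable_exponent) auto
  then show ?thesis unfolding exponent_eq by simp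
qed

lemma exponent_ge_tail: "0 < x \<Longrightarrow> (1 - exp (- 1)) * tail x \<le> exponent x"
proof -
  assume x: "0 < x"
  have "(1 - exp (- 1)) * tail x = (\<integral>u. (1 - exp (- 1)) * indicator {1 / x<..} u \<partial>D)"
    by (simp add: tail_def)
  also have "\<dots> \<le> exponent x"
    unfolding exponent_eq
  proof (intro integral_mono integrable_exponent integrable_mult_right)
    fix u
    show "(1 - exp (- 1)) * indicator {1 / x<..} u \<le> 1 - exp (- (x * \<bar>u\<bar>))"
    proof (cases "1 / x < u")
      case True
      then have "0 < u" using x by (metis less_trans zero_less_divide_1_iff)
      then have "1 \<le> x * \<bar>u\<bar>" using x True by (simp add: field_simps)
      then show ?thesis using True by simp
    qed (use x in simp)
    show "integrable D (indicator {1 / x<..} :: real \<Rightarrow> real)"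
      by (rule D.integrable_const_bound[of _ 1]) auto
  qed (use x in auto)
  finally show ?thesis .
qed

lemma exponent_pos: "0 < x \<Longrightarrow> 0 < exponent x"
  using exponent_ge_tail[of x] tail_pos[of x]
  by (intro less_le_trans[OF _ exponent_ge_tail]) auto

text \<open>Positivity is read off from the limit it describes: the ratio of \<open>exponent\<close>
  to \<open>tail\<close> never falls below 1 - exp (- 1).\<close>

lemma tail_const_0_pos: "0 < tail_const 0"
proof -
  have "1 - exp (- 1) \<le> tail_const 0"
  proof (rule tendsto_lowerbound[OF tail_moment_asymp])
    show "\<forall>\<^sub>F x in at_right 0. 1 - exp (- 1) \<le> tail_moment 0 x / tail x"
    proof -
      have "1 - exp (- 1) \<le> tail_moment 0 x / tail x" if "0 < x" for x
        using exponent_ge_tail[OF that] tail_pos[OF that]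
        by (simp add: exponent_def pos_le_divide_eq)
      then show ?thesis by (auto simp: eventually_at_right[of 0 1] intro!: exI[of _ 1])
    qed
  qed simp
  then show ?thesis by (rule less_le_trans[rotated]) simp
qed

lemma filterlim_scale_at_right: "0 < (s::real) \<Longrightarrow> filterlim (\<lambda>x. s * x) (at_right 0) (at_right 0)"
  unfolding filterlim_at
proof safe
  assume s: "0 < s"
  show "((\<lambda>x. s * x) \<longlongrightarrow> 0) (at_right 0)"
    by (auto intro!: tendsto_eq_intros)
  show "\<forall>\<^sub>F x in at_right 0. s * x \<in> {0<..} \<and> s * x \<noteq> 0"
    using s by (auto simp: eventually_at_right[of 0 1] intro!: exI[of _ 1])
qed

lemma tail_moment_ratio:
  assumes s: "0 < s"
  shows "((\<lambda>x. tail_moment m (s * x) / exponent x) \<longlongrightarrow> tail_const m / tail_const 0 * s powr \<alpha>) (at_right 0)"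
proof -
  have "((\<lambda>x. (tail_moment m (s * x) / tail (s * x)) * (tail (s * x) / tail x) / (tail_moment 0 x / tail x))
    \<longlongrightarrow> tail_const m * s powr \<alpha> / tail_const 0) (at_right 0)"
    using tail_const_0_pos s
    by (intro tendsto_intros tail_ratio tail_moment_asymp
        filterlim_compose[OF tail_moment_asymp filterlim_scale_at_right]) auto
  moreover have "\<forall>\<^sub>F x in at_right 0. (tail_moment m (s * x) / tail (s * x)) * (tail (s * x) / tail x) / (tail_moment 0 x / tail x)
     = tail_moment m (s * x) / exponent x"
  proof -
    have "(tail_moment m (s * x) / tail (s * x)) * (tail (s * x) / tail x) / (tail_moment 0 x / tail x)
     = tail_moment m (s * x) / exponent x" if "0 < x" for x
      using tail_pos[of x] tail_pos[of "s * x"] s that by (simp add: exponent_def)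
    then show ?thesis by (auto simp: eventually_at_right[of 0 1] intro!: exI[of _ 1])
  qed
  ultimately have "((\<lambda>x. tail_moment m (s * x) / exponent x) \<longlongrightarrow> tail_const m * s powr \<alpha> / tail_const 0) (at_right 0)"
    by (rule Lim_transform_eventually)
  then show ?thesis by (simp add: mult_ac)
qed

lemma exponent_half: "((\<lambda>x. exponent (1/2 * x) / exponent x) \<longlongrightarrow> (1/2) powr \<alpha>) (at_right 0)"
  using tail_moment_ratio[of "1/2" 0] tail_const_0_pos by (simp add: exponent_def)

lemma exponent_cont: "continuous_on {0..} exponent"
proof -
  have "continuous_on {0..} (\<lambda>x. \<integral>u. 1 - exp (- (x * \<bar>u\<bar>)) \<partial>D)"
    unfolding continuous_on_sequentially
  proof safe
    fix X and a :: real assume X: "\<forall>n. X n \<in> {0..}" "X \<longlonglongrightarrow> a" "0 \<le> a"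
    show "((\<lambda>x. \<integral>u. 1 - exp (- (x * \<bar>u\<bar>)) \<partial>D) \<circ> X) \<longlonglongrightarrow> (\<integral>u. 1 - exp (- (a * \<bar>u\<bar>)) \<partial>D)"
      unfolding comp_def using X
      by (intro integral_dominated_convergence[where w = "\<lambda>_. 1"]) (auto intro!: tendsto_intros)
  qed
  then show ?thesis by (simp add: exponent_eq[abs_def])
qed

text \<open>The choice is meaningful only for large \<open>n\<close>, see \<open>norming_spec\<close>.\<close>

definition norming :: "nat \<Rightarrow> real" where "norming n = (SOME b. 0 < b \<and> real n * exponent b = 1)"

text \<open>The intermediate value theorem on [0, 1], applicable once 1 / n is below
  \<open>exponent 1\<close>. At b = \<open>norming n\<close> the Laplace transform of a row sum is
  (1 - 1/n)^n, so 1 / b is the order of magnitude of the row sums.\<close>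

lemma norming_spec: "\<forall>\<^sub>F n in sequentially. 0 < norming n \<and> real n * exponent (norming n) = 1"
proof -
  define n0 where "n0 = nat \<lceil>1 / exponent 1\<rceil> + 1"
  have "0 < norming n \<and> real n * exponent (norming n) = 1" if n: "n \<ge> n0" for n
  proof -
    have npos: "0 < real n" using n by (simp add: n0_def)
    have "1 / exponent 1 \<le> real n" using n unfolding n0_def by linarith
    then have "1 / real n \<le> exponent 1"
      using exponent_pos[of 1] npos by (simp add: field_simps)
    moreover have "exponent 0 \<le> 1 / real n" using npos by (simp add: exponent_eq)
    moreover have "continuous_on {0..1} exponent"
      by (rule continuous_on_subset[OF exponent_cont]) auto
    ultimately obtain b where "0 \<le> b" "exponent b = 1 / real n"
      using IVT'[of exponent 0 "1 / real n" 1] by auto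
    moreover from this have "b \<noteq> 0" using npos by (auto simp: exponent_eq)
    ultimately have "0 < b \<and> real n * exponent b = 1" using npos by simp
    then show ?thesis unfolding norming_def by (rule someI)
  qed
  then show ?thesis by (auto simp: eventually_sequentially)
qed

lemma norming_tendsto: "filterlim norming (at_right 0) sequentially"
proof -
  have "\<forall>\<^sub>F n in sequentially. norming n < e" if e: "0 < e" for e
  proof -
    have "\<forall>\<^sub>F n in sequentially. 1 / exponent e < real n"
      using filterlim_real_sequentially by (auto simp: filterlim_at_top_dense)
    then show ?thesis using norming_spec
    proof eventually_elim
      case (elim n)
      show ?case
      proof (rule ccontr)
        assume "\<not> norming n < e"
        then have "exponent e \<le> exponent (norming n)" using e by (intro exponent_mono) auto
        then have "real n * exponent e \<le> 1" using elim by (metis mult_left_mono of_nat_0_le_iff)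
        then show False using elim exponent_pos[OF e] by (simp add: field_simps)
      qed
    qed
  qed
  then have "norming \<longlonglongrightarrow> 0"
    unfolding tendsto_iff dist_real_def
  proof (intro allI impI)
    fix e :: real assume "0 < e"
    then have "\<forall>\<^sub>F n in sequentially. norming n < e" by fact
    with norming_spec show "\<forall>\<^sub>F n in sequentially. \<bar>norming n - 0\<bar> < e" by eventually_elim auto
  qed
  then show ?thesis
    unfolding filterlim_at using norming_spec by (auto elim: eventually_mono)
qed

lemma tail_moment_scaled_tendsto:
  assumes s: "0 < s"
  shows "(\<lambda>n. real n * tail_moment m (norming n * s)) \<longlonglongrightarrow> tail_const m / tail_const 0 * s powr \<alpha>"
proof -
  have "(\<lambda>n. tail_moment m (s * norming n) / exponent (norming n)) \<longlonglongrightarrow> tail_const m / tail_const 0 * s powr \<alpha>"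
    by (rule filterlim_compose[OF tail_moment_ratio[OF s] norming_tendsto])
  moreover have "\<forall>\<^sub>F n in sequentially. tail_moment m (s * norming n) / exponent (norming n) = real n * tail_moment m (norming n * s)"
    using norming_spec
  proof eventually_elim
    case (elim n)
    then have "exponent (norming n) = 1 / real n" by (metis nonzero_eq_divide_eq mult.commute mult_zero_right zero_neq_one)
    then show ?case by (simp add: mult_ac)
  qed
  ultimately show ?thesis by (rule Lim_transform_eventually)
qed

lemma exponent_scaled_tendsto:
  "0 < s \<Longrightarrow> (\<lambda>n. real n * exponent (norming n * s)) \<longlonglongrightarrow> s powr \<alpha>"
  using tail_moment_scaled_tendsto[of s 0] tail_const_0_pos by (simp add: exponent_def)

text \<open>The Potter bound at the fixed point x0 with the ratio x / x0. Only an exponent strictly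
  below 1 is of use later; (\<alpha> + 1) / 2 lies between \<alpha> and 1.\<close>

lemma exponent_lower:
  obtains c x0 where "c > 0" "x0 > 0" "\<And>x. 0 < x \<Longrightarrow> x \<le> x0 \<Longrightarrow> c * x powr ((\<alpha> + 1) / 2) \<le> exponent x"
proof -
  let ?\<eta> = "(\<alpha> + 1) / 2"
  obtain c x0 where c: "c > 0" "x0 > 0"
    "\<And>x s. 0 < x \<Longrightarrow> x \<le> x0 \<Longrightarrow> 0 < s \<Longrightarrow> s \<le> 1 \<Longrightarrow> c * s powr ?\<eta> * exponent x \<le> exponent (x * s)"
    by (rule potter_lower[of exponent \<alpha> ?\<eta>]) (use exponent_mono exponent_pos exponent_half alpha in auto)
  have "c * exponent x0 / x0 powr ?\<eta> * x powr ?\<eta> \<le> exponent x" if "0 < x" "x \<le> x0" for x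
    using c(3)[of x0 "x / x0"] that c by (simp add: powr_divide mult_ac)
  then show thesis
    using c(1,2) exponent_pos[of x0] by (intro that[of "c * exponent x0 / x0 powr ?\<eta>" x0]) simp_all
qed

text \<open>Here \<alpha> < 1 is decisive: row sums, of order 1 / b, are much larger than n. Indeed
  c b^((\<alpha> + 1)/2) <= 1 / n, hence n b is at most b^((1 - \<alpha>)/2) / c.\<close>

lemma n_norming_tendsto: "(\<lambda>n. real n * norming n) \<longlonglongrightarrow> 0"
proof -
  obtain c x0 where c: "c > 0" "x0 > 0" "\<And>x. 0 < x \<Longrightarrow> x \<le> x0 \<Longrightarrow> c * x powr ((\<alpha> + 1) / 2) \<le> exponent x"
    by (rule exponent_lower) blast
  have le: "\<forall>\<^sub>F n in sequentially. norming n \<le> x0"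
    using norming_tendsto c(2) unfolding filterlim_at
    by (auto dest!: order_tendstoD(2)[of _ 0 _ x0] elim: eventually_mono)
  show ?thesis
  proof (rule tendsto_sandwich[where f = "\<lambda>_. 0" and h = "\<lambda>n. 1 / c * norming n powr ((1 - \<alpha>) / 2)"])
    show "\<forall>\<^sub>F n in sequentially. 0 \<le> real n * norming n"
      using norming_spec by eventually_elim auto
    show "\<forall>\<^sub>F n in sequentially. real n * norming n \<le> 1 / c * norming n powr ((1 - \<alpha>) / 2)"
      using norming_spec le
    proof eventually_elim
      case (elim n)
      have "c * norming n powr ((\<alpha> + 1) / 2) * real n \<le> exponent (norming n) * real n"
        using elim by (intro mult_right_mono c(3)) auto
      then have "norming n powr ((\<alpha> + 1) / 2) * real n \<le> 1 / c"
        using elim c by (simp add: field_simps)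
      then have "norming n powr ((1 - \<alpha>) / 2) * (norming n powr ((\<alpha> + 1) / 2) * real n) \<le> norming n powr ((1 - \<alpha>) / 2) * (1 / c)"
        by (intro mult_left_mono) auto
      moreover have "norming n powr ((1 - \<alpha>) / 2) * norming n powr ((\<alpha> + 1) / 2) = norming n"
        using elim by (subst powr_add[symmetric]) (simp add: field_simps)
      ultimately show ?case by (simp add: mult_ac)
    qed
    have "(\<lambda>n. norming n powr ((1 - \<alpha>) / 2)) \<longlonglongrightarrow> 0 powr ((1 - \<alpha>) / 2)"
      using norming_tendsto norming_spec alpha unfolding filterlim_at
      by (intro tendsto_powr') (auto elim: eventually_mono)
    then show "(\<lambda>n. 1 / c * norming n powr ((1 - \<alpha>) / 2)) \<longlonglongrightarrow> 0"
      using tendsto_mult_left[of _ 0 _ "1 / c"] by simp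
  qed auto
qed

lemma exponent_norming_tendsto_0: "0 < y \<Longrightarrow> (\<lambda>n. exponent (norming n * y)) \<longlonglongrightarrow> 0"
proof -
  assume y: "0 < y"
  have "(\<lambda>n. (real n * exponent (norming n * y)) * inverse (real n)) \<longlonglongrightarrow> y powr \<alpha> * 0"
    by (intro tendsto_mult exponent_scaled_tendsto[OF y] lim_inverse_n)
  then have "(\<lambda>n. (real n * exponent (norming n * y)) * inverse (real n)) \<longlonglongrightarrow> 0" by simp
  moreover have "\<forall>\<^sub>F n in sequentially. (real n * exponent (norming n * y)) * inverse (real n) = exponent (norming n * y)"
    using eventually_gt_at_top[of 0] by eventually_elim simp
  ultimately show ?thesis by (rule Lim_transform_eventually)
qed

text \<open>In the Gamma integral of a walk, this is what a vertex with variable y receives from the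
  damping and from its n - v weights towards vertices that the walk does not visit. The power is
  squeezed by means of exp (- z / (1 - z)) <= 1 - z <= exp (- z).\<close>

lemma vertex_factor_tendsto:
  assumes y: "0 < y"
  shows "(\<lambda>n. exp (- (real n * norming n * y)) * (1 - exponent (norming n * y)) ^ (n - v)) \<longlonglongrightarrow> exp (- (y powr \<alpha>))"
proof -
  let ?z = "\<lambda>n. exponent (norming n * y)"
  have z: "(\<lambda>n. real n * ?z n) \<longlonglongrightarrow> y powr \<alpha>" by (rule exponent_scaled_tendsto[OF y])
  have z0: "?z \<longlonglongrightarrow> 0" by (rule exponent_norming_tendsto_0[OF y])
  have "(\<lambda>n. real n * ?z n - real v * ?z n) \<longlonglongrightarrow> y powr \<alpha> - real v * 0"
    by (intro tendsto_intros z z0)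
  moreover have "\<forall>\<^sub>F n in sequentially. real n * ?z n - real v * ?z n = real (n - v) * ?z n"
    using eventually_ge_at_top[of v] by eventually_elim (simp add: algebra_simps of_nat_diff)
  ultimately have nv: "(\<lambda>n. real (n - v) * ?z n) \<longlonglongrightarrow> y powr \<alpha>"
    using Lim_transform_eventually by fastforce
  have "(\<lambda>n. (1 - ?z n) ^ (n - v)) \<longlonglongrightarrow> exp (- (y powr \<alpha>))"
  proof (rule tendsto_sandwich)
    have small: "\<forall>\<^sub>F n in sequentially. ?z n < 1"
      using z0 by (rule order_tendstoD) simp
    show "\<forall>\<^sub>F n in sequentially. exp (- (real (n - v) * ?z n / (1 - ?z n))) \<le> (1 - ?z n) ^ (n - v)"
      using small
    proof eventually_elim
      case (elim n)
      have "1 + ?z n / (1 - ?z n) \<le> exp (?z n / (1 - ?z n))" by simp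
      then have "exp (- (?z n / (1 - ?z n))) \<le> 1 - ?z n"
      proof -
        have e: "1 + ?z n / (1 - ?z n) = 1 / (1 - ?z n)" using elim by (simp add: field_simps)
        have "1 / exp (?z n / (1 - ?z n)) \<le> 1 / (1 / (1 - ?z n))"
          using \<open>1 + ?z n / (1 - ?z n) \<le> _\<close> elim unfolding e by (intro divide_left_mono) auto
        then show ?thesis by (simp add: exp_minus inverse_eq_divide)
      qed
      then have "exp (- (?z n / (1 - ?z n))) ^ (n - v) \<le> (1 - ?z n) ^ (n - v)"
        by (intro power_mono) auto
      then show ?case by (simp add: exp_of_nat_mult[symmetric])
    qed
    show "\<forall>\<^sub>F n in sequentially. (1 - ?z n) ^ (n - v) \<le> exp (- (real (n - v) * ?z n))"
      using small
    proof eventually_elim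
      case (elim n)
      have "1 - ?z n \<le> exp (- ?z n)" using exp_ge_add_one_self[of "- ?z n"] by simp
      then have "(1 - ?z n) ^ (n - v) \<le> exp (- ?z n) ^ (n - v)"
        using elim by (intro power_mono) auto
      then show ?case by (simp add: exp_of_nat_mult[symmetric])
    qed
    show "(\<lambda>n. exp (- (real (n - v) * ?z n))) \<longlonglongrightarrow> exp (- (y powr \<alpha>))"
      by (intro tendsto_intros nv)
    have "(\<lambda>n. exp (- (real (n - v) * ?z n / (1 - ?z n)))) \<longlonglongrightarrow> exp (- (y powr \<alpha> / (1 - 0)))"
      by (intro tendsto_intros nv z0) simp
    then show "(\<lambda>n. exp (- (real (n - v) * ?z n / (1 - ?z n)))) \<longlonglongrightarrow> exp (- (y powr \<alpha>))" by simp
  qed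
  moreover have "(\<lambda>n. exp (- (real n * norming n * y))) \<longlonglongrightarrow> exp (- (0 * y))"
    by (intro tendsto_intros n_norming_tendsto)
  ultimately have "(\<lambda>n. exp (- (real n * norming n * y)) * (1 - ?z n) ^ (n - v)) \<longlonglongrightarrow> exp (- (0 * y)) * exp (- (y powr \<alpha>))"
    by (intro tendsto_mult)
  then show ?thesis by simp
qed

lemma exponent_upper:
  obtains C x0 where "C > 0" "x0 > 0"
    "\<And>x s. 0 < x \<Longrightarrow> x \<le> x0 \<Longrightarrow> 0 < s \<Longrightarrow> s \<le> 1 \<Longrightarrow> exponent (x * s) \<le> C * s powr (\<alpha> / 2) * exponent x"
  by (rule potter_upper[of exponent \<alpha> "\<alpha> / 2"]) (use exponent_mono exponent_pos exponent_half alpha in auto)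

lemma norming_le: "0 < e \<Longrightarrow> \<forall>\<^sub>F n in sequentially. norming n \<le> e"
  using norming_tendsto unfolding filterlim_at
  by (auto dest!: order_tendstoD(2)[of _ 0 _ e] elim: eventually_mono)

text \<open>For s <= 1 this is the upper Potter bound with exponent \<alpha>/2, for s > 1 the
  concavity bound \<open>exponent_scale\<close>; the factor 1 + s covers both.\<close>

lemma exponent_scaled_dominated:
  obtains C where "C > 0"
    "\<forall>\<^sub>F n in sequentially. \<forall>s>0. real n * exponent (norming n * s) \<le> C * (s powr (\<alpha> / 2) * (1 + s))"
proof -
  obtain C x0 where C: "C > 0" "x0 > 0"
    "\<And>x s. 0 < x \<Longrightarrow> x \<le> x0 \<Longrightarrow> 0 < s \<Longrightarrow> s \<le> 1 \<Longrightarrow> exponent (x * s) \<le> C * s powr (\<alpha> / 2) * exponent x"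
    by (rule exponent_upper) blast
  have "\<forall>\<^sub>F n in sequentially. \<forall>s>0. real n * exponent (norming n * s) \<le> (C + 1) * (s powr (\<alpha> / 2) * (1 + s))"
    using norming_spec norming_le[OF C(2)]
  proof eventually_elim
    case (elim n)
    show ?case
    proof (intro allI impI)
      fix s :: real assume s: "0 < s"
      show "real n * exponent (norming n * s) \<le> (C + 1) * (s powr (\<alpha> / 2) * (1 + s))"
      proof (cases "s \<le> 1")
        case True
        have "real n * exponent (norming n * s) \<le> real n * (C * s powr (\<alpha> / 2) * exponent (norming n))"
          using elim s True by (intro mult_left_mono C(3)) auto
        also have "\<dots> = C * s powr (\<alpha> / 2) * (real n * exponent (norming n))" by simp
        also have "\<dots> = C * s powr (\<alpha> / 2)" using elim by simp
        also have "\<dots> \<le> (C + 1) * (s powr (\<alpha> / 2) * (1 + s))"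
          using C(1) s by (intro mult_mono) (auto simp: mult_le_cancel_left1)
        finally show ?thesis .
      next
        case False
        have "real n * exponent (norming n * s) \<le> real n * (s * exponent (norming n))"
          using elim s False by (intro mult_left_mono exponent_scale) auto
        also have "\<dots> = s * (real n * exponent (norming n))" by simp
        also have "\<dots> = s" using elim by simp
        also have "\<dots> \<le> 1 * (1 * (1 + s))" by simp
        also have "\<dots> \<le> (C + 1) * (s powr (\<alpha> / 2) * (1 + s))"
          using C(1) s False alpha by (intro mult_mono mult_right_mono ge_one_powr_ge_zero) auto
        finally show ?thesis .
      qed
    qed
  qed
  then show thesis using C(1) by (intro that[of "C + 1"]) auto
qed

text \<open>As long as b y stays small, the term with \<open>exponent\<close> grows by the Potter
  bound. For large b y it saturates, since \<open>exponent\<close> is at most 1, and the linear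
  damping term takes over. The half in n / 2 leaves room for replacing n by n - v.\<close>

lemma decay_exponent_lower:
  obtains c where "c > 0"
    "\<forall>\<^sub>F n in sequentially. \<forall>y\<ge>1. c * y powr (\<alpha> / 2) \<le> real n * norming n * y + real n / 2 * exponent (norming n * y)"
proof -
  obtain C x0 where C: "C > 0" "x0 > 0"
    "\<And>x s. 0 < x \<Longrightarrow> x \<le> x0 \<Longrightarrow> 0 < s \<Longrightarrow> s \<le> 1 \<Longrightarrow> exponent (x * s) \<le> C * s powr (\<alpha> / 2) * exponent x"
    by (rule exponent_upper) blast
  define c where "c = min (1 / (2 * C)) (x0 / C)"
  have "\<forall>\<^sub>F n in sequentially. \<forall>y\<ge>1. c * y powr (\<alpha> / 2) \<le> real n * norming n * y + real n / 2 * exponent (norming n * y)"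
    using norming_spec norming_le[OF C(2)]
  proof eventually_elim
    case (elim n)
    let ?b = "norming n"
    show ?case
    proof (intro allI impI)
      fix y :: real assume y: "1 \<le> y"
      show "c * y powr (\<alpha> / 2) \<le> real n * ?b * y + real n / 2 * exponent (?b * y)"
      proof (cases "?b * y \<le> x0")
        case True
        have "exponent (?b * y * (1 / y)) \<le> C * (1 / y) powr (\<alpha> / 2) * exponent (?b * y)"
          using elim y True by (intro C(3)) auto
        then have "real n * exponent ?b \<le> real n * (C * (1 / y) powr (\<alpha> / 2) * exponent (?b * y))"
          using y by (intro mult_left_mono) auto
        then have "1 \<le> C * real n * exponent (?b * y) / y powr (\<alpha> / 2)"
          using elim y by (simp add: powr_divide mult_ac)
        then have "y powr (\<alpha> / 2) \<le> C * real n * exponent (?b * y)"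
          using y by (subst (asm) pos_le_divide_eq) auto
        then have "1 / (2 * C) * y powr (\<alpha> / 2) \<le> real n / 2 * exponent (?b * y)"
          using C by (simp add: field_simps)
        moreover have "c * y powr (\<alpha> / 2) \<le> 1 / (2 * C) * y powr (\<alpha> / 2)"
          unfolding c_def by (intro mult_right_mono) auto
        moreover have "0 \<le> real n * ?b * y" using elim y by auto
        ultimately show ?thesis by linarith
      next
        \<comment> \<open>Potter at x0 gives 1 <= n C (b / x0)^(\<alpha>/2). Multiplied by
          y^(\<alpha>/2), the power of b y / x0 >= 1 may be raised from \<alpha>/2 to 1, which is
          the damping term.\<close>
        case False
        have "exponent (x0 * (?b / x0)) \<le> C * (?b / x0) powr (\<alpha> / 2) * exponent x0"
          using elim C by (intro C(3)) auto
        also have "\<dots> \<le> C * (?b / x0) powr (\<alpha> / 2) * 1"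
          using C by (intro mult_left_mono exponent_le_1) auto
        finally have "real n * exponent ?b \<le> real n * (C * (?b / x0) powr (\<alpha> / 2))"
          using C by (intro mult_left_mono) auto
        then have 1: "1 \<le> real n * C * (?b / x0) powr (\<alpha> / 2)" using elim by simp
        have t: "1 \<le> ?b * y / x0" using False C by (simp add: field_simps)
        have "y powr (\<alpha> / 2) * 1 \<le> y powr (\<alpha> / 2) * (real n * C * (?b / x0) powr (\<alpha> / 2))"
          using 1 by (intro mult_left_mono) auto
        also have "\<dots> = real n * C * (?b * y / x0) powr (\<alpha> / 2)"
          using y elim C by (simp add: powr_mult powr_divide)
        also have "\<dots> \<le> real n * C * (?b * y / x0) powr 1"
          using C alpha t by (intro mult_left_mono powr_mono) auto
        also have "\<dots> = C / x0 * (real n * ?b * y)"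
          using t C y elim by (simp add: abs_of_pos)
        finally have "x0 / C * y powr (\<alpha> / 2) \<le> real n * ?b * y"
          using C by (simp add: field_simps)
        moreover have "c * y powr (\<alpha> / 2) \<le> x0 / C * y powr (\<alpha> / 2)"
          unfolding c_def by (intro mult_right_mono) auto
        moreover have "0 \<le> real n / 2 * exponent (?b * y)"
          using elim y by (intro mult_nonneg_nonneg exponent_nonneg) auto
        ultimately show ?thesis by linarith
      qed
    qed
  qed
  moreover have "c > 0" using C by (simp add: c_def)
  ultimately show thesis using that by blast
qed

text \<open>The decay exp (- c y^(\<alpha>/2)) beats every polynomial; the power N leaves room for
  all the polynomial factors that the edges contribute.\<close>

lemma vertex_factor_dominated:
  obtains C where "C > 0"
    "\<forall>\<^sub>F n in sequentially. \<forall>y>0. (1 + y) ^ N * (exp (- (real n * norming n * y)) * (1 - exponent (norming n * y)) ^ (n - v)) \<le> C"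
proof -
  obtain c where c: "c > 0"
    "\<forall>\<^sub>F n in sequentially. \<forall>y\<ge>1. c * y powr (\<alpha> / 2) \<le> real n * norming n * y + real n / 2 * exponent (norming n * y)"
    by (rule decay_exponent_lower) blast
  \<comment> \<open>With z = c y^(\<alpha>/2), the bound exp (- z) <= j! / z^j decays like y^(- j
    \<alpha>/2); j is chosen so that this is at least as fast as y^(-N).\<close>
  define j where "j = nat \<lceil>2 * real N / \<alpha>\<rceil>"
  have "2 * real N / \<alpha> \<le> real j" unfolding j_def by linarith
  then have j: "real N \<le> \<alpha> / 2 * real j" using alpha by (simp add: field_simps)
  define C where "C = max (2 ^ N) (2 ^ N * (fact j / c ^ j))"
  have "\<forall>\<^sub>F n in sequentially. \<forall>y>0. (1 + y) ^ N * (exp (- (real n * norming n * y)) * (1 - exponent (norming n * y)) ^ (n - v)) \<le> C"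
    using norming_spec c(2) eventually_ge_at_top[of "2 * v"]
  proof eventually_elim
    case (elim n)
    let ?b = "norming n"
    let ?E = "\<lambda>y. exp (- (real n * ?b * y)) * (1 - exponent (?b * y)) ^ (n - v)"
    have E: "?E y \<le> exp (- (real n * ?b * y + real n / 2 * exponent (?b * y)))" if y: "0 < y" for y
    proof -
      have nonneg: "0 \<le> ?b * y" using elim y by auto
      have "(1 - exponent (?b * y)) ^ (n - v) \<le> exp (- exponent (?b * y)) ^ (n - v)"
        using exponent_le_1[OF nonneg] exp_ge_add_one_self[of "- exponent (?b * y)"]
        by (intro power_mono) auto
      also have "\<dots> = exp (- (real (n - v) * exponent (?b * y)))"
        by (simp add: exp_of_nat_mult[symmetric])
      also have "\<dots> \<le> exp (- (real n / 2 * exponent (?b * y)))"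
      proof -
        have "real n / 2 * exponent (?b * y) \<le> real (n - v) * exponent (?b * y)"
          using elim by (intro mult_right_mono exponent_nonneg[OF nonneg]) (simp add: of_nat_diff)
        then show ?thesis by simp
      qed
      finally have "?E y \<le> exp (- (real n * ?b * y)) * exp (- (real n / 2 * exponent (?b * y)))"
        by (intro mult_left_mono) auto
      then show ?thesis by (simp add: exp_add[symmetric])
    qed
    show ?case
    proof (intro allI impI)
      fix y :: real assume y: "0 < y"
      show "(1 + y) ^ N * ?E y \<le> C"
      proof (cases "y \<le> 1")
        case True
        have "?E y \<le> exp 0"
        proof -
          have "0 \<le> real n * ?b * y + real n / 2 * exponent (?b * y)"
            using elim y by (intro add_nonneg_nonneg mult_nonneg_nonneg exponent_nonneg) auto
          then show ?thesis by (intro order_trans[OF E[OF y]]) simp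
        qed
        moreover have "(1 + y) ^ N \<le> 2 ^ N" using y True by (intro power_mono) auto
        moreover have "0 \<le> ?E y"
          using exponent_le_1[of "?b * y"] elim y by (intro mult_nonneg_nonneg zero_le_power) auto
        ultimately have "(1 + y) ^ N * ?E y \<le> 2 ^ N * exp 0" by (intro mult_mono) auto
        then show ?thesis unfolding C_def by simp
      next
        case False
        let ?z = "c * y powr (\<alpha> / 2)"
        have z: "0 < ?z" using c y by simp
        have "?E y \<le> exp (- ?z)"
        proof -
          have "?z \<le> real n * ?b * y + real n / 2 * exponent (?b * y)"
            using elim False by (meson linear)
          then show ?thesis by (intro order_trans[OF E[OF y]]) simp
        qed
        also have "\<dots> \<le> fact j / ?z ^ j"
          using power_le_fact_exp[of ?z j] zero_less_power[OF z, of j] z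
          by (simp only: exp_minus) (simp add: divide_simps del: power_mult_distrib)
        also have "?z ^ j = c ^ j * y powr (\<alpha> / 2 * real j)"
          using y by (simp add: power_mult_distrib powr_powr powr_realpow[symmetric])
        also have "fact j / (c ^ j * y powr (\<alpha> / 2 * real j)) \<le> fact j / (c ^ j * y powr real N)"
          using c y False j by (intro divide_left_mono mult_left_mono powr_mono) auto
        also have "\<dots> = fact j / c ^ j / y ^ N" using y by (simp add: powr_realpow)
        finally have 1: "?E y \<le> fact j / c ^ j / y ^ N" .
        have "(1 + y) ^ N * ?E y \<le> (2 * y) ^ N * (fact j / c ^ j / y ^ N)"
          using 1 y False exponent_le_1[of "?b * y"] elim
          by (intro mult_mono power_mono) (auto intro!: mult_nonneg_nonneg zero_le_power)
        also have "\<dots> = 2 ^ N * (fact j / c ^ j)" using y by (simp add: power_mult_distrib)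
        finally show ?thesis unfolding C_def by simp
      qed
    qed
  qed
  moreover have "C > 0" by (simp add: C_def less_max_iff_disj)
  ultimately show thesis using that by blast
qed

end

section \<open>Markov kernels and closed walks\<close>

definition kernel_prod :: "nat \<Rightarrow> (nat \<Rightarrow> nat \<Rightarrow> real) \<Rightarrow> (nat \<Rightarrow> nat \<Rightarrow> real) \<Rightarrow> nat \<Rightarrow> nat \<Rightarrow> real" where
  "kernel_prod n A B i j = (\<Sum>l<n. A i l * B l j)"

fun kernel_pow :: "nat \<Rightarrow> (nat \<Rightarrow> nat \<Rightarrow> real) \<Rightarrow> nat \<Rightarrow> nat \<Rightarrow> nat \<Rightarrow> real" where
  "kernel_pow n A 0 = (\<lambda>i j. if i = j then 1 else 0)"
| "kernel_pow n A (Suc k) = kernel_prod n (kernel_pow n A k) A"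

definition kernel_trace :: "nat \<Rightarrow> (nat \<Rightarrow> nat \<Rightarrow> real) \<Rightarrow> real" where
  "kernel_trace n A = (\<Sum>i<n. A i i)"

definition substochastic :: "nat \<Rightarrow> (nat \<Rightarrow> nat \<Rightarrow> real) \<Rightarrow> bool" where
  "substochastic n A \<longleftrightarrow> (\<forall>i<n. (\<forall>j<n. 0 \<le> A i j) \<and> (\<Sum>j<n. A i j) \<le> 1)"

lemma substochastic_le_1: "substochastic n A \<Longrightarrow> i < n \<Longrightarrow> j < n \<Longrightarrow> A i j \<le> 1"
  unfolding substochastic_def
  by (rule order_trans[OF member_le_sum[of j "{..<n}" "A i"]]) auto

lemma kernel_prod_assoc: "kernel_prod n (kernel_prod n A B) C = kernel_prod n A (kernel_prod n B C)"
  unfolding kernel_prod_def fun_eq_iff sum_distrib_left sum_distrib_right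
  by (subst sum.swap) (simp add: mult.assoc)

lemma kernel_trace_prod_commute: "kernel_trace n (kernel_prod n A B) = kernel_trace n (kernel_prod n B A)"
  unfolding kernel_trace_def kernel_prod_def by (subst sum.swap) (simp add: mult.commute)

lemma substochastic_id: "substochastic n (kernel_pow n A 0)"
  by (auto simp: substochastic_def)

lemma substochastic_prod:
  assumes "substochastic n A" "substochastic n B" shows "substochastic n (kernel_prod n A B)"
  unfolding substochastic_def
proof (intro allI impI conjI)
  fix i assume i: "i < n"
  show "0 \<le> kernel_prod n A B i j" if "j < n" for j
    using assms i that by (auto simp: substochastic_def kernel_prod_def intro!: sum_nonneg)
  have "(\<Sum>j<n. kernel_prod n A B i j) = (\<Sum>l<n. A i l * (\<Sum>j<n. B l j))"
    unfolding kernel_prod_def by (subst sum.swap) (simp add: sum_distrib_left)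
  also have "\<dots> \<le> (\<Sum>l<n. A i l * 1)"
    using assms i by (intro sum_mono mult_left_mono) (auto simp: substochastic_def)
  also have "\<dots> \<le> 1" using assms i by (simp add: substochastic_def)
  finally show "(\<Sum>j<n. kernel_prod n A B i j) \<le> 1" .
qed

lemma substochastic_pow: "substochastic n A \<Longrightarrow> substochastic n (kernel_pow n A k)"
  by (induction k) (use substochastic_id substochastic_prod in auto)

text \<open>Telescoping: the factors A are exchanged for B one at a time. By cyclicity one exchange
  pairs A - B with the kernel C B^k, whose entries lie in [0, 1]. The right factor C is kept general
  because the induction moves factors into it.\<close>

lemma kernel_trace_diff:
  assumes A: "substochastic n A" and B: "substochastic n B"
  shows "substochastic n C \<Longrightarrow>
    \<bar>kernel_trace n (kernel_prod n (kernel_pow n A k) C) - kernel_trace n (kernel_prod n (kernel_pow n B k) C)\<bar>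
      \<le> real k * (\<Sum>i<n. \<Sum>j<n. \<bar>A i j - B i j\<bar>)"
proof (induction k arbitrary: C)
  case (Suc k)
  let ?S = "\<Sum>i<n. \<Sum>j<n. \<bar>A i j - B i j\<bar>"
  let ?P = "\<lambda>A k C. kernel_trace n (kernel_prod n (kernel_pow n A k) C)"
  let ?Q = "kernel_prod n C (kernel_pow n B k)"
  have Q: "substochastic n ?Q" using Suc.prems B by (intro substochastic_prod substochastic_pow)
  have split: "?P B k (kernel_prod n X C) = (\<Sum>i<n. \<Sum>j<n. X i j * ?Q j i)" for X
  proof -
    have "?P B k (kernel_prod n X C) = kernel_trace n (kernel_prod n (kernel_prod n X C) (kernel_pow n B k))"
      by (rule kernel_trace_prod_commute)
    also have "\<dots> = kernel_trace n (kernel_prod n X ?Q)" by (simp add: kernel_prod_assoc)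
    finally show ?thesis by (simp add: kernel_trace_def kernel_prod_def)
  qed
  have "\<bar>?P B k (kernel_prod n A C) - ?P B k (kernel_prod n B C)\<bar>
      = \<bar>\<Sum>i<n. \<Sum>j<n. (A i j - B i j) * ?Q j i\<bar>"
    unfolding split by (simp add: sum_subtractf[symmetric] left_diff_distrib)
  also have "\<dots> \<le> (\<Sum>i<n. \<Sum>j<n. \<bar>(A i j - B i j) * ?Q j i\<bar>)"
    by (rule order_trans[OF sum_abs]) (intro sum_mono sum_abs)
  also have "\<dots> \<le> ?S"
  proof (intro sum_mono)
    fix i j assume "i \<in> {..<n}" "j \<in> {..<n}"
    then have "0 \<le> ?Q j i" "?Q j i \<le> 1"
      using Q substochastic_le_1[OF Q] by (auto simp: substochastic_def)
    then show "\<bar>(A i j - B i j) * ?Q j i\<bar> \<le> \<bar>A i j - B i j\<bar>"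
      by (simp add: abs_mult mult_left_le)
  qed
  finally have 1: "\<bar>?P B k (kernel_prod n A C) - ?P B k (kernel_prod n B C)\<bar> \<le> ?S" .
  have 2: "\<bar>?P A k (kernel_prod n A C) - ?P B k (kernel_prod n A C)\<bar> \<le> real k * ?S"
    by (rule Suc.IH[OF substochastic_prod[OF A Suc.prems]])
  have "\<bar>?P A k (kernel_prod n A C) - ?P B k (kernel_prod n B C)\<bar> \<le> real k * ?S + ?S"
    using 1 2 by linarith
  then show ?case by (simp add: kernel_prod_assoc distrib_right add.commute)
qed simp

lemma kernel_prod_id: "i < n \<Longrightarrow> j < n \<Longrightarrow> kernel_prod n A (kernel_pow n B 0) i j = A i j"
proof -
  assume "i < n" "j < n"
  have "kernel_prod n A (kernel_pow n B 0) i j = (\<Sum>l<n. if l = j then A i l else 0)"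
    unfolding kernel_prod_def by (intro sum.cong) auto
  then show ?thesis using \<open>j < n\<close> by simp
qed

lemma kernel_trace_pow_diff:
  assumes "substochastic n A" "substochastic n B"
  shows "\<bar>kernel_trace n (kernel_pow n A k) - kernel_trace n (kernel_pow n B k)\<bar>
      \<le> real k * (\<Sum>i<n. \<Sum>j<n. \<bar>A i j - B i j\<bar>)"
proof -
  have "kernel_trace n (kernel_prod n X (kernel_pow n A 0)) = kernel_trace n X" for X
    unfolding kernel_trace_def by (intro sum.cong kernel_prod_id) auto
  then show ?thesis
    using kernel_trace_diff[OF assms substochastic_id[of n A], of k] by simp
qed

lemma kernel_trace_pow_bounds:
  assumes "substochastic n A"
  shows "0 \<le> kernel_trace n (kernel_pow n A k)" "kernel_trace n (kernel_pow n A k) \<le> real n"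
proof -
  note P = substochastic_pow[OF assms, of k]
  show "0 \<le> kernel_trace n (kernel_pow n A k)"
    using P by (auto simp: kernel_trace_def substochastic_def intro!: sum_nonneg)
  have "kernel_trace n (kernel_pow n A k) \<le> (\<Sum>i<n. 1)"
    unfolding kernel_trace_def by (intro sum_mono substochastic_le_1[OF P]) auto
  then show "kernel_trace n (kernel_pow n A k) \<le> real n" by simp
qed

text \<open>The weight h of the two end points lets the induction absorb the last step of a path
  into h. A trace is recovered by choosing for h the kernel entry that closes the path.\<close>

lemma kernel_pow_paths:
  "(\<Sum>w \<in> PiE {..<Suc k} (\<lambda>_. {..<n}). (\<Prod>t<k. K (w t) (w (Suc t))) * h (w 0) (w k))
    = (\<Sum>i<n. \<Sum>j<n. h i j * kernel_pow n K k i j)"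
proof (induction k arbitrary: h)
  case 0
  have "(\<Sum>w \<in> PiE {..<Suc 0} (\<lambda>_. {..<n}). h (w 0) (w 0)) = (\<Sum>i<n. h i i)"
  proof (rule sum.reindex_bij_witness[where j = "\<lambda>w. w 0" and i = "\<lambda>i. \<lambda>t\<in>{..<Suc 0}. i"])
    fix w assume "w \<in> PiE {..<Suc 0} (\<lambda>_. {..<n})"
    then show "(\<lambda>t\<in>{..<Suc 0}. w 0) = w" by (auto simp: fun_eq_iff PiE_iff extensional_def)
  qed auto
  moreover have "(\<Sum>j<n. h i j * (if i = j then 1 else 0)) = h i i" if "i < n" for i
  proof -
    have "(\<Sum>j<n. h i j * (if i = j then 1 else 0)) = (\<Sum>j<n. if i = j then h i j else 0)"
      by (intro sum.cong) auto
    then show ?thesis using that by simp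
  qed
  ultimately show ?case by simp
next
  case (Suc k)
  let ?P = "PiE {..<Suc k} (\<lambda>_. {..<n})"
  have "{..<Suc (Suc k)} = insert (Suc k) {..<Suc k}" by auto
  then have "(\<Sum>w \<in> PiE {..<Suc (Suc k)} (\<lambda>_. {..<n}). (\<Prod>t<Suc k. K (w t) (w (Suc t))) * h (w 0) (w (Suc k)))
      = (\<Sum>w \<in> (\<lambda>(y, g). g(Suc k := y)) ` ({..<n} \<times> ?P). (\<Prod>t<Suc k. K (w t) (w (Suc t))) * h (w 0) (w (Suc k)))"
    by (simp only: PiE_insert_eq)
  also have "\<dots> = (\<Sum>(y, w) \<in> {..<n} \<times> ?P. (\<Prod>t<k. K (w t) (w (Suc t))) * (K (w k) y * h (w 0) y))"
  proof (subst sum.reindex)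
    show "inj_on (\<lambda>(y, g). g(Suc k := y)) ({..<n} \<times> ?P)"
      using inj_combinator[of "Suc k" "{..<Suc k}" "\<lambda>_. {..<n}"] by simp
    have "(\<Prod>t<k. K ((w(Suc k := y)) t) ((w(Suc k := y)) (Suc t))) = (\<Prod>t<k. K (w t) (w (Suc t)))" for y and w :: "nat \<Rightarrow> nat"
      by (intro prod.cong) auto
    then show "(sum ((\<lambda>w. (\<Prod>t<Suc k. K (w t) (w (Suc t))) * h (w 0) (w (Suc k))) \<circ> (\<lambda>(y, g). g(Suc k := y))) ({..<n} \<times> ?P))
      = (\<Sum>(y, w) \<in> {..<n} \<times> ?P. (\<Prod>t<k. K (w t) (w (Suc t))) * (K (w k) y * h (w 0) y))"
      by (intro sum.cong refl) (simp add: comp_def case_prod_beta mult.assoc)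
  qed
  also have "\<dots> = (\<Sum>y<n. \<Sum>w\<in>?P. (\<Prod>t<k. K (w t) (w (Suc t))) * (K (w k) y * h (w 0) y))"
    by (simp add: sum.cartesian_product)
  also have "\<dots> = (\<Sum>y<n. \<Sum>i<n. \<Sum>j<n. (K j y * h i y) * kernel_pow n K k i j)"
    by (intro sum.cong refl Suc.IH)
  also have "\<dots> = (\<Sum>i<n. \<Sum>y<n. \<Sum>j<n. (K j y * h i y) * kernel_pow n K k i j)"
    by (rule sum.swap)
  also have "\<dots> = (\<Sum>i<n. \<Sum>y<n. h i y * kernel_pow n K (Suc k) i y)"
    by (simp add: kernel_prod_def sum_distrib_left mult_ac)
  finally show ?case .
qed

text \<open>The cyclic successor: a closed walk of length k is stored by its k vertices, without
  repeating the first.\<close>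

definition next_step :: "nat \<Rightarrow> nat \<Rightarrow> nat" where
  "next_step k t = (if Suc t = k then 0 else Suc t)"

lemma kernel_trace_paths:
  assumes "0 < k"
  shows "kernel_trace n (kernel_pow n K k)
    = (\<Sum>w \<in> PiE {..<k} (\<lambda>_. {..<n}). \<Prod>t<k. K (w t) (w (next_step k t)))"
proof -
  obtain k' where k: "k = Suc k'" using assms by (cases k) auto
  have "(\<Prod>t<k. K (w t) (w (next_step k t))) = (\<Prod>t<k'. K (w t) (w (Suc t))) * K (w k') (w 0)" for w
    unfolding k by (auto simp: next_step_def intro!: prod.cong)
  then have "(\<Sum>w \<in> PiE {..<k} (\<lambda>_. {..<n}). \<Prod>t<k. K (w t) (w (next_step k t)))
      = (\<Sum>i<n. \<Sum>j<n. K j i * kernel_pow n K k' i j)"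
    unfolding k by (subst kernel_pow_paths[where k = k' and h = "\<lambda>i j. K j i", symmetric]) simp
  also have "\<dots> = kernel_trace n (kernel_pow n K k)"
    unfolding k kernel_trace_def by (simp add: kernel_prod_def mult.commute)
  finally show ?thesis by simp
qed

section \<open>Perturbing and damping the rows of a Markov kernel\<close>

definition markov_row :: "nat \<Rightarrow> (nat \<Rightarrow> real) \<Rightarrow> nat \<Rightarrow> nat \<Rightarrow> real" where
  "markov_row n r i j =
     (let \<rho> = \<Sum>k<n. r k in if \<rho> = 0 then (if i = j then 1 else 0) else r j / \<rho>)"

definition markov_kernel :: "nat \<Rightarrow> (nat \<Rightarrow> nat \<Rightarrow> real) \<Rightarrow> nat \<Rightarrow> nat \<Rightarrow> real" where
  "markov_kernel n u i = markov_row n (u i) i"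

lemma markov_row_nonneg: "(\<And>j. 0 \<le> r j) \<Longrightarrow> 0 \<le> markov_row n r i j"
  by (auto simp: markov_row_def Let_def intro!: divide_nonneg_nonneg sum_nonneg)

lemma markov_row_sum: "i < n \<Longrightarrow> (\<Sum>j<n. markov_row n r i j) = 1"
  by (cases "(\<Sum>k<n. r k) = 0") (simp_all add: markov_row_def sum_divide_distrib[symmetric])

lemma substochastic_markov: "(\<And>i j. 0 \<le> u i j) \<Longrightarrow> substochastic n (markov_kernel n u)"
  by (auto simp: substochastic_def markov_kernel_def markov_row_nonneg markov_row_sum)

text \<open>The mass removed at j0 is spread over the remaining entries by the new normalisation, so
  it counts twice. If j0 carried all the mass, the new row is the one fixed by convention and the
  trivial bound 2 applies, which equals the right-hand side.\<close>

lemma markov_row_zero_entry: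
  assumes r: "\<And>j. 0 \<le> r j" and i: "i < n" and j0: "j0 < n"
  shows "(\<Sum>j<n. \<bar>markov_row n r i j - markov_row n (r(j0 := 0)) i j\<bar>) \<le> 2 * (r j0 / (\<Sum>k<n. r k))"
proof -
  let ?\<rho> = "\<Sum>k<n. r k" and ?s = "\<Sum>k<n. (r(j0 := 0)) k"
  have split: "(\<Sum>k<n. f k) = f j0 + (\<Sum>k\<in>{..<n} - {j0}. f k)" for f :: "nat \<Rightarrow> real"
    using j0 by (simp add: sum.remove)
  have s: "?\<rho> = r j0 + ?s" by (subst (1 2) split) simp
  have nn: "0 \<le> ?s" "0 \<le> r j0" using r by (auto intro!: sum_nonneg)
  consider "?\<rho> = 0" | "?\<rho> > 0" "?s = 0" | "?\<rho> > 0" "?s > 0" using s nn by fastforce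
  then show ?thesis
  proof cases
    case 1
    then have "r j0 = 0" using s nn by linarith
    then have "r(j0 := 0) = r" by auto
    then show ?thesis using 1 by simp
  next
    case 2
    have "(\<Sum>j<n. \<bar>markov_row n r i j - markov_row n (r(j0 := 0)) i j\<bar>)
        \<le> (\<Sum>j<n. markov_row n r i j + markov_row n (r(j0 := 0)) i j)"
    proof (intro sum_mono)
      fix j
      have "0 \<le> markov_row n r i j" "0 \<le> markov_row n (r(j0 := 0)) i j"
        using r by (auto intro!: markov_row_nonneg)
      then show "\<bar>markov_row n r i j - markov_row n (r(j0 := 0)) i j\<bar> \<le> markov_row n r i j + markov_row n (r(j0 := 0)) i j"
        by linarith
    qed
    also have "\<dots> = 2" using i by (simp add: sum.distrib markov_row_sum)
    finally show ?thesis using 2 s by simp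
  next
    case 3
    have "(\<Sum>j<n. \<bar>markov_row n r i j - markov_row n (r(j0 := 0)) i j\<bar>)
        = (\<Sum>j<n. \<bar>r j / ?\<rho> - (r(j0 := 0)) j / ?s\<bar>)"
      using 3 by (simp add: markov_row_def Let_def)
    also have "\<dots> = r j0 / ?\<rho> + (\<Sum>j\<in>{..<n} - {j0}. \<bar>r j / ?\<rho> - r j / ?s\<bar>)"
      using 3 nn by (subst split) simp
    also have "(\<Sum>j\<in>{..<n} - {j0}. \<bar>r j / ?\<rho> - r j / ?s\<bar>) = (\<Sum>j\<in>{..<n} - {j0}. (r(j0 := 0)) j * (1 / ?s - 1 / ?\<rho>))"
    proof (intro sum.cong refl)
      fix j assume j: "j \<in> {..<n} - {j0}"
      have "1 / ?\<rho> \<le> 1 / ?s" using 3 s nn by (intro divide_left_mono) auto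
      then have "r j * (1 / ?\<rho>) \<le> r j * (1 / ?s)" using r by (intro mult_left_mono) auto
      then show "\<bar>r j / ?\<rho> - r j / ?s\<bar> = (r(j0 := 0)) j * (1 / ?s - 1 / ?\<rho>)"
        using j by (simp add: algebra_simps)
    qed
    also have "\<dots> = (\<Sum>j\<in>{..<n} - {j0}. (r(j0 := 0)) j) * (1 / ?s - 1 / ?\<rho>)"
      by (rule sum_distrib_right[symmetric])
    also have "(\<Sum>j\<in>{..<n} - {j0}. (r(j0 := 0)) j) = ?s" by (subst split) simp
    also have "?s * (1 / ?s - 1 / ?\<rho>) = (?\<rho> - ?s) / ?\<rho>"
      using 3 by (simp add: right_diff_distrib diff_divide_distrib del: fun_upd_apply)
    also have "?\<rho> - ?s = r j0" using s by linarith
    finally show ?thesis by (simp del: fun_upd_apply)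
  qed
qed

lemma markov_row_cong: "(\<And>j. j < n \<Longrightarrow> r j = r' j) \<Longrightarrow> j < n \<Longrightarrow> markov_row n r i j = markov_row n r' i j"
proof -
  assume r: "\<And>j. j < n \<Longrightarrow> r j = r' j" "j < n"
  then have "(\<Sum>k<n. r k) = (\<Sum>k<n. r' k)" by (intro sum.cong) auto
  then show ?thesis using r by (simp add: markov_row_def)
qed

text \<open>The extra \<open>n\<close> is negligible against a typical row sum, but it removes the convention for zero
  rows and provides exponential decay in the Gamma integrals below.\<close>

definition damped_kernel :: "nat \<Rightarrow> (nat \<Rightarrow> nat \<Rightarrow> real) \<Rightarrow> nat \<Rightarrow> nat \<Rightarrow> real" where
  "damped_kernel n u i j = u i j / (real n + (\<Sum>k<n. u i k))"

lemma substochastic_damped: "(\<And>i j. 0 \<le> u i j) \<Longrightarrow> substochastic n (damped_kernel n u)"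
  unfolding substochastic_def damped_kernel_def sum_divide_distrib[symmetric]
proof (intro allI impI conjI)
  fix i assume u: "\<And>i j. 0 \<le> u i j" and i: "i < n"
  have p: "0 < real n + (\<Sum>k<n. u i k)" using u i by (intro add_pos_nonneg sum_nonneg) auto
  show "(\<Sum>k<n. u i k) / (real n + (\<Sum>k<n. u i k)) \<le> 1" using p by simp
  show "0 \<le> u i j / (real n + (\<Sum>k<n. u i k))" for j using p u by simp
qed

text \<open>The damped row is the Markov row times \<rho> / (n + \<rho>), so the difference is the
  missing mass. For \<rho> = 0 the damped row vanishes and the whole mass 1 = n / n is
  missing.\<close>

lemma markov_damped_diff:
  assumes u: "\<And>i j. 0 \<le> u i j" and i: "i < n"
  shows "(\<Sum>j<n. \<bar>markov_kernel n u i j - damped_kernel n u i j\<bar>) = real n / (real n + (\<Sum>k<n. u i k))"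
proof (cases "(\<Sum>k<n. u i k) = 0")
  case True
  then have z: "u i j = 0" if "j < n" for j
    using u that by (simp add: sum_nonneg_eq_0_iff)
  have "(\<Sum>j<n. \<bar>markov_kernel n u i j - damped_kernel n u i j\<bar>) = (\<Sum>j<n. if i = j then 1 else 0)"
    using True z by (intro sum.cong) (auto simp: markov_kernel_def markov_row_def damped_kernel_def)
  then show ?thesis using True i by simp
next
  case False
  let ?\<rho> = "\<Sum>k<n. u i k"
  have \<rho>: "0 < ?\<rho>" using False u by (simp add: sum_nonneg order_less_le)
  have n: "0 < real n" using i by simp
  have "(\<Sum>j<n. \<bar>markov_kernel n u i j - damped_kernel n u i j\<bar>) = (\<Sum>j<n. u i j * (1 / ?\<rho> - 1 / (real n + ?\<rho>)))"
  proof (intro sum.cong refl)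
    fix j
    have "1 / (real n + ?\<rho>) \<le> 1 / ?\<rho>" using \<rho> n by (intro divide_left_mono) auto
    then have "u i j * (1 / (real n + ?\<rho>)) \<le> u i j * (1 / ?\<rho>)" using u by (intro mult_left_mono) auto
    then show "\<bar>markov_kernel n u i j - damped_kernel n u i j\<bar> = u i j * (1 / ?\<rho> - 1 / (real n + ?\<rho>))"
      using False by (simp add: markov_kernel_def markov_row_def damped_kernel_def algebra_simps)
  qed
  also have "\<dots> = ?\<rho> * (1 / ?\<rho> - 1 / (real n + ?\<rho>))" by (simp add: sum_distrib_right)
  also have "\<dots> = 1 - ?\<rho> / (real n + ?\<rho>)" using \<rho> by (simp add: right_diff_distrib)
  also have "\<dots> = real n / (real n + ?\<rho>)" using \<rho> n by (simp add: diff_divide_eq_iff)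
  finally show ?thesis .
qed

section \<open>Concentration\<close>

context prob_space
begin

text \<open>Both sides are the variance of \<open>h\<close>. Dropping the last square bounds the
  variance by the second moment about an arbitrary constant.\<close>

lemma variance_shift:
  fixes h :: "'a \<Rightarrow> real"
  assumes [measurable]: "h \<in> borel_measurable M" and B: "\<And>x. x \<in> space M \<Longrightarrow> \<bar>h x\<bar> \<le> B"
  shows "(\<integral>x. (h x)\<^sup>2 \<partial>M) - (\<integral>x. h x \<partial>M)\<^sup>2 = (\<integral>x. (h x - c)\<^sup>2 \<partial>M) - ((\<integral>x. h x \<partial>M) - c)\<^sup>2"
proof -
  have [simp]: "integrable M h"
    by (rule integrable_const_bound[of _ B]) (use B in auto)
  have "(h x)\<^sup>2 \<le> B\<^sup>2" if "x \<in> space M" for x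
    using B[OF that] by (metis abs_ge_zero power2_abs power_mono)
  then have [simp]: "integrable M (\<lambda>x. (h x)\<^sup>2)"
    by (intro integrable_const_bound[of _ "B\<^sup>2"]) auto
  have "(\<integral>x. (h x - c)\<^sup>2 \<partial>M) = (\<integral>x. (h x)\<^sup>2 + c\<^sup>2 - 2 * c * h x \<partial>M)"
    by (simp add: power2_diff mult_ac)
  also have "\<dots> = (\<integral>x. (h x)\<^sup>2 \<partial>M) + c\<^sup>2 - 2 * c * (\<integral>x. h x \<partial>M)"
    by (simp add: prob_space)
  finally show ?thesis by (simp add: power2_diff)
qed

lemma square_integral_le:
  fixes h :: "'a \<Rightarrow> real"
  assumes "h \<in> borel_measurable M" "\<And>x. x \<in> space M \<Longrightarrow> \<bar>h x\<bar> \<le> B"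
  shows "(\<integral>x. h x \<partial>M)\<^sup>2 \<le> (\<integral>x. (h x)\<^sup>2 \<partial>M)"
proof -
  have "0 \<le> (\<integral>x. (h x - (\<integral>x. h x \<partial>M))\<^sup>2 \<partial>M)" by simp
  moreover have "(\<integral>x. (h x)\<^sup>2 \<partial>M) - (\<integral>x. h x \<partial>M)\<^sup>2 = (\<integral>x. (h x - (\<integral>x. h x \<partial>M))\<^sup>2 \<partial>M)"
    by (subst variance_shift[OF assms, of "\<integral>x. h x \<partial>M"]) auto
  ultimately show ?thesis by linarith
qed

lemma bounded_integrable:
  fixes h :: "'a \<Rightarrow> real"
  assumes "h \<in> borel_measurable M" "\<And>x. x \<in> space M \<Longrightarrow> \<bar>h x\<bar> \<le> B"
  shows "integrable M h"
  by (rule integrable_const_bound[of _ B]) (use assms in auto)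

lemma abs_integral_le_bound:
  fixes h :: "'a \<Rightarrow> real"
  assumes "h \<in> borel_measurable M" "\<And>x. x \<in> space M \<Longrightarrow> \<bar>h x\<bar> \<le> B"
  shows "\<bar>\<integral>x. h x \<partial>M\<bar> \<le> B"
proof -
  have "\<bar>\<integral>x. h x \<partial>M\<bar> \<le> (\<integral>x. \<bar>h x\<bar> \<partial>M)" by (rule integral_abs_bound)
  also have "\<dots> \<le> (\<integral>x. B \<partial>M)"
    using assms bounded_integrable[OF assms] by (intro integral_mono) auto
  finally show ?thesis by (simp add: prob_space)
qed

end

lemma measurable_PiM_update [measurable]:
  assumes "i \<in> I" "z \<in> space (M i)"
  shows "(\<lambda>x. x(i := z)) \<in> measurable (PiM I M) (PiM I M)"
proof (rule measurable_PiM_single')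
  fix j assume "j \<in> I"
  then show "(\<lambda>x. (x(i := z)) j) \<in> measurable (PiM I M) (M j)"
    using assms by (cases "j = i") auto
qed (use assms in \<open>auto simp: space_PiM PiE_iff extensional_def\<close>)

lemma PiM_space_update: "x \<in> space (PiM I M) \<Longrightarrow> i \<in> I \<Longrightarrow> z \<in> space (M i) \<Longrightarrow> x(i := z) \<in> space (PiM I M)"
  by (auto simp: space_PiM PiE_iff extensional_def)

lemma PiM_space_insert: "x \<in> space (PiM I M) \<Longrightarrow> z \<in> space (M i) \<Longrightarrow> x(i := z) \<in> space (PiM (insert i I) M)"
  by (auto simp: space_PiM PiE_iff extensional_def)

text \<open>A variant of the Efron-Stein inequality in which a coordinate is overwritten by a fixed
  value z rather than by an independent copy. The induction splits the variance into the mean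
  conditional variance in the new coordinate and the variance of the conditional mean.\<close>

lemma efron_stein:
  fixes N :: "'a measure" and f :: "('i \<Rightarrow> 'a) \<Rightarrow> real"
  assumes N: "prob_space N" and z: "z \<in> space N" and fin: "finite I"
    and "f \<in> borel_measurable (PiM I (\<lambda>_. N))"
    and "\<And>x. x \<in> space (PiM I (\<lambda>_. N)) \<Longrightarrow> \<bar>f x\<bar> \<le> B"
  shows "(\<integral>x. (f x)\<^sup>2 \<partial>PiM I (\<lambda>_. N)) - (\<integral>x. f x \<partial>PiM I (\<lambda>_. N))\<^sup>2
    \<le> (\<Sum>i\<in>I. \<integral>x. (f x - f (x(i := z)))\<^sup>2 \<partial>PiM I (\<lambda>_. N))"
  using fin assms(4,5)
proof (induction I arbitrary: f)
  case empty
  interpret E: prob_space "PiM {} (\<lambda>_. N)" by (intro prob_space_PiM N)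
  have "(\<integral>x. (f x)\<^sup>2 \<partial>PiM {} (\<lambda>_. N)) = (\<integral>x. (f (\<lambda>_. undefined))\<^sup>2 \<partial>PiM ({}::'i set) (\<lambda>_. N))"
    by (rule Bochner_Integration.integral_cong[OF refl]) (auto simp: space_PiM)
  moreover have "(\<integral>x. f x \<partial>PiM {} (\<lambda>_. N)) = (\<integral>x. f (\<lambda>_. undefined) \<partial>PiM ({}::'i set) (\<lambda>_. N))"
    by (rule Bochner_Integration.integral_cong[OF refl]) (auto simp: space_PiM)
  ultimately show ?case by (simp add: E.prob_space)
next
  case (insert e I)
  interpret N: prob_space N by fact
  interpret PS: product_sigma_finite "\<lambda>_::'i. N" ..
  let ?P = "PiM I (\<lambda>_. N)" and ?Q = "PiM (insert e I) (\<lambda>_. N)"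
  interpret P: prob_space ?P by (intro prob_space_PiM N)
  interpret Q: prob_space ?Q by (intro prob_space_PiM N)
  note [measurable] = insert.prems(1)
  note bd = insert.prems(2)
  let ?B = "\<bar>B\<bar> + \<bar>B\<bar>"
  have upd [measurable]: "(\<lambda>(x, y). x(e := y)) \<in> measurable (?P \<Otimes>\<^sub>M N) ?Q"
    by (rule measurable_add_dim)
  have fubini: "(\<integral>x. h x \<partial>?Q) = (\<integral>x. (\<integral>y. h (x(e := y)) \<partial>N) \<partial>?P)"
    if [measurable]: "h \<in> borel_measurable ?Q" and h: "\<And>x. x \<in> space ?Q \<Longrightarrow> \<bar>h x\<bar> \<le> C" for h :: "_ \<Rightarrow> real" and C
    using insert.hyps Q.bounded_integrable[OF that] by (intro PS.product_integral_insert) auto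
  have meas2: "(\<lambda>(x, y). h (x(e := y))) \<in> borel_measurable (?P \<Otimes>\<^sub>M N)"
    if [measurable]: "h \<in> borel_measurable ?Q" for h :: "_ \<Rightarrow> real"
    using measurable_compose[OF upd that] by (simp add: case_prod_beta')
  have meas1: "(\<lambda>y. h (x(e := y))) \<in> borel_measurable N"
    if "h \<in> borel_measurable ?Q" "x \<in> space ?P" for h :: "_ \<Rightarrow> real" and x
    using measurable_Pair2[OF meas2[OF that(1)] that(2)] by simp
  have measI: "(\<lambda>x. \<integral>y. h (x(e := y)) \<partial>N) \<in> borel_measurable ?P"
    if "h \<in> borel_measurable ?Q" for h :: "_ \<Rightarrow> real"
    using N.borel_measurable_lebesgue_integral[OF meas2[OF that]] by simp
  \<comment> \<open>The conditional mean given the old coordinates, to which the induction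
    hypothesis is applied.\<close>
  define g where "g x = (\<integral>y. f (x(e := y)) \<partial>N)" for x
  have g [measurable]: "g \<in> borel_measurable ?P" unfolding g_def[abs_def] by (rule measI) measurable
  have bdx: "\<bar>f (x(e := y))\<bar> \<le> B" if "x \<in> space ?P" "y \<in> space N" for x y
    using that by (intro bd PiM_space_insert)
  have gB: "\<bar>g x\<bar> \<le> B" if "x \<in> space ?P" for x
    unfolding g_def using that bdx by (intro N.abs_integral_le_bound meas1) auto
  have sqB: "\<bar>(a - b)\<^sup>2\<bar> \<le> ?B\<^sup>2" if "\<bar>a\<bar> \<le> B" "\<bar>b\<bar> \<le> B" for a b :: real
  proof -
    have "\<bar>a - b\<bar> \<le> ?B" using that by linarith
    then have "\<bar>a - b\<bar>\<^sup>2 \<le> ?B\<^sup>2" by (intro power_mono) auto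
    then show ?thesis by simp
  qed
  have sqB0: "\<bar>a\<^sup>2\<bar> \<le> ?B\<^sup>2" if "\<bar>a\<bar> \<le> B" for a :: real
    using sqB[of a 0] that by simp
  have zQ: "x(i := z) \<in> space ?Q" if "x \<in> space ?Q" "i \<in> insert e I" for x i
    using that z by (intro PiM_space_update) auto
  have dm: "(\<lambda>x. (f x - f (x(i := z)))\<^sup>2) \<in> borel_measurable ?Q" if i: "i \<in> insert e I" for i
  proof -
    have [measurable]: "(\<lambda>x. x(i := z)) \<in> measurable ?Q ?Q" using i z by (rule measurable_PiM_update)
    show ?thesis by measurable
  qed
  have D: "(\<integral>x. (f x - f (x(i := z)))\<^sup>2 \<partial>?Q) = (\<integral>x. (\<integral>y. (f (x(e := y)) - f ((x(e := y))(i := z)))\<^sup>2 \<partial>N) \<partial>?P)"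
    if i: "i \<in> insert e I" for i
    by (rule fubini[OF dm[OF i] sqB[OF bd bd[OF zQ]]]) (use i in auto)
  have dB: "\<bar>(f (x(e := y)) - f ((x(e := y))(i := z)))\<^sup>2\<bar> \<le> ?B\<^sup>2"
    if "x \<in> space ?P" "y \<in> space N" "i \<in> insert e I" for x y i
    by (intro sqB bd zQ PiM_space_insert that)
  have DP: "integrable ?P (\<lambda>x. \<integral>y. (f (x(e := y)) - f ((x(e := y))(i := z)))\<^sup>2 \<partial>N)" if i: "i \<in> insert e I" for i
    by (rule P.bounded_integrable[OF measI[OF dm[OF i]] N.abs_integral_le_bound[OF meas1[OF dm[OF i]] dB]])
      (use i in auto)
  have g2: "integrable ?P (\<lambda>x. (g x)\<^sup>2)"
    by (rule P.bounded_integrable[OF _ sqB0[OF gB]]) auto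
  have f2: "integrable ?P (\<lambda>x. \<integral>y. (f (x(e := y)))\<^sup>2 \<partial>N)"
  proof (rule P.bounded_integrable)
    show "(\<lambda>x. \<integral>y. (f (x(e := y)))\<^sup>2 \<partial>N) \<in> borel_measurable ?P"
      by (rule measI) measurable
    fix x assume x: "x \<in> space ?P"
    show "\<bar>\<integral>y. (f (x(e := y)))\<^sup>2 \<partial>N\<bar> \<le> ?B\<^sup>2"
      by (rule N.abs_integral_le_bound[OF _ sqB0[OF bdx[OF x]]]) (use x in \<open>auto intro!: meas1\<close>)
  qed
  have "(\<integral>x. (f x)\<^sup>2 \<partial>?Q) - (\<integral>x. (g x)\<^sup>2 \<partial>?P) = (\<integral>x. (\<integral>y. (f (x(e := y)))\<^sup>2 \<partial>N) - (g x)\<^sup>2 \<partial>?P)"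
    using f2 g2 fubini[of "\<lambda>x. (f x)\<^sup>2", OF _ sqB0[OF bd]] by simp
  \<comment> \<open>For fixed x the value f (x(e := z)) is a constant in y, so it may serve as the
    centre in \<open>variance_shift\<close>.\<close>
  also have "\<dots> \<le> (\<integral>x. (\<integral>y. (f (x(e := y)) - f ((x(e := y))(e := z)))\<^sup>2 \<partial>N) \<partial>?P)"
  proof (rule integral_mono)
    fix x assume x: "x \<in> space ?P"
    show "(\<integral>y. (f (x(e := y)))\<^sup>2 \<partial>N) - (g x)\<^sup>2 \<le> (\<integral>y. (f (x(e := y)) - f ((x(e := y))(e := z)))\<^sup>2 \<partial>N)"
      unfolding g_def
      by (subst N.variance_shift[where c = "f (x(e := z))" and B = B])
        (use x bdx in \<open>auto intro!: meas1\<close>)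
  qed (use f2 g2 DP[of e] in auto)
  also have "\<dots> = (\<integral>x. (f x - f (x(e := z)))\<^sup>2 \<partial>?Q)" using D[of e] by simp
  finally have 1: "(\<integral>x. (f x)\<^sup>2 \<partial>?Q) - (\<integral>x. (g x)\<^sup>2 \<partial>?P) \<le> (\<integral>x. (f x - f (x(e := z)))\<^sup>2 \<partial>?Q)" .
  have "(\<integral>x. (g x)\<^sup>2 \<partial>?P) - (\<integral>x. g x \<partial>?P)\<^sup>2 \<le> (\<Sum>i\<in>I. \<integral>x. (g x - g (x(i := z)))\<^sup>2 \<partial>?P)"
    using g gB by (rule insert.IH)
  also have "\<dots> \<le> (\<Sum>i\<in>I. \<integral>x. (f x - f (x(i := z)))\<^sup>2 \<partial>?Q)"
  proof (rule sum_mono)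
    fix i assume i: "i \<in> I"
    then have ie: "i \<noteq> e" using insert.hyps by auto
    have zP: "x(i := z) \<in> space ?P" if "x \<in> space ?P" for x using that i z by (intro PiM_space_update) auto
    have [measurable]: "(\<lambda>x. x(i := z)) \<in> measurable ?P ?P" using i z by (rule measurable_PiM_update)
    have "(\<integral>x. (g x - g (x(i := z)))\<^sup>2 \<partial>?P) \<le> (\<integral>x. (\<integral>y. (f (x(e := y)) - f ((x(e := y))(i := z)))\<^sup>2 \<partial>N) \<partial>?P)"
    proof (rule integral_mono)
      show "integrable ?P (\<lambda>x. (g x - g (x(i := z)))\<^sup>2)"
        by (rule P.bounded_integrable[OF _ sqB[OF gB gB[OF zP]]]) auto
      show "integrable ?P (\<lambda>x. \<integral>y. (f (x(e := y)) - f ((x(e := y))(i := z)))\<^sup>2 \<partial>N)"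
        using i by (intro DP) auto
      fix x assume x: "x \<in> space ?P"
      have m1: "(\<lambda>y. f (x(e := y))) \<in> borel_measurable N" using x by (intro meas1) auto
      have m2: "(\<lambda>y. f ((x(i := z))(e := y))) \<in> borel_measurable N" using x by (intro meas1 zP) auto
      have "g x - g (x(i := z)) = (\<integral>y. f (x(e := y)) - f ((x(i := z))(e := y)) \<partial>N)"
        unfolding g_def
        using x bdx zP[OF x] by (intro Bochner_Integration.integral_diff[symmetric] N.bounded_integrable[where B = B] m1 m2) auto
      also have "\<dots> = (\<integral>y. f (x(e := y)) - f ((x(e := y))(i := z)) \<partial>N)"
        using ie by (simp add: fun_upd_twist)
      finally have eq: "g x - g (x(i := z)) = (\<integral>y. f (x(e := y)) - f ((x(e := y))(i := z)) \<partial>N)" .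
      \<comment> \<open>Jensen: overwriting i commutes with integrating out e, and the square of a
        mean is at most the mean of the square.\<close>
      show "(g x - g (x(i := z)))\<^sup>2 \<le> (\<integral>y. (f (x(e := y)) - f ((x(e := y))(i := z)))\<^sup>2 \<partial>N)"
        unfolding eq
      proof (rule N.square_integral_le[where B = ?B])
        show "(\<lambda>y. f (x(e := y)) - f ((x(e := y))(i := z))) \<in> borel_measurable N"
          using m1 m2 ie by (simp add: fun_upd_twist)
        fix y assume y: "y \<in> space N"
        have "\<bar>f (x(e := y))\<bar> \<le> B" "\<bar>f ((x(e := y))(i := z))\<bar> \<le> B"
          using x y i by (auto intro!: bd zQ PiM_space_insert simp del: fun_upd_apply)
        then show "\<bar>f (x(e := y)) - f ((x(e := y))(i := z))\<bar> \<le> ?B" by linarith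
      qed
    qed
    also have "\<dots> = (\<integral>x. (f x - f (x(i := z)))\<^sup>2 \<partial>?Q)" using i by (intro D[symmetric]) auto
    finally show "(\<integral>x. (g x - g (x(i := z)))\<^sup>2 \<partial>?P) \<le> (\<integral>x. (f x - f (x(i := z)))\<^sup>2 \<partial>?Q)" .
  qed
  finally have 2: "(\<integral>x. (g x)\<^sup>2 \<partial>?P) - (\<integral>x. g x \<partial>?P)\<^sup>2 \<le> (\<Sum>i\<in>I. \<integral>x. (f x - f (x(i := z)))\<^sup>2 \<partial>?Q)" .
  have "(\<integral>x. g x \<partial>?P) = (\<integral>x. f x \<partial>?Q)"
    unfolding g_def by (rule fubini[OF _ bd, symmetric]) auto
  then show ?case using 1 2 insert.hyps by (simp del: fun_upd_apply add: fun_upd_def[symmetric])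
qed

text \<open>Efron-Stein is applied to f and then to G = (f - m)^2. The first gives E G <= \<delta>.
  For the second, the squared changes of G sum to at most \<delta> (8 G + 2 \<delta>), of mean at
  most 10 \<delta>^2; the square of E G adds the eleventh \<delta>^2.\<close>

lemma efron_stein_fourth_moment:
  fixes N :: "'a measure" and f :: "('i \<Rightarrow> 'a) \<Rightarrow> real"
  assumes N: "prob_space N" and z: "z \<in> space N" and fin: "finite I"
    and f [measurable]: "f \<in> borel_measurable (PiM I (\<lambda>_. N))"
    and bd: "\<And>x. x \<in> space (PiM I (\<lambda>_. N)) \<Longrightarrow> \<bar>f x\<bar> \<le> B"
    and diff: "\<And>x. x \<in> space (PiM I (\<lambda>_. N)) \<Longrightarrow> (\<Sum>i\<in>I. (f x - f (x(i := z)))\<^sup>2) \<le> \<delta>"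
  shows "(\<integral>x. (f x - (\<integral>x. f x \<partial>PiM I (\<lambda>_. N))) ^ 4 \<partial>PiM I (\<lambda>_. N)) \<le> 11 * \<delta>\<^sup>2"
proof -
  let ?P = "PiM I (\<lambda>_. N)"
  interpret P: prob_space ?P by (intro prob_space_PiM N)
  have zP: "x(i := z) \<in> space ?P" if "x \<in> space ?P" "i \<in> I" for x i using that z by (intro PiM_space_update) auto
  have um: "(\<lambda>x. x(i := z)) \<in> measurable ?P ?P" if "i \<in> I" for i using that z by (rule measurable_PiM_update)
  define m where "m = (\<integral>x. f x \<partial>?P)"
  have mB: "\<bar>m\<bar> \<le> B" unfolding m_def by (rule P.abs_integral_le_bound[OF f bd])
  have \<delta>0: "0 \<le> \<delta>"
  proof -
    obtain x where x: "x \<in> space ?P" using P.not_empty by blast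
    have "0 \<le> (\<Sum>i\<in>I. (f x - f (x(i := z)))\<^sup>2)" by (intro sum_nonneg) auto
    then show ?thesis using diff[OF x] by linarith
  qed
  define G where "G x = (f x - m)\<^sup>2" for x
  have [measurable]: "G \<in> borel_measurable ?P" unfolding G_def[abs_def] by measurable
  have GB: "\<bar>G x\<bar> \<le> (2 * B)\<^sup>2" if "x \<in> space ?P" for x
  proof -
    have "\<bar>f x - m\<bar> \<le> 2 * B" using bd[OF that] mB by linarith
    then have "\<bar>f x - m\<bar>\<^sup>2 \<le> (2 * B)\<^sup>2" by (intro power_mono) auto
    then show ?thesis by (simp add: G_def)
  qed
  have intG: "integrable ?P G" by (rule P.bounded_integrable[OF _ GB]) auto
  have int_d: "integrable ?P (\<lambda>x. (h x - h (x(i := z)))\<^sup>2)"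
    if i: "i \<in> I" and [measurable]: "h \<in> borel_measurable ?P" and h: "\<And>x. x \<in> space ?P \<Longrightarrow> \<bar>h x\<bar> \<le> C" for i h and C :: real
  proof (rule P.bounded_integrable)
    note [measurable] = um[OF i]
    show "(\<lambda>x. (h x - h (x(i := z)))\<^sup>2) \<in> borel_measurable ?P" by measurable
    fix x assume x: "x \<in> space ?P"
    have "\<bar>h x - h (x(i := z))\<bar> \<le> 2 * C" using h[OF x] h[OF zP[OF x i]] by linarith
    then have "\<bar>h x - h (x(i := z))\<bar>\<^sup>2 \<le> (2 * C)\<^sup>2" by (intro power_mono) auto
    then show "\<bar>(h x - h (x(i := z)))\<^sup>2\<bar> \<le> (2 * C)\<^sup>2" by simp
  qed
  have EG: "(\<integral>x. G x \<partial>?P) = (\<integral>x. (f x)\<^sup>2 \<partial>?P) - m\<^sup>2"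
    using P.variance_shift[OF f bd, of m] by (simp add: G_def m_def)
  also have "\<dots> \<le> (\<Sum>i\<in>I. \<integral>x. (f x - f (x(i := z)))\<^sup>2 \<partial>?P)"
    unfolding m_def by (rule efron_stein[OF N z fin f bd])
  also have "\<dots> = (\<integral>x. (\<Sum>i\<in>I. (f x - f (x(i := z)))\<^sup>2) \<partial>?P)"
    using bd by (intro Bochner_Integration.integral_sum[symmetric] int_d) auto
  also have "\<dots> \<le> (\<integral>x. \<delta> \<partial>?P)"
    using bd diff by (intro integral_mono Bochner_Integration.integrable_sum int_d) auto
  finally have var: "(\<integral>x. G x \<partial>?P) \<le> \<delta>" by (simp add: P.prob_space)
  have Gnn: "0 \<le> (\<integral>x. G x \<partial>?P)" by (simp add: G_def)
  have "(\<integral>x. (G x)\<^sup>2 \<partial>?P) - (\<integral>x. G x \<partial>?P)\<^sup>2 \<le> (\<Sum>i\<in>I. \<integral>x. (G x - G (x(i := z)))\<^sup>2 \<partial>?P)"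
    by (rule efron_stein[OF N z fin _ GB]) auto
  also have "\<dots> = (\<integral>x. (\<Sum>i\<in>I. (G x - G (x(i := z)))\<^sup>2) \<partial>?P)"
    by (intro Bochner_Integration.integral_sum[symmetric] int_d[OF _ _ GB]) auto
  also have "\<dots> \<le> (\<integral>x. 8 * \<delta> * G x + 2 * \<delta>\<^sup>2 \<partial>?P)"
  proof (rule integral_mono)
    show "integrable ?P (\<lambda>x. \<Sum>i\<in>I. (G x - G (x(i := z)))\<^sup>2)"
      by (intro Bochner_Integration.integrable_sum int_d[OF _ _ GB]) auto
    show "integrable ?P (\<lambda>x. 8 * \<delta> * G x + 2 * \<delta>\<^sup>2)"
      using intG by simp
    fix x assume x: "x \<in> space ?P"
    let ?d = "\<lambda>i. f x - f (x(i := z))"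
    have d1: "(?d i)\<^sup>2 \<le> \<delta>" if "i \<in> I" for i
      using member_le_sum[of i I "\<lambda>i. (?d i)\<^sup>2"] that fin diff[OF x] by fastforce
    have "(G x - G (x(i := z)))\<^sup>2 \<le> (?d i)\<^sup>2 * (8 * G x + 2 * \<delta>)" if "i \<in> I" for i
    proof -
      \<comment> \<open>Factoring the difference of squares keeps d^2 as a factor, so the
        deterministic bound \<delta> on the sum of all d^2 can be used once more.\<close>
      have "G x - G (x(i := z)) = ?d i * (2 * (f x - m) - ?d i)"
        by (simp add: G_def power2_eq_square algebra_simps)
      then have "(G x - G (x(i := z)))\<^sup>2 = (?d i)\<^sup>2 * (2 * (f x - m) - ?d i)\<^sup>2"
        by (simp add: power_mult_distrib)
      also have "(2 * (f x - m) - ?d i)\<^sup>2 \<le> 8 * (f x - m)\<^sup>2 + 2 * (?d i)\<^sup>2"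
        using zero_le_power2[of "2 * (f x - m) + ?d i"] by (simp add: power2_eq_square algebra_simps)
      also have "\<dots> \<le> 8 * G x + 2 * \<delta>" using d1[OF that] by (simp add: G_def)
      finally show ?thesis by (simp add: mult_left_mono del: fun_upd_apply)
    qed
    then have "(\<Sum>i\<in>I. (G x - G (x(i := z)))\<^sup>2) \<le> (\<Sum>i\<in>I. (?d i)\<^sup>2 * (8 * G x + 2 * \<delta>))"
      by (rule sum_mono)
    also have "\<dots> = (\<Sum>i\<in>I. (?d i)\<^sup>2) * (8 * G x + 2 * \<delta>)" by (rule sum_distrib_right[symmetric])
    also have "\<dots> \<le> \<delta> * (8 * G x + 2 * \<delta>)"
      using \<delta>0 by (intro mult_right_mono diff x) (auto simp: G_def)
    finally show "(\<Sum>i\<in>I. (G x - G (x(i := z)))\<^sup>2) \<le> 8 * \<delta> * G x + 2 * \<delta>\<^sup>2"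
      by (simp add: algebra_simps power2_eq_square)
  qed
  also have "\<dots> = 8 * \<delta> * (\<integral>x. G x \<partial>?P) + 2 * \<delta>\<^sup>2"
    using intG by (simp add: P.prob_space)
  also have "\<dots> \<le> 8 * \<delta> * \<delta> + 2 * \<delta>\<^sup>2"
    using var \<delta>0 by (intro add_right_mono mult_left_mono) auto
  finally have "(\<integral>x. (G x)\<^sup>2 \<partial>?P) \<le> 10 * \<delta>\<^sup>2 + (\<integral>x. G x \<partial>?P)\<^sup>2"
    by (simp add: power2_eq_square)
  also have "(\<integral>x. G x \<partial>?P)\<^sup>2 \<le> \<delta>\<^sup>2" using var Gnn by (intro power_mono)
  finally have "(\<integral>x. (G x)\<^sup>2 \<partial>?P) \<le> 11 * \<delta>\<^sup>2" by simp
  moreover have "(G x)\<^sup>2 = (f x - m) ^ 4" for x by (simp add: G_def power_mult[symmetric])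
  ultimately show ?thesis by (simp add: m_def)
qed

section \<open>Bounded differences of the spectral moments\<close>

definition upper_pairs :: "nat \<Rightarrow> (nat \<times> nat) set" where
  "upper_pairs n = {(i, j). i \<le> j \<and> j < n}"

lemma upper_pairs_subset: "upper_pairs n \<subseteq> {..<n} \<times> {..<n}"
  by (auto simp: upper_pairs_def)

lemma finite_upper_pairs [simp]: "finite (upper_pairs n)"
  by (rule finite_subset[OF upper_pairs_subset]) simp

definition sorted_pair :: "nat \<Rightarrow> nat \<Rightarrow> nat \<times> nat" where
  "sorted_pair i j = (min i j, max i j)"

lemma sorted_pair_le: "i \<le> j \<Longrightarrow> sorted_pair i j = (i, j)"
  by (simp add: sorted_pair_def)

lemma sorted_pair_upper: "i < n \<Longrightarrow> j < n \<Longrightarrow> sorted_pair i j \<in> upper_pairs n"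
  by (auto simp: sorted_pair_def upper_pairs_def)

lemma sorted_pair_eq_iff: "sorted_pair i j = sorted_pair k l \<longleftrightarrow> (i = k \<and> j = l) \<or> (i = l \<and> j = k)"
  by (auto simp: sorted_pair_def min_def max_def split: if_splits)

text \<open>The absolute value makes the weights nonnegative everywhere and not only almost everywhere.\<close>

definition table_weight :: "(nat \<times> nat \<Rightarrow> real) \<Rightarrow> nat \<Rightarrow> nat \<Rightarrow> real" where
  "table_weight x i j = \<bar>x (sorted_pair i j)\<bar>"

lemma table_weight_nonneg [simp]: "0 \<le> table_weight x i j"
  by (simp add: table_weight_def)

definition spectral_moment :: "nat \<Rightarrow> nat \<Rightarrow> (nat \<times> nat \<Rightarrow> real) \<Rightarrow> real" where
  "spectral_moment n k x = kernel_trace n (kernel_pow n (markov_kernel n (table_weight x)) k) / real n"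

lemma substochastic_table: "substochastic n (markov_kernel n (table_weight x))"
  by (intro substochastic_markov) simp

lemma spectral_moment_bounded: "\<bar>spectral_moment n k x\<bar> \<le> 1"
  unfolding spectral_moment_def
  using kernel_trace_pow_bounds[OF substochastic_table, of n x k]
  by (cases "n = 0") (auto simp: abs_mult)

lemma table_weight_measurable:
  assumes "sets N = sets borel" "i < n" "j < n"
  shows "(\<lambda>x. table_weight x i j) \<in> borel_measurable (PiM (upper_pairs n) (\<lambda>_. N))"
proof -
  have "(\<lambda>x. x (sorted_pair i j)) \<in> measurable (PiM (upper_pairs n) (\<lambda>_. N)) N"
    using assms by (intro measurable_component_singleton sorted_pair_upper)
  then have "(\<lambda>x. x (sorted_pair i j)) \<in> borel_measurable (PiM (upper_pairs n) (\<lambda>_. N))"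
    using assms(1) by (simp cong: measurable_cong_sets)
  then show ?thesis unfolding table_weight_def by measurable
qed

lemma markov_kernel_measurable:
  assumes N: "sets N = sets borel" "i < n" "j < n"
  shows "(\<lambda>x. markov_kernel n (table_weight x) i j) \<in> borel_measurable (PiM (upper_pairs n) (\<lambda>_. N))"
proof -
  have "(\<lambda>x. \<Sum>k<n. table_weight x i k) \<in> borel_measurable (PiM (upper_pairs n) (\<lambda>_. N))"
    using N by (intro borel_measurable_sum table_weight_measurable) auto
  moreover have "(\<lambda>x. table_weight x i j) \<in> borel_measurable (PiM (upper_pairs n) (\<lambda>_. N))"
    using N by (intro table_weight_measurable)
  ultimately show ?thesis
    unfolding markov_kernel_def markov_row_def Let_def by measurable
qed

lemma kernel_pow_measurable:
  assumes "\<And>i j. i < n \<Longrightarrow> j < n \<Longrightarrow> (\<lambda>x. K x i j) \<in> borel_measurable M" "i < n" "j < n"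
  shows "(\<lambda>x. kernel_pow n (K x) k i j) \<in> borel_measurable M"
  using assms(2,3)
proof (induction k arbitrary: j)
  case (Suc k)
  then show ?case
    unfolding kernel_pow.simps kernel_prod_def
    by (intro borel_measurable_sum borel_measurable_times assms(1)) auto
qed simp

lemma kernel_trace_pow_measurable:
  assumes "\<And>i j. i < n \<Longrightarrow> j < n \<Longrightarrow> (\<lambda>x. K x i j) \<in> borel_measurable M"
  shows "(\<lambda>x. kernel_trace n (kernel_pow n (K x) k)) \<in> borel_measurable M"
  unfolding kernel_trace_def
  by (intro borel_measurable_sum kernel_pow_measurable assms) auto

lemma spectral_moment_measurable:
  "sets N = sets borel \<Longrightarrow> spectral_moment n k \<in> borel_measurable (PiM (upper_pairs n) (\<lambda>_. N))"
  unfolding spectral_moment_def[abs_def]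
  by (intro borel_measurable_divide kernel_trace_pow_measurable markov_kernel_measurable) auto

text \<open>The Markov kernel entry, except that a vanishing row yields 0 through division by zero;
  hence row sums are at most 1 rather than equal to 1.\<close>

definition entry_ratio :: "nat \<Rightarrow> (nat \<times> nat \<Rightarrow> real) \<Rightarrow> nat \<Rightarrow> nat \<Rightarrow> real" where
  "entry_ratio n x i j = table_weight x i j / (\<Sum>k<n. table_weight x i k)"

lemma entry_ratio_nonneg: "0 \<le> entry_ratio n x i j"
  unfolding entry_ratio_def by (intro divide_nonneg_nonneg sum_nonneg) auto

lemma entry_ratio_sum: "(\<Sum>j<n. entry_ratio n x i j) \<le> 1"
  unfolding entry_ratio_def by (simp add: sum_divide_distrib[symmetric])

lemma entry_ratio_le_1: "j < n \<Longrightarrow> entry_ratio n x i j \<le> 1"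
  using member_le_sum[of j "{..<n}" "entry_ratio n x i"] entry_ratio_sum[of n x i] entry_ratio_nonneg
  by fastforce

text \<open>By symmetry the weight of a pair occurs in the rows of both its indices and nowhere
  else. On the diagonal the two rows coincide and the bound counts it twice.\<close>

lemma markov_kernel_zero_entry:
  assumes e: "(i0, j0) \<in> upper_pairs n"
  shows "(\<Sum>i<n. \<Sum>j<n. \<bar>markov_kernel n (table_weight x) i j - markov_kernel n (table_weight (x((i0, j0) := 0))) i j\<bar>)
    \<le> 2 * (entry_ratio n x i0 j0 + entry_ratio n x j0 i0)"
proof -
  have ij: "i0 \<le> j0" "j0 < n" using e by (auto simp: upper_pairs_def)
  let ?x = "x((i0, j0) := 0)"
  let ?R = "\<lambda>i. \<Sum>j<n. \<bar>markov_kernel n (table_weight x) i j - markov_kernel n (table_weight ?x) i j\<bar>"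
  have row: "?R i \<le> 2 * entry_ratio n x i l"
    if "table_weight ?x i = (table_weight x i)(l := 0)" "i < n" "l < n" for i l
    using markov_row_zero_entry[of "table_weight x i" i n l] that
    by (simp add: markov_kernel_def entry_ratio_def)
  have sp: "sorted_pair i j = (i0, j0) \<longleftrightarrow> (i = i0 \<and> j = j0) \<or> (i = j0 \<and> j = i0)" for i j
    using ij sorted_pair_eq_iff[of i j i0 j0] by (simp add: sorted_pair_le)
  have r1: "?R i0 \<le> 2 * entry_ratio n x i0 j0"
    using ij by (intro row) (auto simp: table_weight_def fun_eq_iff sp)
  have r2: "?R j0 \<le> 2 * entry_ratio n x j0 i0"
    using ij by (intro row) (auto simp: table_weight_def fun_eq_iff sp)
  have r3: "?R i = 0" if "i \<noteq> i0" "i \<noteq> j0" for i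
  proof -
    have "table_weight ?x i = table_weight x i"
      using that by (auto simp: table_weight_def fun_eq_iff sp)
    then show ?thesis by (simp add: markov_kernel_def)
  qed
  have "(\<Sum>i<n. ?R i) = (\<Sum>i\<in>{i0, j0}. ?R i)"
    using ij r3 by (intro sum.mono_neutral_right) auto
  also have "\<dots> \<le> ?R i0 + ?R j0"
    by (cases "i0 = j0") (auto intro!: sum_nonneg)
  also have "\<dots> \<le> 2 * (entry_ratio n x i0 j0 + entry_ratio n x j0 i0)"
    using r1 r2 by simp
  finally show ?thesis .
qed

text \<open>One change is at most (2 k / n) s with s the sum of the two entries of the pair. Since s
  <= 2, its square is at most 2 s, and as rows have mass at most 1 the s add up to at most 2 n. This
  linearisation gives 1 / n for every table, whatever the law.\<close>

lemma spectral_moment_square_diff: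
  "(\<Sum>e\<in>upper_pairs n. (spectral_moment n k x - spectral_moment n k (x(e := 0)))\<^sup>2) \<le> 16 * (real k)\<^sup>2 / real n"
proof (cases "n = 0")
  case True
  then show ?thesis by (simp add: upper_pairs_def)
next
  case False
  let ?a = "\<lambda>i j. entry_ratio n x i j"
  have "(spectral_moment n k x - spectral_moment n k (x((i, j) := 0)))\<^sup>2 \<le> 8 * (real k / real n)\<^sup>2 * (?a i j + ?a j i)"
    if e: "(i, j) \<in> upper_pairs n" for i j
  proof -
    have ij: "i < n" "j < n" using e upper_pairs_subset by auto
    let ?s = "?a i j + ?a j i"
    have s: "0 \<le> ?s" "?s \<le> 2"
      using entry_ratio_nonneg entry_ratio_le_1[OF ij(1), of x j] entry_ratio_le_1[OF ij(2), of x i] by (auto intro: add_nonneg_nonneg)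
    have "\<bar>spectral_moment n k x - spectral_moment n k (x((i, j) := 0))\<bar>
      = \<bar>kernel_trace n (kernel_pow n (markov_kernel n (table_weight x)) k)
         - kernel_trace n (kernel_pow n (markov_kernel n (table_weight (x((i, j) := 0)))) k)\<bar> / real n"
      by (simp add: spectral_moment_def diff_divide_distrib[symmetric])
    also have "\<dots> \<le> real k * (2 * ?s) / real n"
      by (intro divide_right_mono order_trans[OF kernel_trace_pow_diff[OF substochastic_table substochastic_table]]
          mult_left_mono markov_kernel_zero_entry e) auto
    also have "\<dots> = 2 * (real k / real n) * ?s" by simp
    finally have "\<bar>spectral_moment n k x - spectral_moment n k (x((i, j) := 0))\<bar> \<le> 2 * (real k / real n) * ?s" .
    then have "\<bar>spectral_moment n k x - spectral_moment n k (x((i, j) := 0))\<bar>\<^sup>2 \<le> (2 * (real k / real n) * ?s)\<^sup>2"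
      by (intro power_mono) auto
    also have "\<dots> = 4 * (real k / real n)\<^sup>2 * ?s * ?s"
      by (simp add: power2_eq_square)
    also have "\<dots> \<le> 4 * (real k / real n)\<^sup>2 * ?s * 2"
      using s by (intro mult_left_mono) auto
    finally show ?thesis by simp
  qed
  then have "(\<Sum>e\<in>upper_pairs n. (spectral_moment n k x - spectral_moment n k (x(e := 0)))\<^sup>2)
      \<le> (\<Sum>(i, j)\<in>upper_pairs n. 8 * (real k / real n)\<^sup>2 * (?a i j + ?a j i))"
    by (intro sum_mono) auto
  also have "\<dots> = 8 * (real k / real n)\<^sup>2 * ((\<Sum>(i, j)\<in>upper_pairs n. ?a i j) + (\<Sum>(i, j)\<in>upper_pairs n. ?a j i))"
    by (simp add: sum_distrib_left[symmetric] sum.distrib case_prod_beta)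
  also have "\<dots> \<le> 8 * (real k / real n)\<^sup>2 * (real n + real n)"
  proof (intro mult_left_mono add_mono)
    have "(\<Sum>(i, j)\<in>upper_pairs n. ?a i j) \<le> (\<Sum>(i, j)\<in>{..<n} \<times> {..<n}. ?a i j)"
      using upper_pairs_subset by (intro sum_mono2) (auto simp: entry_ratio_nonneg)
    also have "\<dots> = (\<Sum>i<n. \<Sum>j<n. ?a i j)" by (simp add: sum.cartesian_product)
    also have "\<dots> \<le> (\<Sum>i<n. 1)" by (intro sum_mono entry_ratio_sum)
    finally show "(\<Sum>(i, j)\<in>upper_pairs n. ?a i j) \<le> real n" by simp
    have "(\<Sum>(i, j)\<in>upper_pairs n. ?a j i) \<le> (\<Sum>(i, j)\<in>{..<n} \<times> {..<n}. ?a j i)"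
      using upper_pairs_subset by (intro sum_mono2) (auto simp: entry_ratio_nonneg)
    also have "\<dots> = (\<Sum>i<n. \<Sum>j<n. ?a j i)" by (simp add: sum.cartesian_product)
    also have "\<dots> = (\<Sum>j<n. \<Sum>i<n. ?a j i)" by (rule sum.swap)
    also have "\<dots> \<le> (\<Sum>j<n. 1)" by (intro sum_mono entry_ratio_sum)
    finally show "(\<Sum>(i, j)\<in>upper_pairs n. ?a j i) \<le> real n" by simp
  qed simp
  also have "\<dots> = 16 * (real k)\<^sup>2 / real n"
    using False by (simp add: power2_eq_square)
  finally show ?thesis .
qed

lemma spectral_moment_concentration:
  assumes "real_distribution D"
  shows "(\<integral>x. (spectral_moment n k x - (\<integral>x. spectral_moment n k x \<partial>PiM (upper_pairs n) (\<lambda>_. D))) ^ 4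
           \<partial>PiM (upper_pairs n) (\<lambda>_. D)) \<le> 11 * (16 * (real k)\<^sup>2 / real n)\<^sup>2"
proof -
  interpret real_distribution D by fact
  show ?thesis
    by (rule efron_stein_fourth_moment[where B = 1 and z = 0])
      (use spectral_moment_measurable spectral_moment_bounded spectral_moment_square_diff prob_space_axioms in auto)
qed

section \<open>Shapes of closed walks\<close>

text \<open>The falling factorial, extending an injection by one point at a time. Truncated
  subtraction produces a factor 0 when V is larger than B.\<close>

lemma card_inj_PiE:
  assumes "finite V" "finite B"
  shows "card {f \<in> PiE V (\<lambda>_. B). inj_on f V} = (\<Prod>i<card V. card B - i)"
  using assms(1)
proof (induction V)
  case empty
  then show ?case by simp
next
  case (insert a V)
  let ?S = "\<lambda>V. {f \<in> PiE V (\<lambda>_. B). inj_on f V}"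
  have fin: "finite (?S V)"
  proof (rule finite_subset)
    show "?S V \<subseteq> PiE V (\<lambda>_. B)" by blast
    show "finite (PiE V (\<lambda>_. B))" using insert.hyps assms(2) by (intro finite_PiE)
  qed
  let ?\<phi> = "\<lambda>(y, g). g(a := y)"
  have eq: "?S (insert a V) = ?\<phi> ` (\<lambda>(g, y). (y, g)) ` (SIGMA g:?S V. B - g ` V)"
  proof (rule equalityI; rule subsetI)
    fix f assume f: "f \<in> ?S (insert a V)"
    then have "f \<in> ?\<phi> ` (B \<times> PiE V (\<lambda>_. B))" by (simp add: PiE_insert_eq)
    then obtain p where p: "f = ?\<phi> p" "p \<in> B \<times> PiE V (\<lambda>_. B)" by (rule imageE)
    obtain y g where "p = (y, g)" by (cases p)
    with p have yg: "y \<in> B" "g \<in> PiE V (\<lambda>_. B)" "f = g(a := y)" by auto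
    have inj: "inj_on (g(a := y)) (insert a V)" using f unfolding yg(3) by blast
    have "inj_on g V"
    proof (rule inj_onI)
      fix u v assume "u \<in> V" "v \<in> V" "g u = g v"
      moreover from this have "u \<noteq> a" "v \<noteq> a" using insert.hyps by auto
      ultimately show "u = v" using inj_onD[OF inj, of u v] by simp
    qed
    moreover have "y \<notin> g ` V"
    proof
      assume "y \<in> g ` V"
      then obtain u where u: "u \<in> V" "y = g u" by blast
      then have "u \<noteq> a" using insert.hyps by auto
      moreover from this u have "u = a" by (intro inj_onD[OF inj]) auto
      ultimately show False by blast
    qed
    ultimately have "(g, y) \<in> (SIGMA g:?S V. B - g ` V)" using yg by blast
    then show "f \<in> ?\<phi> ` (\<lambda>(g, y). (y, g)) ` (SIGMA g:?S V. B - g ` V)"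
      unfolding yg(3) by (intro image_eqI[where x = "(y, g)"] image_eqI[where x = "(g, y)"]) auto
  next
    fix f assume "f \<in> ?\<phi> ` (\<lambda>(g, y). (y, g)) ` (SIGMA g:?S V. B - g ` V)"
    then have "f \<in> (\<lambda>p. ?\<phi> ((\<lambda>(g, y). (y, g)) p)) ` (SIGMA g:?S V. B - g ` V)"
      by (simp only: image_image)
    then obtain p where p: "f = ?\<phi> ((\<lambda>(g, y). (y, g)) p)" "p \<in> (SIGMA g:?S V. B - g ` V)"
      by (rule imageE)
    obtain g y where gy: "p = (g, y)" by (cases p)
    have yg: "g \<in> PiE V (\<lambda>_. B)" "inj_on g V" "y \<in> B" "y \<notin> g ` V" "f = g(a := y)"
      using p unfolding gy by simp_all
    have "f \<in> PiE (insert a V) (\<lambda>_. B)" unfolding yg(5) using yg by (intro PiE_fun_upd)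
    moreover have "inj_on f (insert a V)"
    proof (rule inj_onI)
      fix u v assume "u \<in> insert a V" "v \<in> insert a V" "f u = f v"
      then show "u = v" using yg inj_onD[OF yg(2), of u v] insert.hyps by (auto split: if_splits)
    qed
    ultimately show "f \<in> ?S (insert a V)" by blast
  qed
  have inj: "inj_on ?\<phi> (B \<times> PiE V (\<lambda>_. B))"
    by (rule inj_combinator) (use insert.hyps in simp)
  have "card (?S (insert a V)) = card ((\<lambda>(g, y). (y, g)) ` (SIGMA g:?S V. B - g ` V))"
    unfolding eq by (intro card_image inj_on_subset[OF inj]) auto
  also have "\<dots> = card (SIGMA g:?S V. B - g ` V)"
    by (intro card_image) (auto simp: inj_on_def)
  finally have "card (?S (insert a V)) = card (SIGMA g:?S V. B - g ` V)" .
  also have "\<dots> = (\<Sum>g\<in>?S V. card (B - g ` V))"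
    using fin assms(2) by (intro card_SigmaI) auto
  also have "\<dots> = (\<Sum>g\<in>?S V. card B - card V)"
  proof (intro sum.cong refl)
    fix g assume g: "g \<in> ?S V"
    then have "g ` V \<subseteq> B" by (auto simp: PiE_iff)
    then show "card (B - g ` V) = card B - card V"
      using g insert.hyps by (simp add: card_Diff_subset card_image)
  qed
  also have "\<dots> = (\<Prod>i<card (insert a V). card B - i)"
    using insert by (simp add: mult.commute)
  finally show ?case .
qed

lemma falling_factorial_ratio: "(\<lambda>n. real (\<Prod>i<v. n - i) / real n ^ v) \<longlonglongrightarrow> 1"
proof (induction v)
  case (Suc v)
  have "(\<lambda>n. 1 - real v * inverse (real n)) \<longlonglongrightarrow> 1 - real v * 0"
    by (intro tendsto_diff tendsto_mult tendsto_const lim_inverse_n)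
  then have "(\<lambda>n. 1 - real v * inverse (real n)) \<longlonglongrightarrow> 1" by simp
  moreover have "\<forall>\<^sub>F n in sequentially. 1 - real v * inverse (real n) = real (n - v) / real n"
    using eventually_gt_at_top[of v]
    by eventually_elim (simp add: of_nat_diff left_diff_distrib divide_inverse)
  ultimately have "(\<lambda>n. real (n - v) / real n) \<longlonglongrightarrow> 1"
    by (rule Lim_transform_eventually)
  with Suc have "(\<lambda>n. real (\<Prod>i<v. n - i) / real n ^ v * (real (n - v) / real n)) \<longlonglongrightarrow> 1 * 1"
    by (rule tendsto_mult)
  then show ?case by (simp add: mult_ac)
qed simp

text \<open>The two complements have the same cardinality. With this, a labelling of the vertices of
  a walk becomes a relabelling of all indices, under which the weights are exchangeable.\<close>

lemma inj_extends_to_permutation: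
  assumes "finite A" "V \<subseteq> A" "inj_on f V" "f ` V \<subseteq> A"
  obtains \<pi> where "bij_betw \<pi> A A" "\<And>v. v \<in> V \<Longrightarrow> \<pi> v = f v"
proof -
  have fV: "finite V" using assms finite_subset by blast
  have "card (A - V) = card (A - f ` V)"
    using assms fV by (simp add: card_Diff_subset card_image)
  then obtain h where h: "bij_betw h (A - V) (A - f ` V)"
    using assms(1) finite_same_card_bij[of "A - V" "A - f ` V"] by auto
  have "bij_betw (\<lambda>v. if v \<in> V then f v else h v) (V \<union> (A - V)) (f ` V \<union> (A - f ` V))"
    using assms h by (intro bij_betw_disjoint_Un) (auto intro: inj_on_imp_bij_betw)
  moreover have "V \<union> (A - V) = A" "f ` V \<union> (A - f ` V) = A" using assms by auto
  ultimately show thesis by (intro that[of "\<lambda>v. if v \<in> V then f v else h v"]) auto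
qed

text \<open>In the canonical form of a walk every vertex is named by the time of its first visit.\<close>

definition canonical_form :: "nat \<Rightarrow> (nat \<Rightarrow> nat) \<Rightarrow> nat \<Rightarrow> nat" where
  "canonical_form k w = (\<lambda>t\<in>{..<k}. LEAST s. w s = w t)"

text \<open>These are the set partitions of {0, ..., k - 1}, each block represented by its least
  element: c t lies in the block of t and is below each of its members.\<close>

definition canonical_words :: "nat \<Rightarrow> (nat \<Rightarrow> nat) set" where
  "canonical_words k = {c \<in> PiE {..<k} (\<lambda>_. {..<k}). \<forall>t<k. c t \<le> t \<and> c (c t) = c t}"

lemma finite_canonical_words [simp]: "finite (canonical_words k)"
  unfolding canonical_words_def by (rule finite_subset[OF _ finite_PiE[of "{..<k}" "\<lambda>_. {..<k}"]]) auto

lemma canonical_form_eq: "t < k \<Longrightarrow> w (canonical_form k w t) = w t"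
  unfolding canonical_form_def by (simp add: LeastI[of "\<lambda>s. w s = w t" t])

lemma canonical_form_le: "t < k \<Longrightarrow> canonical_form k w t \<le> t"
  unfolding canonical_form_def by (simp add: Least_le[of "\<lambda>s. w s = w t" t])

lemma canonical_form_cong: "s < k \<Longrightarrow> t < k \<Longrightarrow> w s = w t \<Longrightarrow> canonical_form k w s = canonical_form k w t"
  unfolding canonical_form_def by simp

lemma canonical_form_words: "canonical_form k w \<in> canonical_words k"
proof -
  have lt: "canonical_form k w t < k" if "t < k" for t using canonical_form_le[OF that, of w] that by simp
  have "canonical_form k w (canonical_form k w t) = canonical_form k w t" if "t < k" for t
    by (rule canonical_form_cong) (use lt[OF that] that canonical_form_eq[OF that] in auto)
  moreover have "canonical_form k w \<in> extensional {..<k}"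
    by (simp add: canonical_form_def)
  ultimately show ?thesis
    unfolding canonical_words_def using canonical_form_le lt by (simp add: PiE_iff)
qed

lemma canonical_words_lt: "c \<in> canonical_words k \<Longrightarrow> t < k \<Longrightarrow> c t < k"
  by (auto simp: canonical_words_def)

lemma canonical_words_le: "c \<in> canonical_words k \<Longrightarrow> t < k \<Longrightarrow> c t \<le> t"
  by (auto simp: canonical_words_def)

lemma canonical_words_idem: "c \<in> canonical_words k \<Longrightarrow> t < k \<Longrightarrow> c (c t) = c t"
  by (auto simp: canonical_words_def)

lemma canonical_verts_fix: "c \<in> canonical_words k \<Longrightarrow> v \<in> c ` {..<k} \<Longrightarrow> c v = v"
  by (auto simp: canonical_words_def)

lemma canonical_verts_subset: "c \<in> canonical_words k \<Longrightarrow> c ` {..<k} \<subseteq> {..<k}"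
  by (auto simp: canonical_words_def)

lemma canonical_form_inj:
  assumes "canonical_form k w = c"
  shows "inj_on w (c ` {..<k})"
proof (rule inj_onI)
  fix u v assume uv: "u \<in> c ` {..<k}" "v \<in> c ` {..<k}" "w u = w v"
  have c: "c \<in> canonical_words k" using assms canonical_form_words by auto
  have "u < k" "v < k" using uv canonical_verts_subset[OF c] by auto
  then have "c u = c v" using canonical_form_cong[of u k v w] uv(3) unfolding assms by blast
  moreover have "c u = u" "c v = v" using canonical_verts_fix[OF c] uv(1,2) by blast+
  ultimately show "u = v" by metis
qed

text \<open>A walk of shape c is an injective labelling f of the vertices of c, namely the walk f (c
  t); conversely f is its restriction to the times of first visits.\<close>

lemma card_canonical_form:
  assumes c: "c \<in> canonical_words k"
  shows "card {w \<in> PiE {..<k} (\<lambda>_. {..<n}). canonical_form k w = c} = (\<Prod>i<card (c ` {..<k}). n - i)"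
proof -
  let ?V = "c ` {..<k}"
  have Vk: "?V \<subseteq> {..<k}" by (rule canonical_verts_subset[OF c])
  have "bij_betw (\<lambda>w. restrict w ?V) {w \<in> PiE {..<k} (\<lambda>_. {..<n}). canonical_form k w = c}
      {f \<in> PiE ?V (\<lambda>_. {..<n}). inj_on f ?V}"
  proof (rule bij_betw_byWitness[where f' = "\<lambda>f. \<lambda>t\<in>{..<k}. f (c t)"])
    show "\<forall>w\<in>{w \<in> PiE {..<k} (\<lambda>_. {..<n}). canonical_form k w = c}. (\<lambda>t\<in>{..<k}. (restrict w ?V) (c t)) = w"
      using canonical_form_eq by (fastforce simp: PiE_iff extensional_def fun_eq_iff)
    show "\<forall>f\<in>{f \<in> PiE ?V (\<lambda>_. {..<n}). inj_on f ?V}. restrict (\<lambda>t\<in>{..<k}. f (c t)) ?V = f"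
    proof
      fix f assume f: "f \<in> {f \<in> PiE ?V (\<lambda>_. {..<n}). inj_on f ?V}"
      show "restrict (\<lambda>t\<in>{..<k}. f (c t)) ?V = f"
      proof
        fix v
        show "restrict (\<lambda>t\<in>{..<k}. f (c t)) ?V v = f v"
        proof (cases "v \<in> ?V")
          case True
          then have "v < k" using Vk by auto
          moreover have "c v = v" using canonical_verts_fix[OF c True] .
          ultimately show ?thesis using True by simp
        next
          case False
          then show ?thesis using f by (auto simp: PiE_iff extensional_def)
        qed
      qed
    qed
    show "(\<lambda>w. restrict w ?V) ` {w \<in> PiE {..<k} (\<lambda>_. {..<n}). canonical_form k w = c}
        \<subseteq> {f \<in> PiE ?V (\<lambda>_. {..<n}). inj_on f ?V}"
    proof (rule image_subsetI)
      fix w assume w: "w \<in> {w \<in> PiE {..<k} (\<lambda>_. {..<n}). canonical_form k w = c}"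
      then have "inj_on w ?V" using canonical_form_inj by blast
      then show "restrict w ?V \<in> {f \<in> PiE ?V (\<lambda>_. {..<n}). inj_on f ?V}"
        using w Vk by (auto simp: PiE_iff)
    qed
    show "(\<lambda>f. \<lambda>t\<in>{..<k}. f (c t)) ` {f \<in> PiE ?V (\<lambda>_. {..<n}). inj_on f ?V}
        \<subseteq> {w \<in> PiE {..<k} (\<lambda>_. {..<n}). canonical_form k w = c}"
    proof (rule image_subsetI)
      fix f assume f: "f \<in> {f \<in> PiE ?V (\<lambda>_. {..<n}). inj_on f ?V}"
      let ?w = "\<lambda>t\<in>{..<k}. f (c t)"
      have "canonical_form k ?w t = c t" for t
      proof (cases "t < k")
        case True
        have "(LEAST s. ?w s = ?w t) = c t"
        proof (rule Least_equality)
          have "c t < k" using canonical_words_lt[OF c True] .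
          then show "?w (c t) = ?w t" using canonical_words_idem[OF c True] True by simp
          fix s assume s: "?w s = ?w t"
          show "c t \<le> s"
          proof (rule ccontr)
            assume "\<not> c t \<le> s"
            then have sk: "s < k" "s < c t" using canonical_words_lt[OF c True] by auto
            then have "f (c s) = f (c t)" using s True by simp
            then have "c s = c t" using f sk True by (auto simp: inj_on_def)
            then show False using canonical_words_le[OF c sk(1)] sk by simp
          qed
        qed
        then show ?thesis using True by (simp add: canonical_form_def)
      next
        case False
        then show ?thesis using c by (auto simp: canonical_form_def canonical_words_def PiE_iff extensional_def)
      qed
      then show "?w \<in> {w \<in> PiE {..<k} (\<lambda>_. {..<n}). canonical_form k w = c}"
        using f by (auto simp: PiE_iff)
    qed
  qed
  then have "card {w \<in> PiE {..<k} (\<lambda>_. {..<n}). canonical_form k w = c} = card {f \<in> PiE ?V (\<lambda>_. {..<n}). inj_on f ?V}"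
    by (rule bij_betw_same_card)
  then show ?thesis by (subst (asm) card_inj_PiE) auto
qed

section \<open>Edges of a shape, and trees\<close>

definition word_edge :: "nat \<Rightarrow> (nat \<Rightarrow> nat) \<Rightarrow> nat \<Rightarrow> nat \<times> nat" where
  "word_edge k w t = sorted_pair (w t) (w (next_step k t))"

definition word_edges :: "nat \<Rightarrow> (nat \<Rightarrow> nat) \<Rightarrow> (nat \<times> nat) set" where
  "word_edges k w = word_edge k w ` {..<k}"

lemma next_step_lt: "t < k \<Longrightarrow> next_step k t < k"
  by (auto simp: next_step_def)

lemma bij_next_step: "bij_betw (next_step k) {..<k} {..<k}"
proof -
  have "inj_on (next_step k) {..<k}" by (auto simp: inj_on_def next_step_def split: if_splits)
  moreover have "next_step k ` {..<k} \<subseteq> {..<k}" by (auto simp: next_step_lt)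
  ultimately show ?thesis by (simp add: bij_betw_def endo_inj_surj)
qed

text \<open>The spanning tree of first visits. A vertex is named by its first visit, so i > 0 is
  first reached by the step from c (i - 1). These edges are distinct because i is the larger end of
  its edge.\<close>

lemma card_tree_edges:
  assumes c: "c \<in> canonical_words k" and k: "0 < k"
  defines "\<tau> \<equiv> \<lambda>i. sorted_pair (c (i - 1)) i"
  shows "\<tau> ` (c ` {..<k} - {0}) \<subseteq> word_edges k c"
    and "card (\<tau> ` (c ` {..<k} - {0})) = card (c ` {..<k}) - 1"
    and "0 \<in> c ` {..<k}"
proof -
  show 0: "0 \<in> c ` {..<k}"
  proof -
    have "c 0 = 0" using canonical_words_le[OF c k] by simp
    then show ?thesis using k by (metis image_eqI lessThan_iff)
  qed
  have lt: "c (i - 1) < i" if "i \<in> c ` {..<k} - {0}" for i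
    using canonical_words_le[OF c, of "i - 1"] that canonical_verts_subset[OF c] by fastforce
  show "\<tau> ` (c ` {..<k} - {0}) \<subseteq> word_edges k c"
  proof (rule image_subsetI)
    fix i assume i: "i \<in> c ` {..<k} - {0}"
    then have ik: "i < k" "0 < i" using canonical_verts_subset[OF c] by auto
    have ci: "c i = i" using canonical_verts_fix[OF c] i by blast
    have "next_step k (i - 1) = i" using ik by (simp add: next_step_def)
    then have "\<tau> i = word_edge k c (i - 1)" unfolding \<tau>_def word_edge_def using ci by metis
    then show "\<tau> i \<in> word_edges k c" using ik by (auto simp: word_edges_def)
  qed
  have "inj_on \<tau> (c ` {..<k} - {0})"
  proof (rule inj_onI)
    fix i j assume ij: "i \<in> c ` {..<k} - {0}" "j \<in> c ` {..<k} - {0}" "\<tau> i = \<tau> j"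
    have "snd (\<tau> i) = i" "snd (\<tau> j) = j" using lt[OF ij(1)] lt[OF ij(2)] by (auto simp: \<tau>_def sorted_pair_def)
    then show "i = j" using ij(3) by metis
  qed
  then show "card (\<tau> ` (c ` {..<k} - {0})) = card (c ` {..<k}) - 1"
    using 0 by (simp add: card_image)
qed

lemma card_word_edges_ge:
  assumes "c \<in> canonical_words k" "0 < k"
  shows "card (c ` {..<k}) - 1 \<le> card (word_edges k c)"
  using card_mono[OF _ card_tree_edges(1)[OF assms]] card_tree_edges(2)[OF assms]
  by (simp add: word_edges_def)

text \<open>The distance to the root along a parent map p. The guard p i < i makes the recursion
  terminate for every p.\<close>

fun tree_depth :: "(nat \<Rightarrow> nat) \<Rightarrow> nat \<Rightarrow> nat" where
  "tree_depth p i = (if p i < i then Suc (tree_depth p (p i)) else 0)"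

declare tree_depth.simps [simp del]

text \<open>A closed walk whose edges form a tree alternates between the two colour classes of the tree.\<close>

lemma even_tree_word:
  assumes c: "c \<in> canonical_words k" and k: "0 < k"
    and tree: "card (word_edges k c) = card (c ` {..<k}) - 1"
  shows "even k"
proof -
  let ?\<tau> = "\<lambda>i. sorted_pair (c (i - 1)) i"
  let ?d = "tree_depth (\<lambda>i. c (i - 1))"
  \<comment> \<open>With the minimal number of edges the walk uses no others than those of first
    visits, so each step goes between a vertex and its parent.\<close>
  have eq: "?\<tau> ` (c ` {..<k} - {0}) = word_edges k c"
    using card_tree_edges[OF c k] tree by (intro card_subset_eq) (auto simp: word_edges_def)
  have step: "even (?d (c (next_step k t))) \<longleftrightarrow> odd (?d (c t))" if t: "t < k" for t
  proof -
    have "word_edge k c t \<in> ?\<tau> ` (c ` {..<k} - {0})" unfolding eq using t by (auto simp: word_edges_def)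
    then obtain i where i: "i \<in> c ` {..<k} - {0}" "word_edge k c t = ?\<tau> i" by blast
    have "c (i - 1) < i"
      using canonical_words_le[OF c, of "i - 1"] i(1) canonical_verts_subset[OF c] by fastforce
    then have "?d i = Suc (?d (c (i - 1)))" by (subst tree_depth.simps) simp
    moreover have "(c t = c (i - 1) \<and> c (next_step k t) = i) \<or> (c t = i \<and> c (next_step k t) = c (i - 1))"
      using i(2) by (simp add: word_edge_def sorted_pair_eq_iff)
    ultimately show ?thesis by auto
  qed
  \<comment> \<open>The parity of the depth flips at each step and must be restored after k
    steps.\<close>
  have alt: "t < k \<Longrightarrow> even (?d (c t)) \<longleftrightarrow> even (?d (c 0) + t)" for t
  proof (induction t)
    case (Suc t)
    then show ?case using step[of t] by (auto simp: next_step_def split: if_splits)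
  qed simp
  have "even (?d (c 0)) \<longleftrightarrow> odd (?d (c (k - 1)))"
    using step[of "k - 1"] k by (simp add: next_step_def)
  then show ?thesis using alt[of "k - 1"] k by (cases k) auto
qed

section \<open>The mean weight of a closed walk\<close>

lemma prod_over_fibres:
  fixes g :: "'b \<Rightarrow> 'c::comm_monoid_mult"
  assumes "finite T"
  shows "(\<Prod>t\<in>T. g (h t)) = (\<Prod>e\<in>h ` T. g e ^ card {t \<in> T. h t = e})"
proof -
  have "(\<Prod>t\<in>T. g (h t)) = (\<Prod>e\<in>h ` T. \<Prod>t\<in>{t \<in> T. h t = e}. g (h t))"
    by (rule prod.image_gen[OF assms])
  also have "\<dots> = (\<Prod>e\<in>h ` T. \<Prod>t\<in>{t \<in> T. h t = e}. g e)"
    by (intro prod.cong refl) auto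
  finally show ?thesis by simp
qed

text \<open>The Gamma integral for d factors 1 / r. The free scale b is set to the norming later, so
  that for r of order 1 / b the variable y is of order one.\<close>

lemma inverse_power_gamma:
  assumes r: "0 < r" and b: "0 < b" and d: "0 < d"
  shows "(\<integral>\<^sup>+y. ennreal (indicator {0<..} y * (b ^ d * y ^ (d - 1) / fact (d - 1) * exp (- (b * y * r)))) \<partial>lborel) = ennreal (1 / r ^ d)"
proof -
  let ?f = "\<lambda>x::real. ennreal (x ^ (d - 1) * exp (- x)) * indicator {0..} x"
  have br: "0 < b * r" using b r by simp
  have "ennreal (fact (d - 1)) = (\<integral>\<^sup>+x. ?f x \<partial>lborel)"
    by (subst nn_intergal_power_times_exp_Ici) simp
  also have "\<dots> = ennreal \<bar>b * r\<bar> * (\<integral>\<^sup>+y. ?f (0 + (b * r) * y) \<partial>lborel)"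
    using br by (intro nn_integral_real_affine) auto
  also have "\<dots> = (\<integral>\<^sup>+y. ennreal (b * r) * ?f (b * r * y) \<partial>lborel)"
    using br by (subst nn_integral_cmult[symmetric]) auto
  finally have 1: "ennreal (fact (d - 1)) = (\<integral>\<^sup>+y. ennreal (b * r) * ?f (b * r * y) \<partial>lborel)" .
  have "(\<integral>\<^sup>+y. ennreal (indicator {0<..} y * (b ^ d * y ^ (d - 1) / fact (d - 1) * exp (- (b * y * r)))) \<partial>lborel)
    = (\<integral>\<^sup>+y. ennreal (1 / (r ^ d * fact (d - 1))) * (ennreal (b * r) * ?f (b * r * y)) \<partial>lborel)"
  proof (rule nn_integral_cong_AE)
    show "AE y in lborel. ennreal (indicator {0<..} y * (b ^ d * y ^ (d - 1) / fact (d - 1) * exp (- (b * y * r))))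
       = ennreal (1 / (r ^ d * fact (d - 1))) * (ennreal (b * r) * ?f (b * r * y))"
      using AE_lborel_singleton[of 0]
    proof eventually_elim
      case (elim y)
      show ?case
      proof (cases "0 < y")
        case True
        have dd: "z ^ d = z * z ^ (d - 1)" for z :: real using d by (cases d) auto
        have "b ^ d * y ^ (d - 1) / fact (d - 1) * exp (- (b * y * r))
          = 1 / (r ^ d * fact (d - 1)) * ((b * r) * ((b * r * y) ^ (d - 1) * exp (- (b * r * y))))"
          using r by (simp add: dd power_mult_distrib mult_ac)
        then show ?thesis using True br r
          by (simp add: ennreal_mult[symmetric] mult_nonneg_nonneg)
      next
        case False
        then have "y < 0" using elim by simp
        then have "b * r * y < 0" using br by (simp add: mult_pos_neg)
        then show ?thesis using False by simp
      qed
    qed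
  qed
  also have "\<dots> = ennreal (1 / (r ^ d * fact (d - 1))) * ennreal (fact (d - 1))"
    unfolding 1 by (intro nn_integral_cmult) measurable
  also have "\<dots> = ennreal (1 / r ^ d)"
    using r by (simp add: ennreal_mult[symmetric])
  finally show ?thesis .
qed

definition edge_mult :: "nat \<Rightarrow> (nat \<Rightarrow> nat) \<Rightarrow> nat \<times> nat \<Rightarrow> nat" where
  "edge_mult k c e = card {t \<in> {..<k}. word_edge k c t = e}"

definition visits :: "nat \<Rightarrow> (nat \<Rightarrow> nat) \<Rightarrow> nat \<Rightarrow> nat" where
  "visits k c i = card {t \<in> {..<k}. c t = i}"

text \<open>The coefficient of the weight of e in the sum of y i times the row sum of i over i in V.
  The intersection with a set counts a loop once, as the row sum does, and ignores ends outside
  V.\<close>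

definition edge_sum :: "nat set \<Rightarrow> nat \<times> nat \<Rightarrow> (nat \<Rightarrow> real) \<Rightarrow> real" where
  "edge_sum V e y = (\<Sum>i\<in>V \<inter> {fst e, snd e}. y i)"

lemma edge_mult_pos: "e \<in> word_edges k c \<Longrightarrow> 0 < edge_mult k c e"
  by (auto simp: edge_mult_def word_edges_def card_gt_0_iff)

lemma edge_mult_zero: "e \<notin> word_edges k c \<Longrightarrow> edge_mult k c e = 0"
  by (auto simp: edge_mult_def word_edges_def card_eq_0_iff)

lemma visits_pos: "i \<in> c ` {..<k} \<Longrightarrow> 0 < visits k c i"
  by (auto simp: visits_def card_gt_0_iff)

lemma finite_word_edges [simp]: "finite (word_edges k c)"
  by (simp add: word_edges_def)

lemma sum_edge_mult: "(\<Sum>e\<in>word_edges k c. edge_mult k c e) = k"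
  using sum.image_gen[of "{..<k}" "\<lambda>_. 1::nat" "word_edge k c"] by (simp add: word_edges_def edge_mult_def)

lemma sum_visits: "(\<Sum>i\<in>c ` {..<k}. visits k c i) = k"
  using sum.image_gen[of "{..<k}" "\<lambda>_. 1::nat" c] by (simp add: visits_def)

lemma prod_word_edges:
  fixes g :: "nat \<times> nat \<Rightarrow> 'c::comm_monoid_mult"
  shows "(\<Prod>t<k. g (word_edge k c t)) = (\<Prod>e\<in>word_edges k c. g e ^ edge_mult k c e)"
  unfolding word_edges_def edge_mult_def by (rule prod_over_fibres) simp

lemma prod_word_verts:
  fixes g :: "nat \<Rightarrow> 'c::comm_monoid_mult"
  shows "(\<Prod>t<k. g (c t)) = (\<Prod>i\<in>c ` {..<k}. g i ^ visits k c i)"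
  unfolding visits_def by (rule prod_over_fibres) simp

lemma word_edges_verts:
  "e \<in> word_edges k c \<Longrightarrow> fst e \<in> c ` {..<k} \<and> snd e \<in> c ` {..<k} \<and> fst e \<le> snd e"
  by (auto simp: word_edges_def word_edge_def sorted_pair_def min_def max_def next_step_lt)

lemma word_edges_upper:
  "c \<in> canonical_words k \<Longrightarrow> k \<le> n \<Longrightarrow> word_edges k c \<subseteq> upper_pairs n"
  using word_edges_verts canonical_verts_subset[of c k] by (fastforce simp: upper_pairs_def)

lemma edge_sum_nonneg: "(\<And>i. i \<in> V \<Longrightarrow> 0 \<le> y i) \<Longrightarrow> 0 \<le> edge_sum V e y"
  unfolding edge_sum_def by (intro sum_nonneg) auto

lemma edge_sum_pos:
  assumes "e \<in> word_edges k c" "\<And>i. i \<in> c ` {..<k} \<Longrightarrow> 0 < y i"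
  shows "0 < edge_sum (c ` {..<k}) e y"
  unfolding edge_sum_def using word_edges_verts[OF assms(1)] assms(2) by (intro sum_pos) auto

text \<open>Double counting: the entries of row i correspond to the unordered pairs containing i.
  This exhibits the exponent of the Gamma integrals as a sum over independent weights.\<close>

lemma sum_table_weight:
  assumes V: "V \<subseteq> {..<n}"
  shows "(\<Sum>i\<in>V. y i * (\<Sum>j<n. table_weight x i j)) = (\<Sum>e\<in>upper_pairs n. edge_sum V e y * \<bar>x e\<bar>)"
proof -
  have fin: "finite V" using V finite_subset by blast
  have row: "(\<Sum>j<n. table_weight x i j) = (\<Sum>e\<in>{e \<in> upper_pairs n. i \<in> {fst e, snd e}}. \<bar>x e\<bar>)" if i: "i \<in> V" for i
  proof (rule sum.reindex_bij_witness[where i = "\<lambda>e. if fst e = i then snd e else fst e" and j = "sorted_pair i"])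
    fix j assume j: "j \<in> {..<n}"
    show "(if fst (sorted_pair i j) = i then snd (sorted_pair i j) else fst (sorted_pair i j)) = j"
      by (auto simp: sorted_pair_def min_def max_def)
    show "sorted_pair i j \<in> {e \<in> upper_pairs n. i \<in> {fst e, snd e}}"
      using i V j by (auto simp: sorted_pair_def upper_pairs_def min_def max_def)
    show "\<bar>x (sorted_pair i j)\<bar> = table_weight x i j" by (simp add: table_weight_def)
  next
    fix e assume e: "e \<in> {e \<in> upper_pairs n. i \<in> {fst e, snd e}}"
    then show "sorted_pair i (if fst e = i then snd e else fst e) = e"
      by (cases e) (auto simp: sorted_pair_def upper_pairs_def)
    show "(if fst e = i then snd e else fst e) \<in> {..<n}"
      using e by (auto simp: upper_pairs_def)
  qed
  have "(\<Sum>i\<in>V. y i * (\<Sum>j<n. table_weight x i j))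
      = (\<Sum>i\<in>V. \<Sum>e\<in>{e \<in> upper_pairs n. i \<in> {fst e, snd e}}. y i * \<bar>x e\<bar>)"
    by (simp only: row sum_distrib_left cong: sum.cong)
  also have "\<dots> = (\<Sum>i\<in>V. \<Sum>e\<in>upper_pairs n. if i \<in> {fst e, snd e} then y i * \<bar>x e\<bar> else 0)"
    by (intro sum.cong refl sum.inter_filter) simp
  also have "\<dots> = (\<Sum>e\<in>upper_pairs n. \<Sum>i\<in>V. if i \<in> {fst e, snd e} then y i * \<bar>x e\<bar> else 0)"
    by (rule sum.swap)
  also have "\<dots> = (\<Sum>e\<in>upper_pairs n. \<Sum>i\<in>V \<inter> {fst e, snd e}. y i * \<bar>x e\<bar>)"
    by (intro sum.cong refl sum.inter_restrict[symmetric] fin)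
  also have "\<dots> = (\<Sum>e\<in>upper_pairs n. edge_sum V e y * \<bar>x e\<bar>)"
    by (simp only: edge_sum_def sum_distrib_right)
  finally show ?thesis .
qed

context heavy_tail
begin

definition "path_mean n k w =
  (\<integral>x. (\<Prod>t<k. damped_kernel n (table_weight x) (w t) (w (next_step k t))) \<partial>PiM (upper_pairs n) (\<lambda>_. D))"

text \<open>The factor of one independent weight. A pair that the walk does not traverse contributes
  a Laplace transform, and there s = 0 is allowed, for pairs away from the walk.\<close>

lemma entry_integral:
  assumes b: "0 < b" and s: "0 \<le> s" "m \<noteq> 0 \<Longrightarrow> 0 < s"
  shows "(\<integral>\<^sup>+u. ennreal (\<bar>u\<bar> ^ m * exp (- (b * s * \<bar>u\<bar>))) \<partial>D)
    = ennreal (if m = 0 then 1 - exponent (b * s) else tail_moment m (b * s) / (b * s) ^ m)"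
proof (cases "m = 0")
  case True
  have bs: "0 \<le> b * s" using b s by simp
  have int: "integrable D (\<lambda>u. exp (- (b * s * \<bar>u\<bar>)))"
    using bs by (intro D.integrable_const_bound[of _ 1]) auto
  have "(\<integral>u. exp (- (b * s * \<bar>u\<bar>)) \<partial>D) = (\<integral>u. 1 - (1 - exp (- (b * s * \<bar>u\<bar>))) \<partial>D)" by simp
  also have "\<dots> = 1 - exponent (b * s)"
    unfolding exponent_eq using integrable_exponent[OF bs]
    using D.prob_space by (subst Bochner_Integration.integral_diff) auto
  finally show ?thesis using True int by (simp add: nn_integral_eq_integral)
next
  case False
  then have bs: "0 < b * s" using b s by simp
  have "(\<integral>\<^sup>+u. ennreal (\<bar>u\<bar> ^ m * exp (- (b * s * \<bar>u\<bar>))) \<partial>D) = (\<integral>\<^sup>+u. ennreal (tail_primitive m (b * s * \<bar>u\<bar>) / (b * s) ^ m) \<partial>D)"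
    using False bs b s by (intro nn_integral_cong) (simp add: tail_primitive_def power_mult_distrib)
  also have "\<dots> = ennreal (\<integral>u. tail_primitive m (b * s * \<bar>u\<bar>) / (b * s) ^ m \<partial>D)"
    using bs integrable_primitive[of "b * s" m]
    by (intro nn_integral_eq_integral) (auto intro!: divide_nonneg_nonneg tail_primitive_nonneg)
  finally show ?thesis using False by (simp add: tail_moment_def)
qed

text \<open>The integrand after averaging over the weights: Gamma densities at the vertices, moments
  for the traversed pairs, Laplace transforms for all other pairs. The powers of b from vertices and
  edges have already cancelled.\<close>

definition "word_density n b k c y =
  (\<Prod>i\<in>c ` {..<k}. indicator {0<..} (y i) * (y i ^ (visits k c i - 1) / fact (visits k c i - 1) * exp (- (real n * b * y i)))) *
  (\<Prod>e\<in>word_edges k c. tail_moment (edge_mult k c e) (b * edge_sum (c ` {..<k}) e y) / edge_sum (c ` {..<k}) e y ^ edge_mult k c e) *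
  (\<Prod>e\<in>upper_pairs n - word_edges k c. 1 - exponent (b * edge_sum (c ` {..<k}) e y))"


text \<open>Pointwise in the weights: each vertex contributes one Gamma integral, of order its
  number of visits. The exponential of all row sums is then regrouped into a product over
  pairs.\<close>

lemma word_product:
  assumes c: "c \<in> canonical_words k" and k: "0 < k" "k \<le> n" and b: "0 < b"
  shows "ennreal (\<Prod>t<k. damped_kernel n (table_weight x) (c t) (c (next_step k t)))
    = (\<integral>\<^sup>+y. ennreal ((\<Prod>i\<in>c ` {..<k}. indicator {0<..} (y i) *
          (b ^ visits k c i * y i ^ (visits k c i - 1) / fact (visits k c i - 1) * exp (- (real n * b * y i)))) *
        (\<Prod>e\<in>upper_pairs n. \<bar>x e\<bar> ^ edge_mult k c e * exp (- (b * edge_sum (c ` {..<k}) e y * \<bar>x e\<bar>))))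
      \<partial>PiM (c ` {..<k}) (\<lambda>_. lborel))"
proof -
  interpret product_sigma_finite "\<lambda>_::nat. lborel :: real measure" ..
  let ?V = "c ` {..<k}"
  let ?r = "\<lambda>i. real n + (\<Sum>j<n. table_weight x i j)"
  let ?d = "visits k c" and ?m = "edge_mult k c"
  have V: "?V \<subseteq> {..<n}" using canonical_verts_subset[OF c] k by auto
  have r: "0 < ?r i" for i using k by (intro add_pos_nonneg sum_nonneg) auto
  let ?g = "\<lambda>i y. indicator {0<..} y * (b ^ ?d i * y ^ (?d i - 1) / fact (?d i - 1) * exp (- (b * y * ?r i)))"
  have g_nn: "0 \<le> ?g i y" for i y using b by (auto simp: indicator_def)
  let ?X = "\<Prod>e\<in>upper_pairs n. \<bar>x e\<bar> ^ ?m e"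
  have "(\<Prod>t<k. damped_kernel n (table_weight x) (c t) (c (next_step k t)))
      = (\<Prod>t<k. \<bar>x (word_edge k c t)\<bar>) * (\<Prod>t<k. 1 / ?r (c t))"
    unfolding prod.distrib[symmetric] by (simp add: damped_kernel_def table_weight_def word_edge_def)
  also have "(\<Prod>t<k. \<bar>x (word_edge k c t)\<bar>) = (\<Prod>e\<in>word_edges k c. \<bar>x e\<bar> ^ ?m e)"
    by (rule prod_word_edges)
  also have "\<dots> = ?X"
    using word_edges_upper[OF c k(2)]
    by (intro prod.mono_neutral_left) (auto simp: edge_mult_zero)
  also have "(\<Prod>t<k. 1 / ?r (c t)) = (\<Prod>i\<in>?V. (1 / ?r i) ^ ?d i)"
    by (rule prod_word_verts)
  finally have "ennreal (\<Prod>t<k. damped_kernel n (table_weight x) (c t) (c (next_step k t)))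
      = ennreal ?X * ennreal (\<Prod>i\<in>?V. (1 / ?r i) ^ ?d i)"
    by (simp add: ennreal_mult' prod_nonneg)
  also have "ennreal (\<Prod>i\<in>?V. (1 / ?r i) ^ ?d i) = (\<Prod>i\<in>?V. ennreal (1 / ?r i ^ ?d i))"
    using r by (subst prod_ennreal[symmetric]) (auto simp: power_one_over intro: less_imp_le)
  also have "\<dots> = (\<Prod>i\<in>?V. \<integral>\<^sup>+y. ennreal (?g i y) \<partial>lborel)"
    using r b visits_pos by (intro prod.cong refl inverse_power_gamma[symmetric]) auto
  also have "\<dots> = (\<integral>\<^sup>+y. (\<Prod>i\<in>?V. ennreal (?g i (y i))) \<partial>PiM ?V (\<lambda>_. lborel))"
    by (intro product_nn_integral_prod[symmetric]) auto
  also have "ennreal ?X * \<dots> = (\<integral>\<^sup>+y. ennreal ?X * (\<Prod>i\<in>?V. ennreal (?g i (y i))) \<partial>PiM ?V (\<lambda>_. lborel))"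
    by (intro nn_integral_cmult[symmetric]) measurable
  also have "\<dots> = (\<integral>\<^sup>+y. ennreal ((\<Prod>i\<in>?V. indicator {0<..} (y i) *
          (b ^ ?d i * y i ^ (?d i - 1) / fact (?d i - 1) * exp (- (real n * b * y i)))) *
        (\<Prod>e\<in>upper_pairs n. \<bar>x e\<bar> ^ ?m e * exp (- (b * edge_sum ?V e y * \<bar>x e\<bar>))))
      \<partial>PiM ?V (\<lambda>_. lborel))"
  proof (intro nn_integral_cong)
    fix y :: "nat \<Rightarrow> real"
    let ?h = "\<lambda>i. indicator {0<..} (y i) * (b ^ ?d i * y i ^ (?d i - 1) / fact (?d i - 1) * exp (- (real n * b * y i)))"
    have split: "?g i (y i) = ?h i * exp (- (b * (y i * (\<Sum>j<n. table_weight x i j))))" for i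
    proof -
      have "- (b * y i * ?r i) = - (real n * b * y i) + - (b * (y i * (\<Sum>j<n. table_weight x i j)))"
        by (simp add: algebra_simps)
      then have "exp (- (b * y i * ?r i)) = exp (- (real n * b * y i)) * exp (- (b * (y i * (\<Sum>j<n. table_weight x i j))))"
        by (simp only: exp_add)
      then show ?thesis by (simp only: mult.assoc times_divide_eq_left)
    qed
    have "(\<Prod>i\<in>?V. exp (- (b * (y i * (\<Sum>j<n. table_weight x i j))))) = exp (- (b * (\<Sum>i\<in>?V. y i * (\<Sum>j<n. table_weight x i j))))"
      by (simp add: exp_sum[symmetric] sum_distrib_left sum_negf)
    also have "\<dots> = exp (\<Sum>e\<in>upper_pairs n. - (b * edge_sum ?V e y * \<bar>x e\<bar>))"
      unfolding sum_table_weight[OF V] by (simp add: sum_distrib_left sum_negf mult.assoc)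
    also have "\<dots> = (\<Prod>e\<in>upper_pairs n. exp (- (b * edge_sum ?V e y * \<bar>x e\<bar>)))"
      by (rule exp_sum) simp
    finally have e: "(\<Prod>i\<in>?V. exp (- (b * (y i * (\<Sum>j<n. table_weight x i j)))))
       = (\<Prod>e\<in>upper_pairs n. exp (- (b * edge_sum ?V e y * \<bar>x e\<bar>)))" .
    have "ennreal ?X * (\<Prod>i\<in>?V. ennreal (?g i (y i))) = ennreal (?X * (\<Prod>i\<in>?V. ?g i (y i)))"
      using g_nn by (simp add: prod_ennreal ennreal_mult prod_nonneg)
    also have "(\<Prod>i\<in>?V. ?g i (y i)) = (\<Prod>i\<in>?V. ?h i * exp (- (b * (y i * (\<Sum>j<n. table_weight x i j)))))"
      by (intro prod.cong refl split)
    also have "\<dots> = (\<Prod>i\<in>?V. ?h i) * (\<Prod>e\<in>upper_pairs n. exp (- (b * edge_sum ?V e y * \<bar>x e\<bar>)))"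
      unfolding e[symmetric] by (rule prod.distrib)
    also have "?X * \<dots> = (\<Prod>i\<in>?V. ?h i) * (\<Prod>e\<in>upper_pairs n. \<bar>x e\<bar> ^ ?m e * exp (- (b * edge_sum ?V e y * \<bar>x e\<bar>)))"
      by (subst prod.distrib[of "\<lambda>e. \<bar>x e\<bar> ^ ?m e"]) (rule mult.left_commute)
    finally show "ennreal ?X * (\<Prod>i\<in>?V. ennreal (?g i (y i))) = ennreal ((\<Prod>i\<in>?V. ?h i) * (\<Prod>e\<in>upper_pairs n. \<bar>x e\<bar> ^ ?m e * exp (- (b * edge_sum ?V e y * \<bar>x e\<bar>))))" .
  qed
  finally show ?thesis .
qed

lemma damped_word_measurable [measurable]:
  assumes "\<And>t. t < k \<Longrightarrow> w t < n"
  shows "(\<lambda>x. \<Prod>t<k. damped_kernel n (table_weight x) (w t) (w (next_step k t))) \<in> borel_measurable (PiM (upper_pairs n) (\<lambda>_. D))"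
  unfolding damped_kernel_def
  by (intro borel_measurable_prod borel_measurable_divide borel_measurable_add borel_measurable_sum table_weight_measurable)
    (use assms next_step_lt in auto)

lemma damped_word_bounds:
  assumes "\<And>t. t < k \<Longrightarrow> w t < n"
  shows "0 \<le> (\<Prod>t<k. damped_kernel n (table_weight x) (w t) (w (next_step k t)))"
    and "(\<Prod>t<k. damped_kernel n (table_weight x) (w t) (w (next_step k t))) \<le> 1"
proof -
  have S: "substochastic n (damped_kernel n (table_weight x))" by (rule substochastic_damped) simp
  have *: "0 \<le> damped_kernel n (table_weight x) (w t) (w (next_step k t))"
    "damped_kernel n (table_weight x) (w t) (w (next_step k t)) \<le> 1" if "t < k" for t
    using S substochastic_le_1[OF S] assms that next_step_lt by (auto simp: substochastic_def)
  show "0 \<le> (\<Prod>t<k. damped_kernel n (table_weight x) (w t) (w (next_step k t)))"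
    using * by (intro prod_nonneg) auto
  show "(\<Prod>t<k. damped_kernel n (table_weight x) (w t) (w (next_step k t))) \<le> 1"
    using * by (intro prod_le_1) auto
qed

text \<open>Tonelli exchanges the Gamma variables with the weights; for fixed y the integrand is a
  product over independent weights and factorises.\<close>

lemma path_mean_formula:
  assumes c: "c \<in> canonical_words k" and k: "0 < k" "k \<le> n" and b: "0 < b"
  shows "ennreal (path_mean n k c) = (\<integral>\<^sup>+y. ennreal (word_density n b k c y) \<partial>PiM (c ` {..<k}) (\<lambda>_. lborel))"
proof -
  let ?V = "c ` {..<k}"
  let ?d = "visits k c" and ?m = "edge_mult k c"
  let ?Q = "PiM (upper_pairs n) (\<lambda>_. D)" and ?L = "PiM ?V (\<lambda>_. lborel :: real measure)"
  interpret Q: prob_space ?Q by (intro prob_space_PiM D.prob_space_axioms)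
  interpret PD: product_sigma_finite "\<lambda>_::nat \<times> nat. D" ..
  interpret PL: product_sigma_finite "\<lambda>_::nat. lborel :: real measure" ..
  interpret L: sigma_finite_measure ?L by (intro PL.sigma_finite) simp
  interpret QL: pair_sigma_finite ?Q ?L ..
  have cn: "c t < n" if "t < k" for t using canonical_words_lt[OF c that] k by simp
  let ?A = "\<lambda>y. \<Prod>i\<in>?V. indicator {0<..} (y i) * (b ^ ?d i * y i ^ (?d i - 1) / fact (?d i - 1) * exp (- (real n * b * y i)))"
  let ?B = "\<lambda>x y. \<Prod>e\<in>upper_pairs n. \<bar>x e\<bar> ^ ?m e * exp (- (b * edge_sum ?V e y * \<bar>x e\<bar>))"
  define A where "A = ?A"
  define B where "B = ?B"
  have A_nn: "0 \<le> A y" for y unfolding A_def using b by (intro prod_nonneg) (auto simp: indicator_def)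
  have B_nn: "0 \<le> B x y" for x y unfolding B_def by (intro prod_nonneg) auto
  have [measurable]: "(\<lambda>y. y i) \<in> borel_measurable ?L" if "i \<in> ?V" for i
  proof -
    have "(\<lambda>y. y i) \<in> measurable ?L lborel" using that by (rule measurable_component_singleton)
    then show ?thesis by simp
  qed
  have [measurable]: "(\<lambda>x. x e) \<in> borel_measurable ?Q" if "e \<in> upper_pairs n" for e
  proof -
    have "(\<lambda>x. x e) \<in> measurable ?Q D" using that by measurable
    then show ?thesis by (simp cong: measurable_cong_sets)
  qed
  have [measurable]: "edge_sum ?V e \<in> borel_measurable ?L" for e
    unfolding edge_sum_def by measurable
  have A_meas [measurable]: "A \<in> borel_measurable ?L" unfolding A_def by measurable
  have B_meas: "(\<lambda>(x, y). B x y) \<in> borel_measurable (?Q \<Otimes>\<^sub>M ?L)"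
  proof -
    have "(\<lambda>p. \<Prod>e\<in>upper_pairs n. \<bar>fst p e\<bar> ^ ?m e * exp (- (b * edge_sum ?V e (snd p) * \<bar>fst p e\<bar>)))
      \<in> borel_measurable (?Q \<Otimes>\<^sub>M ?L)"
    proof (intro borel_measurable_prod)
      fix e assume e: "e \<in> upper_pairs n"
      have [measurable]: "(\<lambda>p. fst p e) \<in> borel_measurable (?Q \<Otimes>\<^sub>M ?L)"
        using e by measurable
      show "(\<lambda>p. \<bar>fst p e\<bar> ^ ?m e * exp (- (b * edge_sum ?V e (snd p) * \<bar>fst p e\<bar>))) \<in> borel_measurable (?Q \<Otimes>\<^sub>M ?L)"
        by measurable
    qed
    then show ?thesis by (simp add: case_prod_beta' B_def)
  qed
  have "ennreal (path_mean n k c) = (\<integral>\<^sup>+x. ennreal (\<Prod>t<k. damped_kernel n (table_weight x) (c t) (c (next_step k t))) \<partial>?Q)"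
    unfolding path_mean_def using cn
    by (intro nn_integral_eq_integral[symmetric] Q.bounded_integrable[where B = 1])
      (auto simp: damped_word_bounds abs_of_nonneg)
  also have "\<dots> = (\<integral>\<^sup>+x. \<integral>\<^sup>+y. ennreal (A y * B x y) \<partial>?L \<partial>?Q)"
    unfolding A_def B_def by (simp only: word_product[OF c k b])
  also have "\<dots> = (\<integral>\<^sup>+y. \<integral>\<^sup>+x. ennreal (A y * B x y) \<partial>?Q \<partial>?L)"
  proof (rule QL.Fubini'[symmetric])
    have "(\<lambda>p. ennreal (A (snd p) * (\<lambda>(x, y). B x y) p)) \<in> borel_measurable (?Q \<Otimes>\<^sub>M ?L)"
      using B_meas by measurable
    then show "(\<lambda>(x, y). ennreal (A y * B x y)) \<in> borel_measurable (?Q \<Otimes>\<^sub>M ?L)"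
      by (simp add: case_prod_beta')
  qed
  also have "\<dots> = (\<integral>\<^sup>+y. ennreal (word_density n b k c y) \<partial>?L)"
  proof (rule nn_integral_cong)
    fix y :: "nat \<Rightarrow> real"
    show "(\<integral>\<^sup>+x. ennreal (A y * B x y) \<partial>?Q) = ennreal (word_density n b k c y)"
    proof (cases "\<forall>i\<in>?V. 0 < y i")
      case False
      then obtain i where i: "i \<in> ?V" "\<not> 0 < y i" by blast
      have z: "\<exists>i\<in>?V. indicator {0<..} (y i) * g i = (0::real)" for g
        using i by (intro bexI[of _ i]) auto
      have "A y = 0" unfolding A_def by (rule prod_zero[OF _ z]) simp
      moreover have "word_density n b k c y = 0"
        unfolding word_density_def by (subst prod_zero[OF _ z]) simp_all
      ultimately show ?thesis by simp
    next
      case True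
      let ?s = "\<lambda>e. edge_sum ?V e y"
      let ?w = "\<lambda>e. if ?m e = 0 then 1 - exponent (b * ?s e) else tail_moment (?m e) (b * ?s e) / (b * ?s e) ^ ?m e"
      have s0: "0 \<le> ?s e" for e using True by (intro edge_sum_nonneg) (auto intro: less_imp_le)
      have w_nn: "0 \<le> ?w e" for e
        using b s0[of e] exponent_le_1[of "b * ?s e"] by (auto intro!: divide_nonneg_nonneg tail_moment_nonneg)
      have Bp: "ennreal (B x y) = (\<Prod>e\<in>upper_pairs n. ennreal (\<bar>x e\<bar> ^ ?m e * exp (- (b * ?s e * \<bar>x e\<bar>))))" for x
        unfolding B_def by (intro prod_ennreal[symmetric]) auto
      have "(\<integral>\<^sup>+x. ennreal (A y * B x y) \<partial>?Q)
          = (\<integral>\<^sup>+x. ennreal (A y) * (\<Prod>e\<in>upper_pairs n. ennreal (\<bar>x e\<bar> ^ ?m e * exp (- (b * ?s e * \<bar>x e\<bar>)))) \<partial>?Q)"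
        by (simp only: ennreal_mult[OF A_nn B_nn] Bp)
      also have "\<dots> = ennreal (A y) * (\<integral>\<^sup>+x. (\<Prod>e\<in>upper_pairs n. ennreal (\<bar>x e\<bar> ^ ?m e * exp (- (b * ?s e * \<bar>x e\<bar>)))) \<partial>?Q)"
        by (intro nn_integral_cmult) measurable
      also have "(\<integral>\<^sup>+x. (\<Prod>e\<in>upper_pairs n. ennreal (\<bar>x e\<bar> ^ ?m e * exp (- (b * ?s e * \<bar>x e\<bar>)))) \<partial>?Q)
          = (\<Prod>e\<in>upper_pairs n. \<integral>\<^sup>+u. ennreal (\<bar>u\<bar> ^ ?m e * exp (- (b * ?s e * \<bar>u\<bar>))) \<partial>D)"
        by (intro PD.product_nn_integral_prod) auto
      also have "\<dots> = (\<Prod>e\<in>upper_pairs n. ennreal (?w e))"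
      proof (intro prod.cong refl entry_integral b s0)
        fix e assume "?m e \<noteq> 0"
        then have "e \<in> word_edges k c" by (rule contrapos_np) (rule edge_mult_zero)
        then show "0 < ?s e" using True by (intro edge_sum_pos) auto
      qed
      also have "(\<Prod>e\<in>upper_pairs n. ennreal (?w e)) = ennreal (\<Prod>e\<in>upper_pairs n. ?w e)"
        by (intro prod_ennreal w_nn)
      also have "ennreal (A y) * \<dots> = ennreal (A y * (\<Prod>e\<in>upper_pairs n. ?w e))"
        by (intro ennreal_mult[symmetric] A_nn prod_nonneg w_nn)
      also have "A y * (\<Prod>e\<in>upper_pairs n. ?w e) = word_density n b k c y"
      proof -
        have sub: "word_edges k c \<subseteq> upper_pairs n" by (rule word_edges_upper[OF c k(2)])
        have 1: "(\<Prod>e\<in>upper_pairs n. ?w e) = (\<Prod>e\<in>upper_pairs n - word_edges k c. ?w e) * (\<Prod>e\<in>word_edges k c. ?w e)"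
          by (rule prod.subset_diff[OF sub]) simp
        have 2: "(\<Prod>e\<in>upper_pairs n - word_edges k c. ?w e) = (\<Prod>e\<in>upper_pairs n - word_edges k c. 1 - exponent (b * ?s e))"
          by (intro prod.cong refl) (auto simp: edge_mult_zero)
        have "(\<Prod>e\<in>word_edges k c. ?w e) = (\<Prod>e\<in>word_edges k c. (1 / b) ^ ?m e * (tail_moment (?m e) (b * ?s e) / ?s e ^ ?m e))"
        proof (intro prod.cong refl)
          fix e assume "e \<in> word_edges k c"
          then have "?m e \<noteq> 0" using edge_mult_pos[of e k c] by simp
          then show "?w e = (1 / b) ^ ?m e * (tail_moment (?m e) (b * ?s e) / ?s e ^ ?m e)"
            by (simp add: power_mult_distrib power_one_over)
        qed
        also have "\<dots> = (\<Prod>e\<in>word_edges k c. (1 / b) ^ ?m e) * (\<Prod>e\<in>word_edges k c. tail_moment (?m e) (b * ?s e) / ?s e ^ ?m e)"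
          by (rule prod.distrib)
        also have "(\<Prod>e\<in>word_edges k c. (1 / b) ^ ?m e) = (1 / b) ^ k"
          by (simp only: power_sum[symmetric] sum_edge_mult)
        finally have 3: "(\<Prod>e\<in>word_edges k c. ?w e) = (1 / b) ^ k * (\<Prod>e\<in>word_edges k c. tail_moment (?m e) (b * ?s e) / ?s e ^ ?m e)" .
        have "A y = (\<Prod>i\<in>?V. b ^ ?d i * (indicator {0<..} (y i) * (y i ^ (?d i - 1) / fact (?d i - 1) * exp (- (real n * b * y i)))))"
          unfolding A_def by (intro prod.cong refl) simp
        also have "\<dots> = (\<Prod>i\<in>?V. b ^ ?d i) * (\<Prod>i\<in>?V. indicator {0<..} (y i) * (y i ^ (?d i - 1) / fact (?d i - 1) * exp (- (real n * b * y i))))"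
          by (rule prod.distrib)
        also have "(\<Prod>i\<in>?V. b ^ ?d i) = b ^ k" by (simp only: power_sum[symmetric] sum_visits)
        finally have 4: "A y = b ^ k * (\<Prod>i\<in>?V. indicator {0<..} (y i) * (y i ^ (?d i - 1) / fact (?d i - 1) * exp (- (real n * b * y i))))" .
        have rearrange: "a * p * (s * (a' * q)) = p * q * s" if "a * a' = 1" for a a' p q s :: real
        proof -
          have "a * p * (s * (a' * q)) = (a * a') * (p * q * s)" by (simp only: mult_ac)
          then show ?thesis using that by simp
        qed
        \<comment> \<open>The vertices supply b^k and the edges (1/b)^k, since visits and
          multiplicities both sum to k.\<close>
        have "b ^ k * (1 / b) ^ k = 1" using b by (simp add: power_mult_distrib[symmetric])
        then show ?thesis
          unfolding 1 2 3 4 word_density_def by (rule rearrange)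
      qed
      finally show ?thesis .
    qed
  qed
  finally show ?thesis .
qed

end

section \<open>The limit of the mean moments\<close>

lemma one_plus_sum_le_prod:
  fixes y :: "'i \<Rightarrow> real"
  assumes "finite V" "\<And>i. i \<in> V \<Longrightarrow> 0 \<le> y i"
  shows "1 + (\<Sum>i\<in>V. y i) \<le> (\<Prod>i\<in>V. 1 + y i)"
  using assms
proof (induction V)
  case (insert a V)
  have s: "0 \<le> (\<Sum>i\<in>V. y i)" using insert.prems by (intro sum_nonneg) auto
  have "1 + (y a + (\<Sum>i\<in>V. y i)) \<le> (1 + y a) * (1 + (\<Sum>i\<in>V. y i))"
    using insert.prems s by (simp add: algebra_simps)
  also have "\<dots> \<le> (1 + y a) * (\<Prod>i\<in>V. 1 + y i)"
    using insert by (intro mult_left_mono insert.IH) auto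
  finally show ?case using insert.hyps by simp
qed simp

definition inner_pairs :: "nat set \<Rightarrow> (nat \<times> nat) set" where
  "inner_pairs V = {(i, j). i \<in> V \<and> j \<in> V \<and> i \<le> j}"

lemma finite_inner_pairs: "finite V \<Longrightarrow> finite (inner_pairs V)"
  by (rule finite_subset[of _ "V \<times> V"]) (auto simp: inner_pairs_def)

text \<open>Pairs are sorted by the number of ends in V. Those with one end i in V depend on y i
  only, and there are n - \<open>card V\<close> of them; those with no end in V give F 0 =
  1.\<close>

lemma prod_outer_pairs:
  fixes F :: "real \<Rightarrow> real"
  assumes V: "V \<subseteq> {..<n}" and E: "E \<subseteq> inner_pairs V" and F0: "F 0 = 1"
  shows "(\<Prod>e\<in>upper_pairs n - E. F (edge_sum V e y))
    = (\<Prod>e\<in>inner_pairs V - E. F (edge_sum V e y)) * (\<Prod>i\<in>V. F (y i) ^ (n - card V))"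
proof -
  have fin: "finite V" using V finite_subset by blast
  let ?O = "(\<lambda>(i, j). sorted_pair i j) ` (V \<times> ({..<n} - V))"
  let ?F = "\<lambda>e. F (edge_sum V e y)"
  have sub: "inner_pairs V \<union> ?O \<subseteq> upper_pairs n"
    using V by (auto simp: inner_pairs_def upper_pairs_def sorted_pair_def min_def max_def)
  have disj: "inner_pairs V \<inter> ?O = {}"
    by (auto simp: inner_pairs_def sorted_pair_def min_def max_def split: if_splits)
  have "?F e = 1" if e: "e \<in> upper_pairs n - (inner_pairs V \<union> ?O)" for e
  proof -
    obtain i j where ij: "e = (i, j)" by (cases e)
    have lt: "i \<le> j" "j < n" using e ij by (auto simp: upper_pairs_def)
    have "i \<notin> V"
    proof
      assume i: "i \<in> V"
      then have "j \<in> V"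
      proof -
        have "(i, j) = sorted_pair i j" using lt by (simp add: sorted_pair_le)
        then have "j \<notin> {..<n} - V" using e i ij by (force intro: image_eqI[where x = "(i, j)"])
        then show ?thesis using lt by simp
      qed
      then show False using i e ij lt by (auto simp: inner_pairs_def)
    qed
    moreover have "j \<notin> V"
    proof
      assume j: "j \<in> V"
      have "e = sorted_pair j i" using ij lt by (auto simp: sorted_pair_def)
      then have "e \<in> ?O" using j lt \<open>i \<notin> V\<close> by (intro image_eqI[where x = "(j, i)"]) auto
      then show False using e by blast
    qed
    ultimately have "V \<inter> {fst e, snd e} = {}" using ij by auto
    then show ?thesis by (simp add: edge_sum_def F0)
  qed
  then have "(\<Prod>e\<in>upper_pairs n - E. ?F e) = (\<Prod>e\<in>(inner_pairs V - E) \<union> ?O. ?F e)"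
  proof (intro prod.mono_neutral_right)
    show "inner_pairs V - E \<union> ?O \<subseteq> upper_pairs n - E" using sub E disj by blast
    show "\<forall>e\<in>upper_pairs n - E - (inner_pairs V - E \<union> ?O). ?F e = 1"
      using \<open>\<And>e. e \<in> upper_pairs n - (inner_pairs V \<union> ?O) \<Longrightarrow> ?F e = 1\<close> by blast
  qed simp
  also have "\<dots> = (\<Prod>e\<in>inner_pairs V - E. ?F e) * (\<Prod>e\<in>?O. ?F e)"
    using disj fin by (intro prod.union_disjoint) (auto simp: finite_inner_pairs)
  also have "(\<Prod>e\<in>?O. ?F e) = (\<Prod>(i, j)\<in>V \<times> ({..<n} - V). F (y i))"
  proof (subst prod.reindex)
    show "inj_on (\<lambda>(i, j). sorted_pair i j) (V \<times> ({..<n} - V))"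
      by (auto simp: inj_on_def sorted_pair_eq_iff)
    show "prod (?F \<circ> (\<lambda>(i, j). sorted_pair i j)) (V \<times> ({..<n} - V)) = (\<Prod>(i, j)\<in>V \<times> ({..<n} - V). F (y i))"
    proof (intro prod.cong refl)
      fix p assume p: "p \<in> V \<times> ({..<n} - V)"
      obtain i j where ij: "p = (i, j)" by (cases p)
      have "V \<inter> {fst (sorted_pair i j), snd (sorted_pair i j)} = {i}"
        using p ij by (auto simp: sorted_pair_def min_def max_def)
      then show "(?F \<circ> (\<lambda>(i, j). sorted_pair i j)) p = (case p of (i, j) \<Rightarrow> F (y i))"
        by (simp add: ij edge_sum_def)
    qed
  qed
  also have "\<dots> = (\<Prod>i\<in>V. \<Prod>j\<in>{..<n} - V. F (y i))"
    by (rule prod.cartesian_product[symmetric])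
  also have "\<dots> = (\<Prod>i\<in>V. F (y i) ^ (n - card V))"
    using V fin by (simp add: card_Diff_subset)
  finally show ?thesis .
qed

lemma word_edges_inner: "word_edges k c \<subseteq> inner_pairs (c ` {..<k})"
  using word_edges_verts[of _ k c] by (fastforce simp: inner_pairs_def)

text \<open>The product of y along the walk is unchanged by the cyclic shift. Multiplying both
  versions pairs the ends of every step; the square root restores the product.\<close>

lemma prod_verts_sqrt_edges:
  assumes pos: "\<And>i. i \<in> c ` {..<k} \<Longrightarrow> 0 < y i"
  shows "(\<Prod>i\<in>c ` {..<k}. y i ^ visits k c i)
    = (\<Prod>e\<in>word_edges k c. sqrt (y (fst e) * y (snd e)) ^ edge_mult k c e)"
proof -
  have p: "0 < y (c t)" if "t < k" for t using that by (intro pos) auto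
  have sqrt_prod: "sqrt (\<Prod>t<j. g t) = (\<Prod>t<j. sqrt (g t))" for g :: "nat \<Rightarrow> real" and j
    by (induction j) (simp_all add: real_sqrt_mult)
  have "(\<Prod>t<k. y (c t)) = sqrt ((\<Prod>t<k. y (c t)) * (\<Prod>t<k. y (c t)))"
  proof -
    have "0 \<le> (\<Prod>t<k. y (c t))" using p by (intro prod_nonneg) (auto intro: less_imp_le)
    then show ?thesis by simp
  qed
  also have "(\<Prod>t<k. y (c t)) * (\<Prod>t<k. y (c t)) = (\<Prod>t<k. y (c t)) * (\<Prod>t<k. y (c (next_step k t)))"
    using prod.reindex_bij_betw[OF bij_next_step, of "\<lambda>t. y (c t)" k] by simp
  also have "\<dots> = (\<Prod>t<k. y (fst (word_edge k c t)) * y (snd (word_edge k c t)))"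
    unfolding prod.distrib[symmetric]
    by (intro prod.cong refl) (auto simp: word_edge_def sorted_pair_def min_def max_def)
  also have "sqrt \<dots> = (\<Prod>t<k. sqrt (y (fst (word_edge k c t)) * y (snd (word_edge k c t))))"
    by (rule sqrt_prod)
  also have "\<dots> = (\<Prod>e\<in>word_edges k c. sqrt (y (fst e) * y (snd e)) ^ edge_mult k c e)"
    by (rule prod_word_edges)
  finally show ?thesis unfolding prod_word_verts[of "y"] .
qed

text \<open>A vertex receives y^(\<epsilon>/2) once for every edge end at it. It has at least one
  such end, so one factor is kept to tame the singularity at 0; the others are bounded by 1 +
  y.\<close>

lemma prod_edges_powr_le:
  assumes pos: "\<And>i. i \<in> c ` {..<k} \<Longrightarrow> 0 < y i" and \<epsilon>: "0 < \<epsilon>" "\<epsilon> \<le> 1"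
  shows "(\<Prod>e\<in>word_edges k c. sqrt (y (fst e) * y (snd e)) powr \<epsilon>)
    \<le> (\<Prod>i\<in>c ` {..<k}. y i powr (\<epsilon> / 2) * (1 + y i) ^ (2 * card (word_edges k c)))"
proof -
  let ?V = "c ` {..<k}" and ?E = "word_edges k c"
  \<comment> \<open>Edge ends, the boolean selecting which end; a loop has two.\<close>
  let ?T = "?E \<times> (UNIV :: bool set)"
  let ?h = "\<lambda>p. if snd p then fst (fst p) else snd (fst p)"
  let ?a = "\<lambda>i. y i powr (\<epsilon> / 2)"
  have im: "?h ` ?T = ?V"
  proof (intro equalityI subsetI)
    fix i assume "i \<in> ?h ` ?T"
    then show "i \<in> ?V" using word_edges_verts[of _ k c] by (auto split: if_splits)
  next
    fix i assume "i \<in> ?V"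
    then obtain t where t: "t < k" "i = c t" by auto
    then have "word_edge k c t \<in> ?E" by (auto simp: word_edges_def)
    moreover have "i = fst (word_edge k c t) \<or> i = snd (word_edge k c t)"
      using t by (auto simp: word_edge_def sorted_pair_def min_def max_def)
    ultimately show "i \<in> ?h ` ?T"
      by (auto intro!: rev_image_eqI[of "(word_edge k c t, i = fst (word_edge k c t))"])
  qed
  have "(\<Prod>e\<in>?E. sqrt (y (fst e) * y (snd e)) powr \<epsilon>) = (\<Prod>e\<in>?E. \<Prod>b\<in>UNIV. ?a (?h (e, b)))"
  proof (intro prod.cong refl)
    fix e assume "e \<in> ?E"
    then have "0 < y (fst e)" "0 < y (snd e)" using word_edges_verts[of e k c] pos by auto
    then show "sqrt (y (fst e) * y (snd e)) powr \<epsilon> = (\<Prod>b\<in>UNIV. ?a (?h (e, b)))"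
      by (simp add: UNIV_bool powr_mult real_sqrt_mult powr_half_sqrt[symmetric] powr_powr mult.commute)
  qed
  also have "\<dots> = (\<Prod>p\<in>?T. ?a (?h p))"
    by (subst prod.cartesian_product) (intro prod.cong refl, simp add: case_prod_beta)
  also have "\<dots> = (\<Prod>i\<in>?V. ?a i ^ card {p \<in> ?T. ?h p = i})"
    unfolding im[symmetric] by (rule prod_over_fibres) simp
  also have "\<dots> \<le> (\<Prod>i\<in>?V. ?a i * (1 + y i) ^ (2 * card ?E))"
  proof (intro prod_mono conjI)
    fix i assume i: "i \<in> ?V"
    let ?c = "card {p \<in> ?T. ?h p = i}"
    have y: "0 < y i" by (rule pos[OF i])
    have "{p \<in> ?T. ?h p = i} \<noteq> {}" using i unfolding im[symmetric] by blast
    then have c1: "0 < ?c" by (simp add: card_gt_0_iff)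
    have "?c \<le> card ?T" by (intro card_mono) auto
    then have c2: "?c \<le> 2 * card ?E" by (simp add: card_cartesian_product)
    have a: "?a i \<le> 1 + y i"
    proof -
      have "?a i \<le> (1 + y i) powr (\<epsilon> / 2)" using y \<epsilon> by (intro powr_mono2) auto
      also have "\<dots> \<le> (1 + y i) powr 1" using y \<epsilon> by (intro powr_mono) auto
      finally show ?thesis using y by simp
    qed
    have "?a i ^ ?c = ?a i * ?a i ^ (?c - 1)" using c1 by (cases ?c) auto
    also have "\<dots> \<le> ?a i * (1 + y i) ^ (?c - 1)" using a by (intro mult_left_mono power_mono) auto
    also have "\<dots> \<le> ?a i * (1 + y i) ^ (2 * card ?E)"
      using c2 y by (intro mult_left_mono power_increasing) auto
    finally show "?a i ^ ?c \<le> ?a i * (1 + y i) ^ (2 * card ?E)" .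
  qed auto
  finally show ?thesis .
qed

context heavy_tail
begin

text \<open>The pointwise limit of \<open>scaled_density\<close>. Like \<open>tail_const\<close> it
  refers to \<alpha> but not to the law.\<close>

definition "limit_density k c y =
  (\<Prod>i\<in>c ` {..<k}. indicator {0<..} (y i) * (y i ^ (visits k c i - 1) / fact (visits k c i - 1) * exp (- (y i powr \<alpha>)))) *
  (\<Prod>e\<in>word_edges k c. tail_const (edge_mult k c e) / tail_const 0 * edge_sum (c ` {..<k}) e y powr \<alpha>
     / edge_sum (c ` {..<k}) e y ^ edge_mult k c e)"

text \<open>One factor n per edge is what keeps the moment of that edge, of order 1 / n, from
  vanishing.\<close>

definition "scaled_density n k c y = real n ^ card (word_edges k c) * word_density n (norming n) k c y"

lemma scaled_density_eq:
  assumes c: "c \<in> canonical_words k" and k: "k \<le> n"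
  shows "scaled_density n k c y =
    (\<Prod>i\<in>c ` {..<k}. indicator {0<..} (y i) * (y i ^ (visits k c i - 1) / fact (visits k c i - 1) *
       (exp (- (real n * norming n * y i)) * (1 - exponent (norming n * y i)) ^ (n - card (c ` {..<k}))))) *
    (\<Prod>e\<in>word_edges k c. real n * tail_moment (edge_mult k c e) (norming n * edge_sum (c ` {..<k}) e y)
       / edge_sum (c ` {..<k}) e y ^ edge_mult k c e) *
    (\<Prod>e\<in>inner_pairs (c ` {..<k}) - word_edges k c. 1 - exponent (norming n * edge_sum (c ` {..<k}) e y))"
proof -
  let ?V = "c ` {..<k}" and ?E = "word_edges k c" and ?b = "norming n"
  have V: "?V \<subseteq> {..<n}" using canonical_verts_subset[OF c] k by auto
  have 1: "(\<Prod>e\<in>upper_pairs n - ?E. 1 - exponent (?b * edge_sum ?V e y))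
    = (\<Prod>e\<in>inner_pairs ?V - ?E. 1 - exponent (?b * edge_sum ?V e y)) * (\<Prod>i\<in>?V. (1 - exponent (?b * y i)) ^ (n - card ?V))"
    using prod_outer_pairs[OF V word_edges_inner, of "\<lambda>s. 1 - exponent (?b * s)" y] by (simp add: exponent_eq)
  let ?A = "\<lambda>i. indicator {0<..} (y i) * (y i ^ (visits k c i - 1) / fact (visits k c i - 1) * exp (- (real n * ?b * y i)))"
  let ?P = "\<lambda>i. (1 - exponent (?b * y i)) ^ (n - card ?V)"
  let ?M = "\<lambda>e. tail_moment (edge_mult k c e) (?b * edge_sum ?V e y) / edge_sum ?V e y ^ edge_mult k c e"
  have 2: "(\<Prod>i\<in>?V. ?A i) * (\<Prod>i\<in>?V. ?P i) = (\<Prod>i\<in>?V. indicator {0<..} (y i) * (y i ^ (visits k c i - 1) / fact (visits k c i - 1) *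
       (exp (- (real n * ?b * y i)) * ?P i)))"
    unfolding prod.distrib[symmetric] by (intro prod.cong refl) simp
  have 3: "real n ^ card ?E * (\<Prod>e\<in>?E. ?M e) = (\<Prod>e\<in>?E. real n * tail_moment (edge_mult k c e) (?b * edge_sum ?V e y) / edge_sum ?V e y ^ edge_mult k c e)"
    unfolding prod_constant[symmetric] prod.distrib[symmetric] by (intro prod.cong refl) simp
  have "scaled_density n k c y = real n ^ card ?E * ((\<Prod>i\<in>?V. ?A i) * (\<Prod>e\<in>?E. ?M e) * ((\<Prod>e\<in>inner_pairs ?V - ?E. 1 - exponent (?b * edge_sum ?V e y)) * (\<Prod>i\<in>?V. ?P i)))"
    unfolding scaled_density_def word_density_def 1 ..
  also have "\<dots> = ((\<Prod>i\<in>?V. ?A i) * (\<Prod>i\<in>?V. ?P i)) * (real n ^ card ?E * (\<Prod>e\<in>?E. ?M e)) * (\<Prod>e\<in>inner_pairs ?V - ?E. 1 - exponent (?b * edge_sum ?V e y))"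
    by (simp only: mult_ac)
  finally show ?thesis unfolding 2 3 .
qed

lemma scaled_density_tendsto:
  assumes c: "c \<in> canonical_words k"
  shows "(\<lambda>n. scaled_density n k c y) \<longlonglongrightarrow> limit_density k c y"
proof (cases "\<forall>i\<in>c ` {..<k}. 0 < y i")
  case False
  then obtain i where i: "i \<in> c ` {..<k}" "\<not> 0 < y i" by blast
  have z: "\<exists>i\<in>c ` {..<k}. indicator {0<..} (y i) * g i = (0::real)" for g
    using i by (intro bexI[of _ i]) auto
  have "scaled_density n k c y = 0" for n
    unfolding scaled_density_def word_density_def by (subst prod_zero[OF _ z]) simp_all
  moreover have "limit_density k c y = 0"
    unfolding limit_density_def by (subst prod_zero[OF _ z]) simp_all
  ultimately show ?thesis by simp
next
  case True
  let ?V = "c ` {..<k}" and ?E = "word_edges k c"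
  let ?R = "\<lambda>n. (\<Prod>i\<in>?V. indicator {0<..} (y i) * (y i ^ (visits k c i - 1) / fact (visits k c i - 1) *
       (exp (- (real n * norming n * y i)) * (1 - exponent (norming n * y i)) ^ (n - card ?V)))) *
    (\<Prod>e\<in>?E. real n * tail_moment (edge_mult k c e) (norming n * edge_sum ?V e y) / edge_sum ?V e y ^ edge_mult k c e) *
    (\<Prod>e\<in>inner_pairs ?V - ?E. 1 - exponent (norming n * edge_sum ?V e y))"
  have pos: "0 < edge_sum ?V e y" if "e \<in> inner_pairs ?V" for e
    unfolding edge_sum_def using that True by (intro sum_pos) (auto simp: inner_pairs_def)
  \<comment> \<open>The last product runs over the pairs of visited vertices that are not traversed;
    their number does not grow with n and each factor tends to 1.\<close>
  have "?R \<longlonglongrightarrow> limit_density k c y * (\<Prod>e\<in>inner_pairs ?V - ?E. 1 - 0)"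
    unfolding limit_density_def
  proof (rule tendsto_mult[OF tendsto_mult])
    show "(\<lambda>n. \<Prod>i\<in>?V. indicator {0<..} (y i) * (y i ^ (visits k c i - 1) / fact (visits k c i - 1) *
       (exp (- (real n * norming n * y i)) * (1 - exponent (norming n * y i)) ^ (n - card ?V))))
      \<longlonglongrightarrow> (\<Prod>i\<in>?V. indicator {0<..} (y i) * (y i ^ (visits k c i - 1) / fact (visits k c i - 1) * exp (- (y i powr \<alpha>))))"
      using True by (intro tendsto_prod tendsto_mult_left vertex_factor_tendsto) auto
    show "(\<lambda>n. \<Prod>e\<in>?E. real n * tail_moment (edge_mult k c e) (norming n * edge_sum ?V e y) / edge_sum ?V e y ^ edge_mult k c e)
      \<longlonglongrightarrow> (\<Prod>e\<in>?E. tail_const (edge_mult k c e) / tail_const 0 * edge_sum ?V e y powr \<alpha> / edge_sum ?V e y ^ edge_mult k c e)"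
    proof (rule tendsto_prod)
      fix e assume "e \<in> ?E"
      then have e: "0 < edge_sum ?V e y" using word_edges_inner by (intro pos) auto
      show "(\<lambda>n. real n * tail_moment (edge_mult k c e) (norming n * edge_sum ?V e y) / edge_sum ?V e y ^ edge_mult k c e)
        \<longlonglongrightarrow> tail_const (edge_mult k c e) / tail_const 0 * edge_sum ?V e y powr \<alpha> / edge_sum ?V e y ^ edge_mult k c e"
        using e by (intro tendsto_divide tail_moment_scaled_tendsto tendsto_const) auto
    qed
    show "(\<lambda>n. \<Prod>e\<in>inner_pairs ?V - ?E. 1 - exponent (norming n * edge_sum ?V e y)) \<longlonglongrightarrow> (\<Prod>e\<in>inner_pairs ?V - ?E. 1 - 0)"
      by (intro tendsto_prod tendsto_diff tendsto_const exponent_norming_tendsto_0 pos) auto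
  qed
  moreover have "\<forall>\<^sub>F n in sequentially. ?R n = scaled_density n k c y"
    using eventually_ge_at_top[of k] by eventually_elim (simp only: scaled_density_eq[OF c])
  ultimately have "(\<lambda>n. scaled_density n k c y) \<longlonglongrightarrow> limit_density k c y * (\<Prod>e\<in>inner_pairs ?V - ?E. 1 - 0)"
    by (rule Lim_transform_eventually)
  then show ?thesis by simp
qed


lemma scaled_density_nonneg:
  assumes n: "0 < norming n"
  shows "0 \<le> scaled_density n k c y"
proof (cases "\<forall>i\<in>c ` {..<k}. 0 < y i")
  case False
  then obtain i where i: "i \<in> c ` {..<k}" "\<not> 0 < y i" by blast
  have z: "\<exists>i\<in>c ` {..<k}. indicator {0<..} (y i) * g i = (0::real)" for g
    using i by (intro bexI[of _ i]) auto
  show ?thesis unfolding scaled_density_def word_density_def by (subst prod_zero[OF _ z]) simp_all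
next
  case True
  have s: "0 \<le> norming n * edge_sum (c ` {..<k}) e y" for e
    using n True by (intro mult_nonneg_nonneg edge_sum_nonneg) (auto intro: less_imp_le)
  have t: "0 \<le> edge_sum (c ` {..<k}) e y" for e
    using True by (intro edge_sum_nonneg) (auto intro: less_imp_le)
  show ?thesis
    unfolding scaled_density_def word_density_def
    using True n
    by (intro mult_nonneg_nonneg[OF mult_nonneg_nonneg] mult_nonneg_nonneg[OF zero_le_power] prod_nonneg
        divide_nonneg_nonneg tail_moment_nonneg zero_le_power s t)
      (auto intro!: divide_nonneg_nonneg mult_nonneg_nonneg less_imp_le exponent_le_1[OF s] simp: indicator_def)
qed

text \<open>As the walk is closed, \<open>y i ^ visits\<close> over all vertices equals \<open>g e ^ mult\<close> over all edges, where
  \<open>g e\<close> is the geometric mean of the end variables. Since \<open>g e\<close> is at most the edge sum \<open>s e\<close>, one has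
  \<open>(g e / s e) ^ mult \<le> (g e / s e) powr (\<alpha>/2)\<close>, and the factor \<open>s e powr (\<alpha>/2)\<close> of the edge bound
  cancels. Every vertex lies on an edge and so keeps a positive power that compensates \<open>1 / y i\<close>.\<close>

lemma scaled_density_bound:
  assumes c: "c \<in> canonical_words k" and k: "k \<le> n" and pos: "\<And>i. i \<in> c ` {..<k} \<Longrightarrow> 0 < y i"
    and b: "0 < norming n"
    and C1: "0 < C1" "\<And>s. 0 < s \<Longrightarrow> real n * exponent (norming n * s) \<le> C1 * (s powr (\<alpha> / 2) * (1 + s))"
    and C2: "0 < C2" "\<And>y. 0 < y \<Longrightarrow> (1 + y) ^ (3 * card (word_edges k c) + 2) *
        (exp (- (real n * norming n * y)) * (1 - exponent (norming n * y)) ^ (n - card (c ` {..<k}))) \<le> C2"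
  shows "scaled_density n k c y \<le> (\<Prod>e\<in>word_edges k c. 2 * fact (edge_mult k c e) * C1) * (\<Prod>i\<in>c ` {..<k}. C2 * two_power (\<alpha> / 4 - 1) (y i))"
proof -
  let ?V = "c ` {..<k}" and ?E = "word_edges k c" and ?b = "norming n" and ?m = "edge_mult k c"
  define s where "s e = edge_sum ?V e y" for e
  define g where "g e = sqrt (y (fst e) * y (snd e))" for e
  define \<psi> where "\<psi> z = exp (- (real n * ?b * z)) * (1 - exponent (?b * z)) ^ (n - card ?V)" for z
  define K where "K e = 2 * fact (?m e) * C1" for e
  define \<tau> where "\<tau> e = real n * tail_moment (?m e) (?b * s e) / s e ^ ?m e" for e
  define P where "P i = indicator {0<..} (y i) * (y i ^ (visits k c i - 1) / fact (visits k c i - 1) * \<psi> (y i))" for i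
  have \<psi>_nn: "0 \<le> \<psi> (y i)" if "i \<in> ?V" for i
    unfolding \<psi>_def using exponent_le_1[of "?b * y i"] b pos[OF that]
    by (intro mult_nonneg_nonneg zero_le_power) auto
  have K_nn: "0 \<le> K e" for e unfolding K_def using C1 by simp
  have s: "0 < s e" if "e \<in> ?E" for e unfolding s_def using that pos by (rule edge_sum_pos)
  have g: "0 < g e" "g e \<le> s e" if e: "e \<in> ?E" for e
  proof -
    have v: "fst e \<in> ?V" "snd e \<in> ?V" using word_edges_verts[OF e] by auto
    then show "0 < g e" using pos by (simp add: g_def)
    have "y i \<le> s e" if "i \<in> {fst e, snd e}" for i
      unfolding s_def edge_sum_def
      by (rule member_le_sum) (use v that pos in \<open>auto intro: less_imp_le\<close>)
    then have "y (fst e) * y (snd e) \<le> s e * s e"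
      using pos v s[OF e] by (intro mult_mono) (auto intro: less_imp_le)
    then show "g e \<le> s e" unfolding g_def using s[OF e] by (intro real_le_lsqrt) (auto simp: power2_eq_square)
  qed
  have \<tau>_nn: "0 \<le> \<tau> e" if "e \<in> ?E" for e
    unfolding \<tau>_def using s[OF that] b by (intro divide_nonneg_nonneg mult_nonneg_nonneg tail_moment_nonneg) auto
  have edge: "g e ^ ?m e * \<tau> e \<le> K e * (g e powr (\<alpha> / 2) * (1 + s e))" if e: "e \<in> ?E" for e
  proof -
    have m: "1 \<le> real (?m e)" using edge_mult_pos[OF e] by simp
    have q: "0 < g e / s e" "g e / s e \<le> 1" using g[OF e] s[OF e] by auto
    have "real n * tail_moment (?m e) (?b * s e) \<le> real n * (2 * fact (?m e) * exponent (?b * s e))"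
      using b s[OF e] by (intro mult_left_mono tail_moment_le) auto
    also have "\<dots> = 2 * fact (?m e) * (real n * exponent (?b * s e))" by simp
    also have "\<dots> \<le> 2 * fact (?m e) * (C1 * (s e powr (\<alpha> / 2) * (1 + s e)))"
      using s[OF e] by (intro mult_left_mono C1) auto
    also have "\<dots> = K e * (s e powr (\<alpha> / 2) * (1 + s e))" by (simp add: K_def)
    finally have 1: "real n * tail_moment (?m e) (?b * s e) \<le> K e * (s e powr (\<alpha> / 2) * (1 + s e))" .
    have "(g e / s e) ^ ?m e = (g e / s e) powr real (?m e)" using q by (simp add: powr_realpow)
    also have "\<dots> \<le> (g e / s e) powr (\<alpha> / 2)"
    proof -
      have "\<alpha> / 2 \<le> real (?m e)" using m alpha by linarith
      then show ?thesis using q by (intro powr_mono') auto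
    qed
    also have "\<dots> = g e powr (\<alpha> / 2) / s e powr (\<alpha> / 2)" using g[OF e] s[OF e] by (intro powr_divide)
    finally have 2: "(g e / s e) ^ ?m e \<le> g e powr (\<alpha> / 2) / s e powr (\<alpha> / 2)" .
    have 3: "0 \<le> real n * tail_moment (?m e) (?b * s e)"
      using b s[OF e] by (intro mult_nonneg_nonneg tail_moment_nonneg) auto
    have "g e ^ ?m e * \<tau> e = (g e / s e) ^ ?m e * (real n * tail_moment (?m e) (?b * s e))"
      by (simp add: power_divide \<tau>_def)
    also have "\<dots> \<le> (g e powr (\<alpha> / 2) / s e powr (\<alpha> / 2)) * (K e * (s e powr (\<alpha> / 2) * (1 + s e)))"
      by (rule mult_mono[OF 2 1 _ 3]) simp
    also have "\<dots> = K e * (g e powr (\<alpha> / 2) * (1 + s e))" using s[OF e] by simp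
    finally show ?thesis .
  qed
  have inner: "(\<Prod>e\<in>inner_pairs ?V - ?E. 1 - exponent (?b * s e)) \<le> 1"
  proof (intro prod_le_1 conjI)
    fix e
    have "0 \<le> ?b * s e" unfolding s_def using b pos by (intro mult_nonneg_nonneg edge_sum_nonneg) (auto intro: less_imp_le)
    then show "0 \<le> 1 - exponent (?b * s e)" "1 - exponent (?b * s e) \<le> 1"
      using exponent_le_1 exponent_nonneg by auto
  qed
  have vert: "0 \<le> P i" "P i \<le> y i ^ visits k c i * (\<psi> (y i) / y i)"
    if i: "i \<in> ?V" for i
  proof -
    have y: "0 < y i" by (rule pos[OF i])
    have v: "0 < visits k c i" by (rule visits_pos[OF i])
    have "y i ^ (visits k c i - 1) / fact (visits k c i - 1) \<le> y i ^ (visits k c i - 1) / 1"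
      using y by (intro divide_left_mono) auto
    also have "\<dots> = y i ^ visits k c i / y i" using y v by (cases "visits k c i") auto
    finally have "y i ^ (visits k c i - 1) / fact (visits k c i - 1) * \<psi> (y i) \<le> y i ^ visits k c i / y i * \<psi> (y i)"
      using \<psi>_nn[OF i] by (intro mult_right_mono)
    then show "P i \<le> y i ^ visits k c i * (\<psi> (y i) / y i)" unfolding P_def using y by simp
    show "0 \<le> P i" unfolding P_def using y \<psi>_nn[OF i] by simp
  qed
  have \<psi>y_nn: "0 \<le> (\<Prod>i\<in>?V. \<psi> (y i) / y i)"
  proof (intro prod_nonneg divide_nonneg_nonneg)
    fix i assume "i \<in> ?V"
    then show "0 \<le> \<psi> (y i)" "0 \<le> y i" using \<psi>_nn pos by (auto intro: less_imp_le)
  qed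
  have \<tau>_prod: "0 \<le> (\<Prod>e\<in>?E. \<tau> e)" by (intro prod_nonneg \<tau>_nn)
  have P_prod: "0 \<le> (\<Prod>i\<in>?V. P i)" by (intro prod_nonneg vert)
  have K_prod: "0 \<le> (\<Prod>e\<in>?E. K e)" by (intro prod_nonneg K_nn)
  have "scaled_density n k c y = (\<Prod>i\<in>?V. P i) * (\<Prod>e\<in>?E. \<tau> e) * (\<Prod>e\<in>inner_pairs ?V - ?E. 1 - exponent (?b * s e))"
    unfolding scaled_density_eq[OF c k] P_def \<tau>_def s_def \<psi>_def ..
  also have "\<dots> \<le> (\<Prod>i\<in>?V. P i) * (\<Prod>e\<in>?E. \<tau> e) * 1"
    by (intro mult_left_mono inner mult_nonneg_nonneg P_prod \<tau>_prod)
  also have "\<dots> \<le> (\<Prod>i\<in>?V. y i ^ visits k c i * (\<psi> (y i) / y i)) * (\<Prod>e\<in>?E. \<tau> e)"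
    unfolding mult_1_right by (intro mult_right_mono prod_mono conjI vert \<tau>_prod)
  also have "\<dots> = (\<Prod>i\<in>?V. \<psi> (y i) / y i) * (\<Prod>e\<in>?E. g e ^ ?m e * \<tau> e)"
  proof -
    have "(\<Prod>i\<in>?V. y i ^ visits k c i) = (\<Prod>e\<in>?E. g e ^ ?m e)"
      unfolding g_def by (rule prod_verts_sqrt_edges[OF pos])
    moreover have "(\<Prod>i\<in>?V. y i ^ visits k c i * (\<psi> (y i) / y i)) = (\<Prod>i\<in>?V. y i ^ visits k c i) * (\<Prod>i\<in>?V. \<psi> (y i) / y i)"
      by (rule prod.distrib)
    moreover have "(\<Prod>e\<in>?E. g e ^ ?m e * \<tau> e) = (\<Prod>e\<in>?E. g e ^ ?m e) * (\<Prod>e\<in>?E. \<tau> e)"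
      by (rule prod.distrib)
    ultimately show ?thesis by (simp only: mult.assoc mult.left_commute)
  qed
  also have "\<dots> \<le> (\<Prod>i\<in>?V. \<psi> (y i) / y i) * (\<Prod>e\<in>?E. K e * (g e powr (\<alpha> / 2) * (1 + s e)))"
  proof (intro mult_left_mono prod_mono conjI edge \<psi>y_nn)
    fix e assume "e \<in> ?E"
    then show "0 \<le> g e ^ ?m e * \<tau> e" using g(1)[of e] \<tau>_nn[of e] by simp
  qed
  also have "\<dots> = (\<Prod>e\<in>?E. K e) * ((\<Prod>i\<in>?V. \<psi> (y i) / y i) * ((\<Prod>e\<in>?E. g e powr (\<alpha> / 2)) * (\<Prod>e\<in>?E. 1 + s e)))"
    unfolding prod.distrib[of K] prod.distrib[of "\<lambda>e. g e powr (\<alpha> / 2)"] by (simp only: mult_ac)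
  also have "\<dots> \<le> (\<Prod>e\<in>?E. K e) * ((\<Prod>i\<in>?V. \<psi> (y i) / y i) *
      ((\<Prod>i\<in>?V. y i powr (\<alpha> / 4) * (1 + y i) ^ (2 * card ?E)) * (\<Prod>i\<in>?V. (1 + y i) ^ card ?E)))"
  proof (intro mult_left_mono mult_mono K_prod \<psi>y_nn)
    show "(\<Prod>e\<in>?E. g e powr (\<alpha> / 2)) \<le> (\<Prod>i\<in>?V. y i powr (\<alpha> / 4) * (1 + y i) ^ (2 * card ?E))"
      using prod_edges_powr_le[of c k y "\<alpha> / 2", OF pos] alpha by (simp add: g_def)
    have s1: "0 \<le> 1 + s e" if "e \<in> ?E" for e using s[OF that] by simp
    have "1 + s e \<le> (\<Prod>i\<in>?V. 1 + y i)" if "e \<in> ?E" for e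
    proof -
      have "s e \<le> (\<Sum>i\<in>?V. y i)"
        unfolding s_def edge_sum_def using pos by (intro sum_mono2) (auto intro: less_imp_le)
      moreover have "1 + (\<Sum>i\<in>?V. y i) \<le> (\<Prod>i\<in>?V. 1 + y i)"
        using pos by (intro one_plus_sum_le_prod) (auto intro: less_imp_le)
      ultimately show ?thesis by linarith
    qed
    then have "(\<Prod>e\<in>?E. 1 + s e) \<le> (\<Prod>e\<in>?E. \<Prod>i\<in>?V. 1 + y i)"
      by (intro prod_mono conjI s1)
    also have "\<dots> = (\<Prod>i\<in>?V. (1 + y i) ^ card ?E)" by (simp add: prod_power_distrib)
    finally show "(\<Prod>e\<in>?E. 1 + s e) \<le> (\<Prod>i\<in>?V. (1 + y i) ^ card ?E)" .
    show "0 \<le> (\<Prod>e\<in>?E. 1 + s e)" by (intro prod_nonneg s1)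
    show "0 \<le> (\<Prod>i\<in>?V. y i powr (\<alpha> / 4) * (1 + y i) ^ (2 * card ?E))"
      using pos by (intro prod_nonneg) (auto intro!: mult_nonneg_nonneg zero_le_power add_nonneg_nonneg less_imp_le)
  qed
  also have "(\<Prod>i\<in>?V. \<psi> (y i) / y i) * ((\<Prod>i\<in>?V. y i powr (\<alpha> / 4) * (1 + y i) ^ (2 * card ?E)) * (\<Prod>i\<in>?V. (1 + y i) ^ card ?E))
      = (\<Prod>i\<in>?V. \<psi> (y i) / y i * (y i powr (\<alpha> / 4) * (1 + y i) ^ (2 * card ?E) * (1 + y i) ^ card ?E))"
    by (simp only: prod.distrib mult.assoc)
  also have "(\<Prod>e\<in>?E. K e) * \<dots> \<le> (\<Prod>e\<in>?E. K e) * (\<Prod>i\<in>?V. C2 * two_power (\<alpha> / 4 - 1) (y i))"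
  proof (intro mult_left_mono prod_mono conjI)
    fix i assume i: "i \<in> ?V"
    have y: "0 < y i" by (rule pos[OF i])
    let ?z = "y i"
    show "0 \<le> \<psi> ?z / ?z * (?z powr (\<alpha> / 4) * (1 + ?z) ^ (2 * card ?E) * (1 + ?z) ^ card ?E)"
      using y \<psi>_nn[OF i] by simp
    \<comment> \<open>The power 3 |E| + 2 is made up of 2 |E| from the geometric means, |E| from the
      factors 1 + s e, and 2 for integrability at infinity.\<close>
    have "\<psi> ?z / ?z * (?z powr (\<alpha> / 4) * (1 + ?z) ^ (2 * card ?E) * (1 + ?z) ^ card ?E)
       = (?z powr (\<alpha> / 4) / ?z / (1 + ?z)\<^sup>2) * ((1 + ?z) ^ (3 * card ?E + 2) * \<psi> ?z)"
    proof -
      have "(1 + ?z) ^ (3 * card ?E + 2) = (1 + ?z) ^ (2 * card ?E) * (1 + ?z) ^ card ?E * (1 + ?z)\<^sup>2"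
        by (simp add: power_add[symmetric])
      then show ?thesis using y by (simp add: power_eq_0_iff)
    qed
    also have "\<dots> \<le> (?z powr (\<alpha> / 4) / ?z / (1 + ?z)\<^sup>2) * C2"
      unfolding \<psi>_def using y by (intro mult_left_mono C2) auto
    also have "?z powr (\<alpha> / 4) / ?z / (1 + ?z)\<^sup>2 \<le> two_power (\<alpha> / 4 - 1) ?z"
    proof (cases "?z \<le> 1")
      case True
      have "?z powr (\<alpha> / 4) / ?z / (1 + ?z)\<^sup>2 \<le> ?z powr (\<alpha> / 4) / ?z / 1"
        using y by (intro divide_left_mono) (auto intro: one_le_power)
      also have "\<dots> = ?z powr (\<alpha> / 4 - 1)" using y by (simp add: powr_diff)
      finally show ?thesis using True y by (simp add: two_power_def)
    next
      case False
      have "?z powr (\<alpha> / 4) \<le> ?z powr 1" using alpha False by (intro powr_mono) auto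
      then have "?z powr (\<alpha> / 4) / ?z \<le> 1" using y by simp
      then have "?z powr (\<alpha> / 4) / ?z / (1 + ?z)\<^sup>2 \<le> 1 / (1 + ?z)\<^sup>2" by (intro divide_right_mono) auto
      also have "\<dots> \<le> 1 / ?z\<^sup>2" using y by (intro divide_left_mono power_mono mult_pos_pos) auto
      also have "\<dots> = ?z powr (- 2)" using y by (simp add: powr_minus powr_numeral divide_inverse)
      finally show ?thesis using False by (simp add: two_power_def)
    qed
    finally show "\<psi> ?z / ?z * (?z powr (\<alpha> / 4) * (1 + ?z) ^ (2 * card ?E) * (1 + ?z) ^ card ?E) \<le> C2 * two_power (\<alpha> / 4 - 1) ?z"
      using C2 by (simp add: mult.commute)
  qed (rule K_prod)
  finally show ?thesis unfolding K_def .
qed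


lemma tail_moment_borel [measurable]: "tail_moment m \<in> borel_measurable borel"
  unfolding tail_moment_def[abs_def] by measurable

lemma exponent_borel [measurable]: "exponent \<in> borel_measurable borel"
  unfolding exponent_def[abs_def] by measurable

lemma word_density_measurable: "word_density n b k c \<in> borel_measurable (PiM (c ` {..<k}) (\<lambda>_. lborel))"
  and limit_density_measurable: "limit_density k c \<in> borel_measurable (PiM (c ` {..<k}) (\<lambda>_. lborel))"
proof -
  let ?V = "c ` {..<k}"
  let ?L = "PiM ?V (\<lambda>_. lborel :: real measure)"
  have [measurable]: "(\<lambda>y. y i) \<in> borel_measurable ?L" if "i \<in> ?V" for i
  proof -
    have "(\<lambda>y. y i) \<in> measurable ?L lborel" using that by (rule measurable_component_singleton)
    then show ?thesis by simp
  qed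
  have [measurable]: "edge_sum ?V e \<in> borel_measurable ?L" for e
    unfolding edge_sum_def by measurable
  show "word_density n b k c \<in> borel_measurable ?L"
    unfolding word_density_def[abs_def] by measurable
  show "limit_density k c \<in> borel_measurable ?L"
    unfolding limit_density_def[abs_def] by measurable
qed

text \<open>Dominated convergence with a product majorant: its integral over the vertex variables
  splits into one-dimensional integrals of \<open>two_power\<close>.\<close>

lemma scaled_density_integral_tendsto:
  assumes c: "c \<in> canonical_words k"
  shows "(\<lambda>n. \<integral>y. scaled_density n k c y \<partial>PiM (c ` {..<k}) (\<lambda>_. lborel)) \<longlonglongrightarrow> (\<integral>y. limit_density k c y \<partial>PiM (c ` {..<k}) (\<lambda>_. lborel))"
proof -
  let ?V = "c ` {..<k}"
  let ?L = "PiM ?V (\<lambda>_. lborel :: real measure)"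
  interpret PL: product_sigma_finite "\<lambda>_::nat. lborel :: real measure" ..
  obtain C1 where C1: "0 < C1"
    "\<forall>\<^sub>F n in sequentially. \<forall>s>0. real n * exponent (norming n * s) \<le> C1 * (s powr (\<alpha> / 2) * (1 + s))"
    by (rule exponent_scaled_dominated) blast
  obtain C2 where C2: "0 < C2" "\<forall>\<^sub>F n in sequentially. \<forall>y>0. (1 + y) ^ (3 * card (word_edges k c) + 2) *
      (exp (- (real n * norming n * y)) * (1 - exponent (norming n * y)) ^ (n - card ?V)) \<le> C2"
    by (rule vertex_factor_dominated) blast
  let ?K = "\<Prod>e\<in>word_edges k c. 2 * fact (edge_mult k c e) * C1"
  let ?W = "\<lambda>y. ?K * (\<Prod>i\<in>?V. C2 * two_power (\<alpha> / 4 - 1) (y i))"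
  have K0: "0 \<le> ?K" using C1 by (intro prod_nonneg) auto
  have W0: "0 \<le> ?W y" for y using C2 by (intro mult_nonneg_nonneg K0 prod_nonneg) auto
  have "\<forall>\<^sub>F n in sequentially. k \<le> n \<and> 0 < norming n \<and> (\<forall>y. norm (scaled_density n k c y) \<le> ?W y)"
    using C1(2) C2(2) norming_spec eventually_ge_at_top[of k]
  proof eventually_elim
    case (elim n)
    have "norm (scaled_density n k c y) \<le> ?W y" for y
    proof (cases "\<forall>i\<in>?V. 0 < y i")
      case True
      have "scaled_density n k c y \<le> ?W y"
        using elim True C1(1) C2(1) by (intro scaled_density_bound c) auto
      then show ?thesis using scaled_density_nonneg[of n k c y] elim by simp
    next
      case False
      then obtain i where i: "i \<in> ?V" "\<not> 0 < y i" by blast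
      have z: "\<exists>i\<in>?V. indicator {0<..} (y i) * h i = (0::real)" for h
        using i by (intro bexI[of _ i]) auto
      have "scaled_density n k c y = 0"
        unfolding scaled_density_def word_density_def by (subst prod_zero[OF _ z]) simp_all
      then show ?thesis using W0 by simp
    qed
    then show ?case using elim by blast
  qed
  then obtain N where N: "\<And>n. n \<ge> N \<Longrightarrow> (\<forall>y. norm (scaled_density n k c y) \<le> ?W y)"
    unfolding eventually_sequentially by blast
  \<comment> \<open>The domination holds only from some N on, so the sequence is shifted.\<close>
  have "(\<lambda>n. \<integral>y. scaled_density (n + N) k c y \<partial>?L) \<longlonglongrightarrow> (\<integral>y. limit_density k c y \<partial>?L)"
  proof (rule integral_dominated_convergence)
    show "integrable ?L ?W"
      using alpha by (intro integrable_mult_right PL.product_integrable_prod two_power_integrable) auto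
    show "AE y in ?L. (\<lambda>n. scaled_density (n + N) k c y) \<longlonglongrightarrow> limit_density k c y"
      by (intro AE_I2 LIMSEQ_ignore_initial_segment scaled_density_tendsto c)
    show "AE y in ?L. norm (scaled_density (n + N) k c y) \<le> ?W y" for n
      using N[of "n + N"] by (intro AE_I2) auto
    show "scaled_density (n + N) k c \<in> borel_measurable ?L" for n
      unfolding scaled_density_def[abs_def]
      by (intro borel_measurable_times borel_measurable_const word_density_measurable)
  qed (rule limit_density_measurable)
  then show ?thesis by (rule LIMSEQ_offset)
qed

text \<open>A shape with more edges than a tree is suppressed by a power of 1 / n and contributes
  0.\<close>

definition "word_limit k c =
  (if card (word_edges k c) = card (c ` {..<k}) - 1
   then \<integral>y. limit_density k c y \<partial>PiM (c ` {..<k}) (\<lambda>_. lborel) else 0)"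

lemma path_mean_nonneg: "(\<And>t. t < k \<Longrightarrow> w t < n) \<Longrightarrow> 0 \<le> path_mean n k w"
  unfolding path_mean_def by (intro Bochner_Integration.integral_nonneg damped_word_bounds) auto

lemma path_mean_tendsto:
  assumes c: "c \<in> canonical_words k" and k: "0 < k"
  shows "(\<lambda>n. real n ^ (card (c ` {..<k}) - 1) * path_mean n k c) \<longlonglongrightarrow> word_limit k c"
proof -
  let ?V = "c ` {..<k}" and ?E = "word_edges k c"
  let ?L = "PiM ?V (\<lambda>_. lborel :: real measure)"
  let ?v = "card ?V - 1"
  have ge: "?v \<le> card ?E" by (rule card_word_edges_ge[OF c k])
  have "(\<lambda>n. inverse (real n) ^ (card ?E - ?v) * (\<integral>y. scaled_density n k c y \<partial>?L)) \<longlonglongrightarrow>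
      0 ^ (card ?E - ?v) * (\<integral>y. limit_density k c y \<partial>?L)"
    by (intro tendsto_mult tendsto_power lim_inverse_n scaled_density_integral_tendsto c)
  \<comment> \<open>Since 0 ^ 0 = 1, the power of 0 is exactly the selection of the tree
    shapes.\<close>
  also have "0 ^ (card ?E - ?v) * (\<integral>y. limit_density k c y \<partial>?L) = word_limit k c"
    using ge by (auto simp: word_limit_def)
  finally have 1: "(\<lambda>n. inverse (real n) ^ (card ?E - ?v) * (\<integral>y. scaled_density n k c y \<partial>?L)) \<longlonglongrightarrow> word_limit k c" .
  have "\<forall>\<^sub>F n in sequentially. inverse (real n) ^ (card ?E - ?v) * (\<integral>y. scaled_density n k c y \<partial>?L) = real n ^ ?v * path_mean n k c"
    using norming_spec eventually_ge_at_top[of k]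
  proof eventually_elim
    case (elim n)
    have n: "0 < real n" using elim k by simp
    have "0 \<le> word_density n (norming n) k c y" for y
    proof -
      have "0 < real n ^ card (word_edges k c)" using n by simp
      moreover have "0 \<le> real n ^ card (word_edges k c) * word_density n (norming n) k c y"
        using scaled_density_nonneg[of n k c y] elim unfolding scaled_density_def by blast
      ultimately show ?thesis by (metis not_le zero_le_mult_iff)
    qed
    then have "(\<integral>y. word_density n (norming n) k c y \<partial>?L) = enn2real (\<integral>\<^sup>+y. ennreal (word_density n (norming n) k c y) \<partial>?L)"
      by (intro integral_eq_nn_integral word_density_measurable) auto
    also have "\<dots> = path_mean n k c"
    proof -
      have "0 \<le> path_mean n k c"
        by (rule path_mean_nonneg) (use canonical_words_lt[OF c] elim in \<open>meson less_le_trans\<close>)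
      moreover have "ennreal (path_mean n k c) = (\<integral>\<^sup>+y. ennreal (word_density n (norming n) k c y) \<partial>?L)"
        using elim by (intro path_mean_formula c k) auto
      ultimately show ?thesis by (metis enn2real_ennreal)
    qed
    finally have "(\<integral>y. scaled_density n k c y \<partial>?L) = real n ^ card ?E * path_mean n k c"
      by (simp add: scaled_density_def)
    moreover have "inverse (real n) ^ (card ?E - ?v) * real n ^ card ?E = real n ^ ?v"
      using ge n by (simp add: power_inverse power_diff field_simps)
    ultimately show ?case by (simp add: mult.assoc[symmetric])
  qed
  with 1 show ?thesis by (rule Lim_transform_eventually)
qed

text \<open>Exchangeability: a permutation of the indices permutes the independent pairs, preserves
  their product law, and carries row sums to row sums.\<close>

lemma path_mean_permute:
  assumes \<pi>: "bij_betw \<pi> {..<n} {..<n}" and w: "\<And>t. t < k \<Longrightarrow> w t < n"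
  shows "path_mean n k (\<lambda>t. \<pi> (w t)) = path_mean n k w"
proof -
  let ?Q = "PiM (upper_pairs n) (\<lambda>_. D)"
  let ?\<sigma> = "\<lambda>e. sorted_pair (\<pi> (fst e)) (\<pi> (snd e))"
  have \<pi>lt: "\<pi> i < n" if "i < n" for i using \<pi> that by (auto simp: bij_betw_def)
  have \<pi>inj: "\<pi> i = \<pi> j \<longleftrightarrow> i = j" if "i < n" "j < n" for i j
    using \<pi> that by (auto simp: bij_betw_def inj_on_def)
  have \<sigma>_mem: "?\<sigma> \<in> upper_pairs n \<rightarrow> upper_pairs n"
  proof
    fix e assume "e \<in> upper_pairs n"
    then have "fst e < n" "snd e < n" by (auto simp: upper_pairs_def)
    then show "?\<sigma> e \<in> upper_pairs n" by (intro sorted_pair_upper \<pi>lt)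
  qed
  have \<sigma>_inj: "inj_on ?\<sigma> (upper_pairs n)"
    by (auto simp: inj_on_def upper_pairs_def sorted_pair_eq_iff \<pi>inj)
  let ?T = "\<lambda>x. \<lambda>e\<in>upper_pairs n. x (?\<sigma> e)"
  have distr: "distr ?Q ?Q ?T = ?Q"
    by (rule distr_PiM_reindex[where M = "\<lambda>_. D", OF _ \<sigma>_inj \<sigma>_mem]) (rule D.prob_space_axioms)
  have tw: "table_weight (?T x) i j = table_weight x (\<pi> i) (\<pi> j)" if "i < n" "j < n" for x i j
  proof -
    have "?\<sigma> (sorted_pair i j) = sorted_pair (\<pi> i) (\<pi> j)"
      by (auto simp: sorted_pair_def min_def max_def)
    then show ?thesis using sorted_pair_upper[OF that] by (simp add: table_weight_def)
  qed
  have dk: "damped_kernel n (table_weight (?T x)) i j = damped_kernel n (table_weight x) (\<pi> i) (\<pi> j)" if "i < n" "j < n" for x i j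
  proof -
    have "(\<Sum>l<n. table_weight (?T x) i l) = (\<Sum>l<n. table_weight x (\<pi> i) (\<pi> l))"
      using that by (intro sum.cong refl tw) auto
    also have "\<dots> = (\<Sum>l<n. table_weight x (\<pi> i) l)"
      using sum.reindex_bij_betw[OF \<pi>, of "table_weight x (\<pi> i)"] by simp
    finally show ?thesis using tw[OF that] by (simp add: damped_kernel_def)
  qed
  have T_meas: "?T \<in> measurable ?Q ?Q"
    using \<sigma>_mem by (intro measurable_restrict measurable_component_singleton) auto
  have "path_mean n k w = (\<integral>x. (\<Prod>t<k. damped_kernel n (table_weight x) (w t) (w (next_step k t))) \<partial>distr ?Q ?Q ?T)"
    unfolding path_mean_def distr ..
  also have "\<dots> = (\<integral>x. (\<Prod>t<k. damped_kernel n (table_weight (?T x)) (w t) (w (next_step k t))) \<partial>?Q)"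
    by (rule integral_distr[OF T_meas damped_word_measurable[OF w]])
  also have "\<dots> = path_mean n k (\<lambda>t. \<pi> (w t))"
    unfolding path_mean_def
    by (intro Bochner_Integration.integral_cong refl prod.cong dk w next_step_lt) auto
  finally show ?thesis by simp
qed

lemma path_mean_cong: "(\<And>t. t < k \<Longrightarrow> w t = w' t) \<Longrightarrow> path_mean n k w = path_mean n k w'"
proof -
  assume w: "\<And>t. t < k \<Longrightarrow> w t = w' t"
  have "(\<Prod>t<k. damped_kernel n (table_weight x) (w t) (w (next_step k t))) = (\<Prod>t<k. damped_kernel n (table_weight x) (w' t) (w' (next_step k t)))" for x
    by (intro prod.cong refl) (simp add: w next_step_lt)
  then show ?thesis by (simp add: path_mean_def)
qed

text \<open>The labelling of the shape by w is injective on its vertices and hence extends to a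
  permutation of all n indices.\<close>

lemma path_mean_canonical:
  assumes w: "w \<in> PiE {..<k} (\<lambda>_. {..<n})" and k: "k \<le> n"
  shows "path_mean n k w = path_mean n k (canonical_form k w)"
proof -
  define c where "c = canonical_form k w"
  have c: "c \<in> canonical_words k" unfolding c_def by (rule canonical_form_words)
  have "c ` {..<k} \<subseteq> {..<n}" using canonical_verts_subset[OF c] k by auto
  moreover have "inj_on w (c ` {..<k})" by (rule canonical_form_inj[OF c_def[symmetric]])
  moreover have "w ` c ` {..<k} \<subseteq> {..<n}" using w canonical_verts_subset[OF c] by (auto simp: PiE_iff)
  ultimately obtain \<pi> where \<pi>: "bij_betw \<pi> {..<n} {..<n}" "\<And>v. v \<in> c ` {..<k} \<Longrightarrow> \<pi> v = w v"
    by (rule inj_extends_to_permutation[OF finite_lessThan]) blast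
  have "path_mean n k w = path_mean n k (\<lambda>t. \<pi> (c t))"
    using \<pi>(2) canonical_form_eq[of _ k w] by (intro path_mean_cong) (simp add: c_def)
  also have "\<dots> = path_mean n k c"
    by (rule path_mean_permute[OF \<pi>(1)]) (use canonical_words_lt[OF c] k in \<open>meson less_le_trans\<close>)
  finally show ?thesis by (simp add: c_def)
qed

definition "damped_moment n k = (\<integral>x. kernel_trace n (kernel_pow n (damped_kernel n (table_weight x)) k) / real n \<partial>PiM (upper_pairs n) (\<lambda>_. D))"

definition "limit_moment k = (\<Sum>c\<in>canonical_words k. word_limit k c)"

text \<open>Closed walks are grouped by shape. The falling factorial counts the labellings of a
  shape; dividing by n leaves n^(v - 1) path means, the quantity with a limit.\<close>

lemma damped_moment_tendsto:
  assumes k: "0 < k"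
  shows "(\<lambda>n. damped_moment n k) \<longlonglongrightarrow> limit_moment k"
proof -
  let ?v = "\<lambda>c. card (c ` {..<k})"
  have "(\<lambda>n. \<Sum>c\<in>canonical_words k. real (\<Prod>i<?v c. n - i) / real n ^ ?v c * (real n ^ (?v c - 1) * path_mean n k c))
    \<longlonglongrightarrow> (\<Sum>c\<in>canonical_words k. 1 * word_limit k c)"
    by (intro tendsto_sum tendsto_mult falling_factorial_ratio path_mean_tendsto k)
  moreover have "\<forall>\<^sub>F n in sequentially. (\<Sum>c\<in>canonical_words k. real (\<Prod>i<?v c. n - i) / real n ^ ?v c * (real n ^ (?v c - 1) * path_mean n k c)) = damped_moment n k"
    using eventually_ge_at_top[of k]
  proof eventually_elim
    case (elim n)
    have n: "0 < real n" using elim k by simp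
    let ?Q = "PiM (upper_pairs n) (\<lambda>_. D)" and ?W = "PiE {..<k} (\<lambda>_. {..<n})"
    interpret Q: prob_space ?Q by (intro prob_space_PiM D.prob_space_axioms)
    have int: "integrable ?Q (\<lambda>x. \<Prod>t<k. damped_kernel n (table_weight x) (w t) (w (next_step k t)))" if "w \<in> ?W" for w
    proof -
      have w: "w t < n" if "t < k" for t using \<open>w \<in> ?W\<close> that by (auto simp: PiE_iff)
      show ?thesis
      proof (rule Q.bounded_integrable)
        show "(\<lambda>x. \<Prod>t<k. damped_kernel n (table_weight x) (w t) (w (next_step k t))) \<in> borel_measurable ?Q"
          by (rule damped_word_measurable[OF w])
        show "\<bar>\<Prod>t<k. damped_kernel n (table_weight x) (w t) (w (next_step k t))\<bar> \<le> 1" for x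
          using damped_word_bounds[of k w n x] w by simp
      qed
    qed
    have fin: "finite ?W" by (intro finite_PiE) auto
    have "damped_moment n k = (\<integral>x. (\<Sum>w\<in>?W. \<Prod>t<k. damped_kernel n (table_weight x) (w t) (w (next_step k t))) \<partial>?Q) / real n"
      unfolding damped_moment_def kernel_trace_paths[OF k] by (rule integral_divide_zero)
    also have "(\<integral>x. (\<Sum>w\<in>?W. \<Prod>t<k. damped_kernel n (table_weight x) (w t) (w (next_step k t))) \<partial>?Q) = (\<Sum>w\<in>?W. path_mean n k w)"
      unfolding path_mean_def by (intro Bochner_Integration.integral_sum int)
    also have "\<dots> = (\<Sum>w\<in>?W. path_mean n k (canonical_form k w))"
      using elim by (intro sum.cong refl path_mean_canonical)
    also have "\<dots> = (\<Sum>c\<in>canonical_words k. \<Sum>w\<in>{w \<in> ?W. canonical_form k w = c}. path_mean n k (canonical_form k w))"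
      using fin canonical_form_words by (intro sum.group[symmetric]) auto
    also have "\<dots> = (\<Sum>c\<in>canonical_words k. real (\<Prod>i<?v c. n - i) * path_mean n k c)"
    proof (intro sum.cong refl)
      fix c assume c: "c \<in> canonical_words k"
      have "(\<Sum>w\<in>{w \<in> ?W. canonical_form k w = c}. path_mean n k (canonical_form k w)) = (\<Sum>w\<in>{w \<in> ?W. canonical_form k w = c}. path_mean n k c)"
        by (intro sum.cong refl) auto
      also have "\<dots> = real (card {w \<in> ?W. canonical_form k w = c}) * path_mean n k c" by simp
      finally show "(\<Sum>w\<in>{w \<in> ?W. canonical_form k w = c}. path_mean n k (canonical_form k w)) = real (\<Prod>i<?v c. n - i) * path_mean n k c"
        unfolding card_canonical_form[OF c] .
    qed
    also have "\<dots> / real n = (\<Sum>c\<in>canonical_words k. real (\<Prod>i<?v c. n - i) / real n ^ ?v c * (real n ^ (?v c - 1) * path_mean n k c))"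
      unfolding sum_divide_distrib
    proof (intro sum.cong refl)
      fix c assume c: "c \<in> canonical_words k"
      have "?v c \<noteq> 0" using k by (auto simp: card_eq_0_iff)
      then have "real n ^ ?v c = real n * real n ^ (?v c - 1)" by (cases "?v c") auto
      then show "real (\<Prod>i<?v c. n - i) * path_mean n k c / real n = real (\<Prod>i<?v c. n - i) / real n ^ ?v c * (real n ^ (?v c - 1) * path_mean n k c)"
        using n by (simp only:) (simp add: divide_simps)
    qed
    finally show ?case by simp
  qed
  ultimately have "(\<lambda>n. damped_moment n k) \<longlonglongrightarrow> (\<Sum>c\<in>canonical_words k. 1 * word_limit k c)"
    by (rule Lim_transform_eventually)
  then show ?thesis by (simp add: limit_moment_def)
qed

lemma limit_moment_odd: "odd k \<Longrightarrow> limit_moment k = 0"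
  unfolding limit_moment_def word_limit_def using even_tree_word[of _ k]
  by (intro sum.neutral) (auto simp: odd_pos)


section \<open>Removing the damping\<close>

text \<open>Row i consists of n independent weights. It is treated as the case V = {i} of
  \<open>prod_outer_pairs\<close>: the loop gives one factor, the pairs leaving i the other n -
  1.\<close>

lemma row_laplace:
  assumes i: "i < n" and s: "0 < s"
  shows "(\<integral>\<^sup>+x. ennreal (exp (- (s * (\<Sum>j<n. table_weight x i j)))) \<partial>PiM (upper_pairs n) (\<lambda>_. D)) = ennreal ((1 - exponent s) ^ n)"
proof -
  interpret PD: product_sigma_finite "\<lambda>_::nat \<times> nat. D" ..
  let ?Q = "PiM (upper_pairs n) (\<lambda>_. D)"
  let ?es = "\<lambda>e. edge_sum {i} e (\<lambda>_. s)"
  have es: "0 \<le> ?es e" for e using s by (intro edge_sum_nonneg) auto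
  have "exp (- (s * (\<Sum>j<n. table_weight x i j))) = (\<Prod>e\<in>upper_pairs n. exp (- (1 * ?es e * \<bar>x e\<bar>)))" for x
  proof -
    have "s * (\<Sum>j<n. table_weight x i j) = (\<Sum>e\<in>upper_pairs n. ?es e * \<bar>x e\<bar>)"
      using sum_table_weight[of "{i}" n "\<lambda>_. s" x] i by simp
    then show ?thesis by (simp add: exp_sum[symmetric] sum_negf)
  qed
  then have "(\<integral>\<^sup>+x. ennreal (exp (- (s * (\<Sum>j<n. table_weight x i j)))) \<partial>?Q)
      = (\<integral>\<^sup>+x. (\<Prod>e\<in>upper_pairs n. ennreal (\<bar>x e\<bar> ^ 0 * exp (- (1 * ?es e * \<bar>x e\<bar>)))) \<partial>?Q)"
    by (simp add: prod_ennreal)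
  also have "\<dots> = (\<Prod>e\<in>upper_pairs n. \<integral>\<^sup>+u. ennreal (\<bar>u\<bar> ^ 0 * exp (- (1 * ?es e * \<bar>u\<bar>))) \<partial>D)"
    by (intro PD.product_nn_integral_prod) auto
  also have "\<dots> = (\<Prod>e\<in>upper_pairs n. ennreal (1 - exponent (?es e)))"
    using es by (intro prod.cong refl) (subst entry_integral, auto)
  also have "\<dots> = ennreal (\<Prod>e\<in>upper_pairs n. 1 - exponent (?es e))"
    using es exponent_le_1 by (intro prod_ennreal) auto
  also have "(\<Prod>e\<in>upper_pairs n. 1 - exponent (?es e)) = (\<Prod>e\<in>inner_pairs {i}. 1 - exponent (?es e)) * (1 - exponent s) ^ (n - 1)"
    using prod_outer_pairs[of "{i}" n "{}" "\<lambda>s. 1 - exponent s" "\<lambda>_. s"] i by (simp add: exponent_eq)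
  also have "inner_pairs {i} = {(i, i)}" by (auto simp: inner_pairs_def)
  also have "(\<Prod>e\<in>{(i, i)}. 1 - exponent (?es e)) * (1 - exponent s) ^ (n - 1) = (1 - exponent s) ^ n"
    using i by (cases n) (auto simp: edge_sum_def)
  finally show ?thesis .
qed

text \<open>If the row sum is at least n / \<delta>, the ratio is at most \<delta>. Otherwise it is
  at most 1, which is below exp (1 - \<delta> \<rho> / n), as in a Chernoff bound.\<close>

lemma row_damping_bound:
  assumes i: "i < n" and \<delta>: "0 < \<delta>"
  shows "(\<integral>x. real n / (real n + (\<Sum>j<n. table_weight x i j)) \<partial>PiM (upper_pairs n) (\<lambda>_. D))
    \<le> \<delta> + exp 1 * (1 - exponent (\<delta> / real n)) ^ n"
proof -
  let ?Q = "PiM (upper_pairs n) (\<lambda>_. D)"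
  let ?\<rho> = "\<lambda>x. \<Sum>j<n. table_weight x i j"
  interpret Q: prob_space ?Q by (intro prob_space_PiM D.prob_space_axioms)
  have n: "0 < real n" using i by simp
  have \<rho>: "0 \<le> ?\<rho> x" for x by (intro sum_nonneg) simp
  have [measurable]: "?\<rho> \<in> borel_measurable ?Q"
    using i by (intro borel_measurable_sum table_weight_measurable) auto
  let ?s = "\<delta> / real n"
  have s: "0 < ?s" using n \<delta> by simp
  have int: "integrable ?Q (\<lambda>x. exp (- (?s * ?\<rho> x)))"
  proof (rule Q.bounded_integrable)
    show "\<bar>exp (- (?s * ?\<rho> x))\<bar> \<le> 1" for x
      using mult_nonneg_nonneg[of ?s "?\<rho> x"] s \<rho>[of x] by simp
  qed measurable
  have pt: "real n / (real n + ?\<rho> x) \<le> \<delta> + exp 1 * exp (- (?s * ?\<rho> x))" for x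
  proof (cases "1 \<le> ?s * ?\<rho> x")
    case True
    then have "real n \<le> \<delta> * ?\<rho> x" using n by (simp add: field_simps)
    also have "\<dots> \<le> \<delta> * (real n + ?\<rho> x)" using n \<delta> by (simp add: algebra_simps)
    finally have "real n / (real n + ?\<rho> x) \<le> \<delta>" using n \<rho>[of x] by (simp add: pos_divide_le_eq add_pos_nonneg)
    then show ?thesis by (simp add: add_increasing2)
  next
    case False
    have "real n / (real n + ?\<rho> x) \<le> 1" using n \<rho>[of x] by simp
    also have "\<dots> \<le> exp (1 - ?s * ?\<rho> x)" using False by simp
    also have "\<dots> = exp 1 * exp (- (?s * ?\<rho> x))" by (simp add: exp_add[symmetric])
    finally show ?thesis using \<delta> by simp
  qed
  have "(\<integral>x. real n / (real n + ?\<rho> x) \<partial>?Q) \<le> (\<integral>x. \<delta> + exp 1 * exp (- (?s * ?\<rho> x)) \<partial>?Q)"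
  proof (rule integral_mono)
    show "integrable ?Q (\<lambda>x. real n / (real n + ?\<rho> x))"
      using n \<rho> by (intro Q.bounded_integrable[where B = 1]) (auto simp: divide_le_eq_1)
    show "integrable ?Q (\<lambda>x. \<delta> + exp 1 * exp (- (?s * ?\<rho> x)))" using int by simp
  qed (rule pt)
  also have "\<dots> = \<delta> + exp 1 * (\<integral>x. exp (- (?s * ?\<rho> x)) \<partial>?Q)"
    using int Q.prob_space by simp
  also have "(\<integral>x. exp (- (?s * ?\<rho> x)) \<partial>?Q) = (1 - exponent ?s) ^ n"
  proof -
    have "ennreal (\<integral>x. exp (- (?s * ?\<rho> x)) \<partial>?Q) = ennreal ((1 - exponent ?s) ^ n)"
      unfolding row_laplace[OF i s, symmetric] using int by (intro nn_integral_eq_integral[symmetric]) auto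
    moreover have "0 \<le> (1 - exponent ?s) ^ n" using s exponent_le_1[of ?s] by (intro zero_le_power) auto
    moreover have "0 \<le> (\<integral>x. exp (- (?s * ?\<rho> x)) \<partial>?Q)" by simp
    ultimately show ?thesis by (simp only: ennreal_inj)
  qed
  finally show ?thesis .
qed

text \<open>By \<open>exponent_lower\<close>, n times \<open>exponent (\<delta> / n)\<close> grows
  at least like n^((1 - \<alpha>)/2). So rows of sum below n / \<delta> become rare, for every
  \<delta>.\<close>

lemma exponent_power_tendsto_0:
  assumes \<delta>: "0 < \<delta>"
  shows "(\<lambda>n. (1 - exponent (\<delta> / real n)) ^ n) \<longlonglongrightarrow> 0"
proof -
  let ?\<eta> = "(\<alpha> + 1) / 2"
  obtain c x0 where c: "c > 0" "x0 > 0" "\<And>x. 0 < x \<Longrightarrow> x \<le> x0 \<Longrightarrow> c * x powr ?\<eta> \<le> exponent x"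
    by (rule exponent_lower) blast
  have up: "filterlim (\<lambda>n. c * \<delta> powr ?\<eta> * real n powr (1 - ?\<eta>)) at_top sequentially"
  proof (rule filterlim_tendsto_pos_mult_at_top[OF tendsto_const])
    show "0 < c * \<delta> powr ?\<eta>" using c \<delta> by simp
    show "filterlim (\<lambda>n. real n powr (1 - ?\<eta>)) at_top sequentially"
    proof (rule filterlim_cong[OF refl refl, THEN iffD1])
      have "0 < 1 - ?\<eta>" using alpha by (simp add: field_simps)
      then show "filterlim (\<lambda>n. exp ((1 - ?\<eta>) * ln (real n))) at_top sequentially"
        by (intro filterlim_compose[OF exp_at_top] filterlim_tendsto_pos_mult_at_top[OF tendsto_const]
            filterlim_compose[OF ln_at_top filterlim_real_sequentially])
      show "\<forall>\<^sub>F n in sequentially. exp ((1 - ?\<eta>) * ln (real n)) = real n powr (1 - ?\<eta>)"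
        using eventually_gt_at_top[of 0] by eventually_elim (simp add: powr_def)
    qed
  qed
  show ?thesis
  proof (rule tendsto_sandwich[where f = "\<lambda>_. 0" and h = "\<lambda>n. exp (- (c * \<delta> powr ?\<eta> * real n powr (1 - ?\<eta>)))"])
    have "\<forall>\<^sub>F n in sequentially. \<delta> / x0 \<le> real n"
      using filterlim_real_sequentially unfolding filterlim_at_top by blast
    then show "\<forall>\<^sub>F n in sequentially. (1 - exponent (\<delta> / real n)) ^ n \<le> exp (- (c * \<delta> powr ?\<eta> * real n powr (1 - ?\<eta>)))"
      using eventually_gt_at_top[of 0]
    proof eventually_elim
      case (elim n)
      have n: "0 < real n" using elim by simp
      have x: "0 < \<delta> / real n" "\<delta> / real n \<le> x0" using elim \<delta> c n by (auto simp: field_simps)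
      have "(1 - exponent (\<delta> / real n)) ^ n \<le> exp (- exponent (\<delta> / real n)) ^ n"
        using exponent_le_1[of "\<delta> / real n"] x(1) exp_ge_add_one_self[of "- exponent (\<delta> / real n)"]
        by (intro power_mono) auto
      also have "\<dots> = exp (- (real n * exponent (\<delta> / real n)))" by (simp add: exp_of_nat_mult[symmetric])
      also have "\<dots> \<le> exp (- (c * \<delta> powr ?\<eta> * real n powr (1 - ?\<eta>)))"
      proof -
        have "c * \<delta> powr ?\<eta> * real n powr (1 - ?\<eta>) = real n * (c * (\<delta> / real n) powr ?\<eta>)"
          using n \<delta> by (simp add: powr_divide powr_diff)
        also have "\<dots> \<le> real n * exponent (\<delta> / real n)"
          using x by (intro mult_left_mono c(3)) auto
        finally show ?thesis by simp
      qed
      finally show ?case .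
    qed
    show "\<forall>\<^sub>F n in sequentially. 0 \<le> (1 - exponent (\<delta> / real n)) ^ n"
      using \<delta> exponent_le_1 by (intro always_eventually allI zero_le_power) auto
    show "(\<lambda>n. exp (- (c * \<delta> powr ?\<eta> * real n powr (1 - ?\<eta>)))) \<longlonglongrightarrow> 0"
      using up by (intro filterlim_compose[OF exp_at_bot] filterlim_uminus_at_bot[THEN iffD2]) auto
  qed simp
qed

lemma spectral_damped_diff:
  assumes n: "0 < n" and \<delta>: "0 < \<delta>"
  shows "\<bar>(\<integral>x. spectral_moment n k x \<partial>PiM (upper_pairs n) (\<lambda>_. D)) - damped_moment n k\<bar>
    \<le> real k * (\<delta> + exp 1 * (1 - exponent (\<delta> / real n)) ^ n)"
proof -
  let ?Q = "PiM (upper_pairs n) (\<lambda>_. D)"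
  interpret Q: prob_space ?Q by (intro prob_space_PiM D.prob_space_axioms)
  let ?dm = "\<lambda>x. kernel_trace n (kernel_pow n (damped_kernel n (table_weight x)) k) / real n"
  let ?r = "\<lambda>x i. real n / (real n + (\<Sum>j<n. table_weight x i j))"
  have S: "substochastic n (damped_kernel n (table_weight x))" for x by (rule substochastic_damped) simp
  have \<rho>: "0 \<le> (\<Sum>j<n. table_weight x i j)" for x i by (intro sum_nonneg) simp
  have rm: "(\<lambda>x. ?r x i) \<in> borel_measurable ?Q" if "i < n" for i
    using that by (intro borel_measurable_divide borel_measurable_add borel_measurable_const borel_measurable_sum table_weight_measurable) auto
  have rint: "integrable ?Q (\<lambda>x. ?r x i)" if "i < n" for i
    using rm[OF that] \<rho> n by (intro Q.bounded_integrable[where B = 1]) (auto simp: divide_le_eq_1)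
  have int1: "integrable ?Q (spectral_moment n k)"
    using spectral_moment_bounded by (intro Q.bounded_integrable[where B = 1] spectral_moment_measurable) auto
  have dmb: "\<bar>?dm x\<bar> \<le> 1" for x
    using kernel_trace_pow_bounds[OF S, of x k] n by (simp add: abs_mult)
  have dkm: "(\<lambda>x. damped_kernel n (table_weight x) i j) \<in> borel_measurable ?Q" if "i < n" "j < n" for i j
    unfolding damped_kernel_def using that
    by (intro borel_measurable_divide borel_measurable_add borel_measurable_const borel_measurable_sum table_weight_measurable) auto
  have int2: "integrable ?Q ?dm"
    using dmb by (intro Q.bounded_integrable[where B = 1] borel_measurable_divide kernel_trace_pow_measurable dkm) auto
  have pt: "\<bar>spectral_moment n k x - ?dm x\<bar> \<le> real k / real n * (\<Sum>i<n. ?r x i)" for x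
  proof -
    have "\<bar>spectral_moment n k x - ?dm x\<bar> = \<bar>kernel_trace n (kernel_pow n (markov_kernel n (table_weight x)) k)
      - kernel_trace n (kernel_pow n (damped_kernel n (table_weight x)) k)\<bar> / real n"
      by (simp add: spectral_moment_def diff_divide_distrib[symmetric])
    also have "\<dots> \<le> real k * (\<Sum>i<n. \<Sum>j<n. \<bar>markov_kernel n (table_weight x) i j - damped_kernel n (table_weight x) i j\<bar>) / real n"
      by (intro divide_right_mono kernel_trace_pow_diff substochastic_table S) simp
    also have "(\<Sum>i<n. \<Sum>j<n. \<bar>markov_kernel n (table_weight x) i j - damped_kernel n (table_weight x) i j\<bar>) = (\<Sum>i<n. ?r x i)"
      by (intro sum.cong refl markov_damped_diff) auto
    finally show ?thesis by simp
  qed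
  have "\<bar>(\<integral>x. spectral_moment n k x \<partial>?Q) - damped_moment n k\<bar> = \<bar>\<integral>x. spectral_moment n k x - ?dm x \<partial>?Q\<bar>"
    unfolding damped_moment_def using int1 int2 by (subst Bochner_Integration.integral_diff) auto
  also have "\<dots> \<le> (\<integral>x. \<bar>spectral_moment n k x - ?dm x\<bar> \<partial>?Q)" by (rule integral_abs_bound)
  also have "\<dots> \<le> (\<integral>x. real k / real n * (\<Sum>i<n. ?r x i) \<partial>?Q)"
    by (intro integral_mono pt integrable_mult_right Bochner_Integration.integrable_sum rint integrable_abs
        Bochner_Integration.integrable_diff int1 int2) auto
  also have "\<dots> = real k / real n * (\<Sum>i<n. \<integral>x. ?r x i \<partial>?Q)"
    using rint by (simp add: Bochner_Integration.integral_sum)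
  also have "\<dots> \<le> real k / real n * (\<Sum>i<n. \<delta> + exp 1 * (1 - exponent (\<delta> / real n)) ^ n)"
    using \<delta> by (intro mult_left_mono sum_mono row_damping_bound) auto
  also have "\<dots> = real k * (\<delta> + exp 1 * (1 - exponent (\<delta> / real n)) ^ n)" using n by simp
  finally show ?thesis .
qed

lemma mean_spectral_moment_tendsto:
  assumes k: "0 < k"
  shows "(\<lambda>n. \<integral>x. spectral_moment n k x \<partial>PiM (upper_pairs n) (\<lambda>_. D)) \<longlonglongrightarrow> limit_moment k"
proof -
  let ?m = "\<lambda>n. \<integral>x. spectral_moment n k x \<partial>PiM (upper_pairs n) (\<lambda>_. D)"
  have "(\<lambda>n. ?m n - damped_moment n k) \<longlonglongrightarrow> 0"
  proof (rule tendstoI)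
    fix e :: real assume e: "0 < e"
    define \<delta> where "\<delta> = e / (2 * real k)"
    have \<delta>: "0 < \<delta>" "real k * \<delta> = e / 2" using e k by (auto simp: \<delta>_def)
    have "(\<lambda>n. real k * (\<delta> + exp 1 * (1 - exponent (\<delta> / real n)) ^ n)) \<longlonglongrightarrow> real k * (\<delta> + exp 1 * 0)"
      by (intro tendsto_intros exponent_power_tendsto_0 \<delta>)
    then have "\<forall>\<^sub>F n in sequentially. real k * (\<delta> + exp 1 * (1 - exponent (\<delta> / real n)) ^ n) < e"
      by (rule order_tendstoD) (use \<delta> e in simp)
    then show "\<forall>\<^sub>F n in sequentially. dist (?m n - damped_moment n k) 0 < e"
      using eventually_gt_at_top[of 0]
    proof eventually_elim
      case (elim n)
      then show ?case using spectral_damped_diff[of n \<delta> k] \<delta> by (simp add: dist_real_def)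
    qed
  qed
  from tendsto_add[OF this damped_moment_tendsto[OF k]] show ?thesis by simp
qed

end

section \<open>Eigenvalues of reversible Markov matrices\<close>

lemma mat_mult_kernel:
  assumes "A \<in> carrier_mat n n" "B \<in> carrier_mat n n" "i < n" "j < n"
  shows "(A * B) $$ (i, j) = kernel_prod n (\<lambda>i j. A $$ (i, j)) (\<lambda>i j. B $$ (i, j)) i j"
  using assms by (simp add: kernel_prod_def scalar_prod_def atLeast0LessThan)

lemma kernel_trace_mat_commute:
  assumes "A \<in> carrier_mat n n" "B \<in> carrier_mat n n"
  shows "kernel_trace n (\<lambda>i j. (A * B) $$ (i, j)) = kernel_trace n (\<lambda>i j. (B * A) $$ (i, j))"
proof -
  have "kernel_trace n (\<lambda>i j. (X * Y) $$ (i, j)) = kernel_trace n (kernel_prod n (\<lambda>i j. X $$ (i, j)) (\<lambda>i j. Y $$ (i, j)))"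
    if "X \<in> carrier_mat n n" "Y \<in> carrier_mat n n" for X Y :: "real mat"
    unfolding kernel_trace_def using that by (intro sum.cong refl mat_mult_kernel) auto
  then show ?thesis using assms kernel_trace_prod_commute by simp
qed

lemma mat_pow_kernel:
  assumes A: "A \<in> carrier_mat n n" and K: "\<And>i j. i < n \<Longrightarrow> j < n \<Longrightarrow> A $$ (i, j) = K i j"
  shows "i < n \<Longrightarrow> j < n \<Longrightarrow> (A ^\<^sub>m k) $$ (i, j) = kernel_pow n K k i j"
proof (induction k arbitrary: j)
  case 0
  then show ?case using A by simp
next
  case (Suc k)
  have "A ^\<^sub>m k \<in> carrier_mat n n" using A by simp
  then have "(A ^\<^sub>m Suc k) $$ (i, j) = (\<Sum>l<n. (A ^\<^sub>m k) $$ (i, l) * A $$ (l, j))"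
    using mat_mult_kernel[of "A ^\<^sub>m k" n A i j] Suc.prems A by (simp add: kernel_prod_def)
  also have "\<dots> = kernel_pow n K (Suc k) i j"
    using Suc K by (simp add: kernel_prod_def)
  finally show ?case .
qed

lemma upper_triangular_pow:
  fixes B :: "real mat"
  assumes B: "B \<in> carrier_mat n n" "upper_triangular B"
  shows "(\<forall>i<n. \<forall>j<i. (B ^\<^sub>m k) $$ (i, j) = 0) \<and> (\<forall>i<n. (B ^\<^sub>m k) $$ (i, i) = (B $$ (i, i)) ^ k)"
proof (induction k)
  case 0
  then show ?case using B by auto
next
  case (Suc k)
  have C: "B ^\<^sub>m k \<in> carrier_mat n n" using B by simp
  have ut: "B $$ (i, j) = 0" if "j < i" "i < n" for i j using B that by auto
  have e: "(B ^\<^sub>m Suc k) $$ (i, j) = (\<Sum>l<n. (B ^\<^sub>m k) $$ (i, l) * B $$ (l, j))" if "i < n" "j < n" for i j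
    using mat_mult_kernel[OF C B(1) that] by (simp add: kernel_prod_def)
  show ?case
  proof (intro conjI allI impI)
    fix i j assume ij: "i < n" "j < i"
    have "(B ^\<^sub>m k) $$ (i, l) * B $$ (l, j) = 0" if "l < n" for l
      using Suc ij that ut[of j l] by (cases "l < i") auto
    then have "(\<Sum>l<n. (B ^\<^sub>m k) $$ (i, l) * B $$ (l, j)) = 0" by (intro sum.neutral) auto
    then show "(B ^\<^sub>m Suc k) $$ (i, j) = 0" using ij e[of i j] by simp
  next
    fix i assume i: "i < n"
    have "(B ^\<^sub>m k) $$ (i, l) * B $$ (l, i) = (if l = i then (B $$ (i, i)) ^ Suc k else 0)" if "l < n" for l
      using Suc i that ut[of i l] by (cases l i rule: linorder_cases) auto
    then show "(B ^\<^sub>m Suc k) $$ (i, i) = (B $$ (i, i)) ^ Suc k" using i e[of i i] by simp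
  qed
qed

text \<open>A real factorisation of the characteristic polynomial gives a real Schur form. Powers of
  a triangular matrix have the powers of its diagonal on the diagonal, and the trace is invariant
  under similarity.\<close>

lemma trace_pow_eigenvalues:
  fixes A :: "real mat"
  assumes A: "A \<in> carrier_mat n n" and es: "char_poly A = (\<Prod>a\<leftarrow>es. [:- a, 1:])"
  shows "kernel_trace n (\<lambda>i j. (A ^\<^sub>m k) $$ (i, j)) = (\<Sum>a\<leftarrow>es. a ^ k)"
proof -
  obtain B P Q where s: "schur_decomposition A es = (B, P, Q)" by (cases "schur_decomposition A es") auto
  have sim: "similar_mat_wit A B P Q" and ut: "upper_triangular B" and diag: "diag_mat B = es"
    using schur_decomposition[OF A es s] by auto
  have c: "B \<in> carrier_mat n n" "P \<in> carrier_mat n n" "Q \<in> carrier_mat n n" "Q * P = 1\<^sub>m n"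
    using similar_mat_witD2[OF A sim] by auto
  have Bk: "B ^\<^sub>m k \<in> carrier_mat n n" using c by simp
  have "A ^\<^sub>m k = P * B ^\<^sub>m k * Q"
    using similar_mat_witD2(3)[OF _ similar_mat_wit_pow[OF sim, of k]] A pow_carrier_mat by blast
  then have "kernel_trace n (\<lambda>i j. (A ^\<^sub>m k) $$ (i, j)) = kernel_trace n (\<lambda>i j. (Q * (P * B ^\<^sub>m k)) $$ (i, j))"
    using kernel_trace_mat_commute[of "P * B ^\<^sub>m k" n Q] c Bk by simp
  also have "Q * (P * B ^\<^sub>m k) = B ^\<^sub>m k"
    using c Bk by (simp add: assoc_mult_mat[symmetric, of Q n n P n "B ^\<^sub>m k" n])
  also have "kernel_trace n (\<lambda>i j. (B ^\<^sub>m k) $$ (i, j)) = (\<Sum>i<n. (B $$ (i, i)) ^ k)"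
    using upper_triangular_pow[OF c(1) ut, of k] by (simp add: kernel_trace_def)
  also have "\<dots> = (\<Sum>a\<leftarrow>diag_mat B. a ^ k)"
    using c by (simp add: diag_mat_def comp_def interv_sum_list_conv_sum_set_nat atLeast0LessThan)
  finally show ?thesis unfolding diag .
qed

lemma markov_matrix_entry:
  "i < n \<Longrightarrow> j < n \<Longrightarrow> markov_matrix n u $$ (i, j) = markov_kernel n u i j"
  by (simp add: markov_matrix_def markov_kernel_def markov_row_def)

lemma markov_matrix_carrier [simp]: "markov_matrix n u \<in> carrier_mat n n"
  by (simp add: markov_matrix_def)

lemma markov_matrix_dim [simp]: "dim_row (markov_matrix n u) = n" "dim_col (markov_matrix n u) = n"
  by (simp_all add: markov_matrix_def)

text \<open>The bound follows at a coordinate of the eigenvector of maximal modulus. Reality follows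
  from reversibility: weighted by w, the kernel defines a Hermitian form whose value at the
  eigenvector is lam times a positive number.\<close>

lemma markov_complex_eigenvalue:
  assumes u: "\<And>i j. 0 \<le> u i j" and sym: "\<And>i j. u i j = u j i"
    and ev: "eigenvalue (map_mat complex_of_real (markov_matrix n u)) lam"
  shows "cmod lam \<le> 1" "Im lam = 0"
proof -
  let ?A = "map_mat complex_of_real (markov_matrix n u)"
  let ?K = "markov_kernel n u"
  have cA: "?A \<in> carrier_mat n n" by simp
  obtain v where v: "v \<in> carrier_vec n" "v \<noteq> 0\<^sub>v n" "?A *\<^sub>v v = lam \<cdot>\<^sub>v v"
    using ev cA unfolding eigenvalue_def eigenvector_def by auto
  have eq: "(\<Sum>j<n. complex_of_real (?K i j) * vec_index v j) = lam * vec_index v i" if i: "i < n" for i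
  proof -
    have "vec_index (?A *\<^sub>v v) i = (\<Sum>j<n. complex_of_real (?K i j) * vec_index v j)"
    proof -
      have "vec_index (?A *\<^sub>v v) i = (\<Sum>j<n. ?A $$ (i, j) * vec_index v j)"
      proof -
        have "vec_index (?A *\<^sub>v v) i = (\<Sum>j<n. vec_index (Matrix.row ?A i) j * vec_index v j)"
          using i v(1) by (simp add: scalar_prod_def atLeast0LessThan)
        also have "\<dots> = (\<Sum>j<n. ?A $$ (i, j) * vec_index v j)"
          using i by (intro sum.cong refl) simp
        finally show ?thesis .
      qed
      then show ?thesis using i by (simp add: markov_matrix_entry)
    qed
    then show ?thesis using v i by simp
  qed
  have K: "substochastic n ?K" by (rule substochastic_markov[OF u])
  have "\<exists>i<n. vec_index v i \<noteq> 0"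
  proof (rule ccontr)
    assume "\<not> ?thesis"
    then have "v = 0\<^sub>v n" using v(1) by (intro eq_vecI) auto
    then show False using v by simp
  qed
  then obtain i0 where i0: "i0 < n" "vec_index v i0 \<noteq> 0" by blast
  define m where "m = Max ((\<lambda>i. cmod (vec_index v i)) ` {..<n})"
  have m: "cmod (vec_index v i) \<le> m" if "i < n" for i unfolding m_def using that by (intro Max_ge) auto
  have "m \<in> (\<lambda>i. cmod (vec_index v i)) ` {..<n}" unfolding m_def using i0 by (intro Max_in) auto
  then obtain i1 where i1: "i1 < n" "cmod (vec_index v i1) = m" by auto
  have mpos: "0 < m" using m[OF i0(1)] i0(2) by (metis less_le_trans zero_less_norm_iff)
  have "cmod lam * m = cmod (lam * vec_index v i1)" by (simp add: norm_mult i1)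
  also have "\<dots> = cmod (\<Sum>j<n. complex_of_real (?K i1 j) * vec_index v j)" using eq[OF i1(1)] by simp
  also have "\<dots> \<le> (\<Sum>j<n. cmod (complex_of_real (?K i1 j) * vec_index v j))" by (rule norm_sum)
  also have "\<dots> \<le> (\<Sum>j<n. ?K i1 j * m)"
    using K i1(1) m by (intro sum_mono) (auto simp: norm_mult substochastic_def abs_of_nonneg intro!: mult_left_mono)
  also have "\<dots> = (\<Sum>j<n. ?K i1 j) * m" by (rule sum_distrib_right[symmetric])
  also have "\<dots> \<le> 1 * m" using K i1(1) mpos by (intro mult_right_mono) (auto simp: substochastic_def)
  finally show "cmod lam \<le> 1" using mpos by simp
  let ?r = "\<lambda>i. \<Sum>k<n. u i k"
  \<comment> \<open>Row sums are a reversible measure but may vanish. Replacing 0 by 1 keeps the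
    form positive definite; detailed balance persists because such a row is a row of the identity
    and, by symmetry, its column carries no other weight.\<close>
  let ?w = "\<lambda>i. if ?r i = 0 then 1 else ?r i"
  have w: "0 < ?w i" for i using u sum_nonneg[of "{..<n}" "u i"] by (auto simp: less_le)
  have z: "u i j = 0" if "?r i = 0" "j < n" for i j
    using that u by (simp add: sum_nonneg_eq_0_iff)
  have wK: "?w i * ?K i j = ?w j * ?K j i" if "i < n" "j < n" for i j
    using z[of i j] z[of j i] that sym[of i j]
    by (auto simp: markov_kernel_def markov_row_def Let_def)
  let ?S = "\<Sum>i<n. \<Sum>j<n. complex_of_real (?w i * ?K i j) * (cnj (vec_index v i) * vec_index v j)"
  have S: "?S = lam * complex_of_real (\<Sum>i<n. ?w i * (cmod (vec_index v i))\<^sup>2)"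
  proof -
    have "?S = (\<Sum>i<n. complex_of_real (?w i) * cnj (vec_index v i) * (\<Sum>j<n. complex_of_real (?K i j) * vec_index v j))"
      unfolding sum_distrib_left by (intro sum.cong refl) (simp only: of_real_mult mult_ac)
    also have "\<dots> = (\<Sum>i<n. lam * complex_of_real (?w i * (cmod (vec_index v i))\<^sup>2))"
    proof (intro sum.cong refl)
      fix i assume "i \<in> {..<n}"
      then have "complex_of_real (?w i) * cnj (vec_index v i) * (\<Sum>j<n. complex_of_real (?K i j) * vec_index v j)
        = lam * (complex_of_real (?w i) * (vec_index v i * cnj (vec_index v i)))" using eq[of i] by simp
      then show "complex_of_real (?w i) * cnj (vec_index v i) * (\<Sum>j<n. complex_of_real (?K i j) * vec_index v j)
        = lam * complex_of_real (?w i * (cmod (vec_index v i))\<^sup>2)" by (simp only: complex_norm_square[symmetric] of_real_mult)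
    qed
    finally show ?thesis by (simp only: sum_distrib_left[symmetric] of_real_sum)
  qed
  have "cnj ?S = (\<Sum>i<n. \<Sum>j<n. complex_of_real (?w i * ?K i j) * (vec_index v i * cnj (vec_index v j)))" by simp
  also have "\<dots> = (\<Sum>j<n. \<Sum>i<n. complex_of_real (?w i * ?K i j) * (vec_index v i * cnj (vec_index v j)))" by (rule sum.swap)
  also have "\<dots> = ?S" using wK by (intro sum.cong refl) (auto simp only: mult.commute lessThan_iff)
  finally have "cnj ?S = ?S" .
  moreover have "Im z = 0" if "cnj z = z" for z using that by (simp add: complex_eq_iff)
  ultimately have "Im ?S = 0" by blast
  moreover have "0 < (\<Sum>i<n. ?w i * (cmod (vec_index v i))\<^sup>2)"
  proof (rule sum_pos2)
    show "0 < ?w i0 * (cmod (vec_index v i0))\<^sup>2" using i0 by (intro mult_pos_pos w) simp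
    show "0 \<le> ?w i * (cmod (vec_index v i))\<^sup>2" for i by (intro mult_nonneg_nonneg less_imp_le[OF w]) simp
  qed (use i0 in auto)
  ultimately show "Im lam = 0" unfolding S by simp
qed

text \<open>The characteristic polynomial is factored over the complex numbers; as its roots are
  real, the factorisation descends to the reals, and the list of eigenvalues is complete.\<close>

lemma markov_eigenvalues:
  assumes u: "\<And>i j. 0 \<le> u i j" and sym: "\<And>i j. u i j = u j i"
  shows "length (eigenvalues (markov_matrix n u)) = n"
    and "\<And>a. a \<in> set (eigenvalues (markov_matrix n u)) \<Longrightarrow> \<bar>a\<bar> \<le> 1"
    and "(\<Sum>i<n. eigenvalues (markov_matrix n u) ! i ^ k) = kernel_trace n (kernel_pow n (markov_kernel n u) k)"
proof -
  let ?A = "markov_matrix n u"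
  let ?B = "map_mat complex_of_real ?A"
  have cB: "?B \<in> carrier_mat n n" by simp
  obtain as where as: "char_poly ?B = (\<Prod>a\<leftarrow>as. [:- a, 1:])" "length as = n"
    using char_poly_factorized[OF cB] by blast
  have ev: "Im a = 0 \<and> cmod a \<le> 1" if "a \<in> set as" for a
  proof -
    have "poly (char_poly ?B) a = 0" unfolding as(1) using that by (auto simp: poly_prod_list prod_list_zero_iff)
    then have "eigenvalue ?B a" using eigenvalue_root_char_poly[OF cB] by simp
    then show ?thesis using markov_complex_eigenvalue[of u n a] u sym by blast
  qed
  define es where "es = map Re as"
  have as_es: "as = map complex_of_real es"
    unfolding es_def map_map using ev by (intro map_idI[symmetric]) (simp add: complex_eq_iff)
  have "map_poly complex_of_real (char_poly ?A) = map_poly complex_of_real (\<Prod>a\<leftarrow>es. [:- a, 1:])"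
  proof -
    have "map_poly complex_of_real (char_poly ?A) = char_poly ?B"
      by (rule of_real_hom.char_poly_hom[symmetric, OF markov_matrix_carrier])
    also have "\<dots> = map_poly complex_of_real (\<Prod>a\<leftarrow>es. [:- a, 1:])"
      unfolding as(1) as_es
    proof (induction es)
      case (Cons a es)
      have mult: "map_poly complex_of_real (p * q) = map_poly complex_of_real p * map_poly complex_of_real q" for p q
        by (rule poly_eqI) (simp add: coeff_map_poly coeff_mult)
      have "map_poly complex_of_real [:- a, 1:] = [:- complex_of_real a, 1:]" by (simp add: map_poly_pCons)
      then show ?case using Cons by (simp only: list.map prod_list.Cons mult)
    qed simp
    finally show ?thesis .
  qed
  then have cp: "char_poly ?A = (\<Prod>a\<leftarrow>es. [:- a, 1:])"
    by (simp add: poly_eq_iff coeff_map_poly)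
  have roots: "proots (char_poly ?A) = mset es"
    unfolding cp
  proof (induction es)
    case (Cons a es)
    have "(\<Prod>a\<leftarrow>es. [:- a, 1:]) \<noteq> 0" by (auto simp: prod_list_zero_iff)
    then show ?case using Cons by (simp only: list.map prod_list.Cons) (subst proots_mult, auto)
  qed simp
  then have E: "mset (eigenvalues ?A) = mset es"
    by (simp add: eigenvalues_def)
  then show len: "length (eigenvalues ?A) = n"
    using as(2) by (metis es_def length_map size_mset)
  show "\<bar>a\<bar> \<le> 1" if "a \<in> set (eigenvalues ?A)" for a
  proof -
    have "a \<in> set es" using E that by (metis set_mset_mset)
    then obtain b where "b \<in> set as" "a = Re b" by (auto simp: es_def)
    then show ?thesis using ev[of b] abs_Re_le_cmod[of b] by simp
  qed
  have "(\<Sum>i<n. eigenvalues ?A ! i ^ k) = (\<Sum>a\<leftarrow>eigenvalues ?A. a ^ k)"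
    using len by (simp add: sum_list_sum_nth atLeast0LessThan)
  also have "\<dots> = (\<Sum>a\<in>#mset (eigenvalues ?A). a ^ k)" by (simp flip: sum_mset_sum_list)
  also have "\<dots> = (\<Sum>a\<leftarrow>es. a ^ k)" unfolding E by (simp flip: sum_mset_sum_list)
  also have "\<dots> = kernel_trace n (\<lambda>i j. (?A ^\<^sub>m k) $$ (i, j))"
    by (rule trace_pow_eigenvalues[OF markov_matrix_carrier cp, symmetric])
  also have "\<dots> = kernel_trace n (kernel_pow n (markov_kernel n u) k)"
    unfolding kernel_trace_def
    by (intro sum.cong refl mat_pow_kernel[OF markov_matrix_carrier markov_matrix_entry]) auto
  finally show "(\<Sum>i<n. eigenvalues ?A ! i ^ k) = kernel_trace n (kernel_pow n (markov_kernel n u) k)" .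
qed

section \<open>Convergence of the spectra\<close>

lemma measurable_uniform_count:
  "g \<in> measurable (uniform_count_measure I) N \<longleftrightarrow> g \<in> I \<rightarrow> space N"
  by (simp add: uniform_count_measure_def point_measure_def)

lemma empirical_spectral_integral:
  fixes f :: "real \<Rightarrow> real"
  assumes [measurable]: "f \<in> borel_measurable borel"
  shows "(\<integral>x. f x \<partial>empirical_spectral_distribution A) = (\<Sum>i<dim_row A. f (eigenvalues A ! i)) / real (dim_row A)"
proof -
  have "(\<integral>x. f x \<partial>empirical_spectral_distribution A) = (\<integral>i. f (eigenvalues A ! i) \<partial>uniform_count_measure {..<dim_row A})"
    unfolding empirical_spectral_distribution_def
    by (rule integral_distr) (auto simp: measurable_uniform_count)
  then show ?thesis by (simp add: integral_uniform_count_measure)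
qed

lemma real_distribution_empirical:
  assumes "0 < dim_row A"
  shows "real_distribution (empirical_spectral_distribution A)"
proof -
  have "{..<dim_row A} \<noteq> {}" using assms by auto
  then interpret prob_space "uniform_count_measure {..<dim_row A}"
    by (intro prob_space_uniform_count_measure) auto
  have "(\<lambda>k. eigenvalues A ! k) \<in> measurable (uniform_count_measure {..<dim_row A}) borel"
    by (auto simp: measurable_uniform_count)
  then show ?thesis
    unfolding empirical_spectral_distribution_def by (intro real_distribution_distr) auto
qed

lemma AE_empirical_bounded:
  assumes u: "\<And>i j. 0 \<le> u i j" and sym: "\<And>i j. u i j = u j i"
  shows "AE x in empirical_spectral_distribution (markov_matrix n u). \<bar>x\<bar> \<le> 1"
proof -
  have "(\<lambda>k. eigenvalues (markov_matrix n u) ! k) \<in> measurable (uniform_count_measure {..<n}) borel"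
    by (auto simp: measurable_uniform_count)
  moreover have "AE k in uniform_count_measure {..<n}. \<bar>eigenvalues (markov_matrix n u) ! k\<bar> \<le> 1"
  proof (rule AE_I2)
    fix k assume "k \<in> space (uniform_count_measure {..<n})"
    then have "k < length (eigenvalues (markov_matrix n u))"
      using markov_eigenvalues(1)[of u n] u sym by (simp add: space_uniform_count_measure)
    then show "\<bar>eigenvalues (markov_matrix n u) ! k\<bar> \<le> 1"
      using markov_eigenvalues(2)[of u _ n] u sym nth_mem by blast
  qed
  ultimately show ?thesis
    unfolding empirical_spectral_distribution_def markov_matrix_dim by (subst AE_distr_iff) auto
qed

text \<open>On measures carried by the compact interval from -1 to 1, convergence of moments is weak
  convergence by the Weierstrass approximation theorem.\<close>

lemma moments_imp_weak_convergence:
  fixes f :: "real \<Rightarrow> real"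
  assumes \<nu>: "\<And>n. real_distribution (\<nu> n)" "\<And>n. AE x in \<nu> n. \<bar>x\<bar> \<le> 1"
    and \<mu>: "real_distribution \<mu>" "AE x in \<mu>. \<bar>x\<bar> \<le> 1"
    and mom: "\<And>k. 0 < k \<Longrightarrow> (\<lambda>n. \<integral>x. x ^ k \<partial>\<nu> n) \<longlonglongrightarrow> (\<integral>x. x ^ k \<partial>\<mu>)"
    and f: "continuous_on UNIV f" "bounded (range f)"
  shows "(\<lambda>n. \<integral>x. f x \<partial>\<nu> n) \<longlonglongrightarrow> (\<integral>x. f x \<partial>\<mu>)"
proof (rule tendstoI)
  fix e :: real assume e: "0 < e"
  have "continuous_on {-1..1} f" using f(1) by (rule continuous_on_subset) simp
  then obtain g where g: "real_polynomial_function g" "\<And>x. x \<in> {-1..1} \<Longrightarrow> \<bar>f x - g x\<bar> < e / 4"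
    using Stone_Weierstrass_real_polynomial_function[of "{-1..1}" f "e / 4"] e by auto
  then obtain a m where g_eq: "g = (\<lambda>x. \<Sum>k\<le>m. a k * x ^ k)"
    unfolding real_polynomial_function_iff_sum by blast
  obtain B where B: "\<And>x. \<bar>f x\<bar> \<le> B" using f(2) by (auto simp: bounded_iff)
  have fm: "f \<in> borel_measurable borel" using f(1) by (rule borel_measurable_continuous_onI)
  have gm: "g \<in> borel_measurable borel" unfolding g_eq by measurable
  have pw: "integrable M (\<lambda>x. x ^ k)" if M: "real_distribution M" "AE x in M. \<bar>x\<bar> \<le> 1" for M k
  proof -
    interpret real_distribution M by fact
    show ?thesis
      by (rule integrable_const_bound[of _ 1])
        (use M(2) in \<open>auto elim!: eventually_mono simp: power_abs power_le_one\<close>)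
  qed
  have gI: "integrable M g" "(\<integral>x. g x \<partial>M) = (\<Sum>k\<le>m. a k * (\<integral>x. x ^ k \<partial>M))"
    if M: "real_distribution M" "AE x in M. \<bar>x\<bar> \<le> 1" for M
    unfolding g_eq using pw[OF M] by (simp_all add: Bochner_Integration.integral_sum)
  have close: "\<bar>(\<integral>x. f x \<partial>M) - (\<integral>x. g x \<partial>M)\<bar> \<le> e / 4" if M: "real_distribution M" "AE x in M. \<bar>x\<bar> \<le> 1" for M
  proof -
    interpret real_distribution M by fact
    have fI: "integrable M f"
      using fm B by (intro integrable_const_bound[of _ B]) auto
    have "\<bar>(\<integral>x. f x \<partial>M) - (\<integral>x. g x \<partial>M)\<bar> = \<bar>\<integral>x. f x - g x \<partial>M\<bar>"
      using fI gI(1)[OF M] by simp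
    also have "\<dots> \<le> (\<integral>x. \<bar>f x - g x\<bar> \<partial>M)" by (rule integral_abs_bound)
    also have "\<dots> \<le> (\<integral>x. e / 4 \<partial>M)"
    proof (rule integral_mono_AE)
      show "AE x in M. \<bar>f x - g x\<bar> \<le> e / 4"
        using M(2) by eventually_elim (use g(2) in \<open>force simp: abs_le_iff intro: less_imp_le\<close>)
    qed (use fI gI(1)[OF M] in auto)
    also have "\<dots> = e / 4" using prob_space by simp
    finally show ?thesis .
  qed
  have "(\<lambda>n. \<Sum>k\<le>m. a k * (\<integral>x. x ^ k \<partial>\<nu> n)) \<longlonglongrightarrow> (\<Sum>k\<le>m. a k * (\<integral>x. x ^ k \<partial>\<mu>))"
  proof (intro tendsto_sum tendsto_mult_left)
    fix k
    show "(\<lambda>n. \<integral>x. x ^ k \<partial>\<nu> n) \<longlonglongrightarrow> (\<integral>x. x ^ k \<partial>\<mu>)"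
    proof (cases "k = 0")
      case True
      have "(\<integral>x. x ^ k \<partial>M) = 1" if "real_distribution M" for M
      proof -
        interpret real_distribution M by fact
        show ?thesis using True prob_space by simp
      qed
      then show ?thesis using \<nu>(1) \<mu>(1) by simp
    qed (use mom in auto)
  qed
  then have "(\<lambda>n. \<integral>x. g x \<partial>\<nu> n) \<longlonglongrightarrow> (\<integral>x. g x \<partial>\<mu>)"
    using gI(2)[OF \<nu>] gI(2)[OF \<mu>] by simp
  then have "\<forall>\<^sub>F n in sequentially. \<bar>(\<integral>x. g x \<partial>\<nu> n) - (\<integral>x. g x \<partial>\<mu>)\<bar> < e / 4"
  proof -
    assume "(\<lambda>n. \<integral>x. g x \<partial>\<nu> n) \<longlonglongrightarrow> (\<integral>x. g x \<partial>\<mu>)"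
    from tendstoD[OF this, of "e / 4"] e show ?thesis by (simp add: dist_real_def)
  qed
  then show "\<forall>\<^sub>F n in sequentially. dist (\<integral>x. f x \<partial>\<nu> n) (\<integral>x. f x \<partial>\<mu>) < e"
  proof eventually_elim
    case (elim n)
    then show ?case using close[OF \<nu>, of n] close[OF \<mu>] e unfolding dist_real_def by linarith
  qed
qed

text \<open>Cosine and sine are admissible test functions, so the characteristic functions
  agree.\<close>

lemma weak_limits_unique:
  assumes "real_distribution \<mu>" "real_distribution \<nu>"
    and eq: "\<And>f :: real \<Rightarrow> real. continuous_on UNIV f \<Longrightarrow> bounded (range f) \<Longrightarrow> (\<integral>x. f x \<partial>\<mu>) = (\<integral>x. f x \<partial>\<nu>)"
  shows "\<mu> = \<nu>"
proof (rule Levy_uniqueness[OF assms(1,2)])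
  have char: "char M t = complex_of_real (\<integral>x. cos (t * x) \<partial>M) + \<i> * complex_of_real (\<integral>x. sin (t * x) \<partial>M)"
    if "real_distribution M" for M t
  proof -
    interpret real_distribution M by fact
    have i: "integrable M (\<lambda>x. cos (t * x))" "integrable M (\<lambda>x. sin (t * x))"
      by (intro integrable_const_bound[of _ 1]; simp)+
    have "char M t = (\<integral>x. complex_of_real (cos (t * x)) + \<i> * complex_of_real (sin (t * x)) \<partial>M)"
      unfolding char_def by (simp add: exp_Euler cos_of_real sin_of_real mult.commute flip: of_real_mult)
    then show ?thesis using i by simp
  qed
  have "(\<integral>x. cos (t * x) \<partial>\<mu>) = (\<integral>x. cos (t * x) \<partial>\<nu>)" "(\<integral>x. sin (t * x) \<partial>\<mu>) = (\<integral>x. sin (t * x) \<partial>\<nu>)" for t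
    by (intro eq continuous_intros; auto simp: bounded_iff intro!: exI[of _ 1])+
  then show "char \<mu> = char \<nu>"
    using char[OF assms(1)] char[OF assms(2)] by (simp add: fun_eq_iff)
qed

lemma kernel_pow_cong:
  assumes "\<And>i j. i < n \<Longrightarrow> j < n \<Longrightarrow> A i j = B i j"
  shows "i < n \<Longrightarrow> j < n \<Longrightarrow> kernel_pow n A l i j = kernel_pow n B l i j"
  by (induction l arbitrary: j) (simp_all add: kernel_prod_def assms)

context heavy_tail
begin

text \<open>The fourth central moments are of order n^(-2), hence summable. So the series of fourth
  powers of the deviations has finite mean and converges almost surely, and its terms tend to
  0.\<close>

lemma AE_spectral_moment_tendsto:
  assumes iid: "iid_weights M D U" and k: "0 < k"
  shows "AE \<omega> in M. (\<lambda>n. spectral_moment n k (\<lambda>(i, j). U i j \<omega>)) \<longlonglongrightarrow> limit_moment k"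
proof -
  interpret M: prob_space M using iid by (simp add: iid_weights_def)
  let ?X = "\<lambda>(i, j). U i j"
  have indep: "M.indep_vars (\<lambda>_. borel) ?X {(i, j). i \<le> j}"
    and distr: "\<And>e. e \<in> {(i, j). i \<le> j} \<Longrightarrow> distr M borel (?X e) = D"
    using iid by (auto simp: iid_weights_def)
  have rv: "?X e \<in> borel_measurable M" if "e \<in> {(i, j). i \<le> j}" for e
    using indep that unfolding M.indep_vars_def2 by blast
  let ?Q = "\<lambda>n. PiM (upper_pairs n) (\<lambda>_. D)"
  let ?R = "\<lambda>n \<omega>. \<lambda>e\<in>upper_pairs n. ?X e \<omega>"
  let ?m = "\<lambda>n. \<integral>x. spectral_moment n k x \<partial>?Q n"
  let ?Y = "\<lambda>n \<omega>. spectral_moment n k (\<lambda>(i, j). U i j \<omega>)"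
  have up: "upper_pairs n \<subseteq> {(i, j). i \<le> j}" for n by (auto simp: upper_pairs_def)
  have rvD: "?X e \<in> measurable M D" if "e \<in> upper_pairs n" for e n
    using rv[OF subsetD[OF up that]] by (subst measurable_cong_sets[OF refl D.events_eq_borel])
  have R_meas: "?R n \<in> measurable M (?Q n)" for n
    by (intro measurable_restrict rvD)
  have tw: "table_weight (?R n \<omega>) i j = table_weight (\<lambda>(i, j). U i j \<omega>) i j" if "i < n" "j < n" for n \<omega> i j
    using sorted_pair_upper[OF that] by (auto simp: table_weight_def split: prod.split)
  have Y_eq: "?Y n \<omega> = spectral_moment n k (?R n \<omega>)" for n \<omega>
  proof -
    have K: "markov_kernel n (table_weight (?R n \<omega>)) i j = markov_kernel n (table_weight (\<lambda>(i, j). U i j \<omega>)) i j"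
      if "i < n" "j < n" for i j
      unfolding markov_kernel_def using that by (intro markov_row_cong tw) auto
    then have "kernel_trace n (kernel_pow n (markov_kernel n (table_weight (?R n \<omega>))) k)
        = kernel_trace n (kernel_pow n (markov_kernel n (table_weight (\<lambda>(i, j). U i j \<omega>))) k)"
      unfolding kernel_trace_def by (intro sum.cong refl kernel_pow_cong) auto
    then show ?thesis unfolding spectral_moment_def by simp
  qed
  \<comment> \<open>Only the finitely many pairs below n enter the matrix; their joint law is the
    product over which means and concentration were computed.\<close>
  have dist_R: "distr M (?Q n) (?R n) = ?Q n" if n: "0 < n" for n
  proof -
    have ne: "upper_pairs n \<noteq> {}" using n by (auto simp: upper_pairs_def)
    have "distr M (PiM (upper_pairs n) (\<lambda>_. borel)) (?R n) = PiM (upper_pairs n) (\<lambda>e. distr M borel (?X e))"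
      by (rule iffD1[OF M.indep_vars_iff_distr_eq_PiM'[OF ne rv[OF subsetD[OF up]]] M.indep_vars_subset[OF indep up]])
    also have "\<dots> = ?Q n" by (intro PiM_cong refl distr subsetD[OF up])
    also have "distr M (PiM (upper_pairs n) (\<lambda>_. borel)) (?R n) = distr M (?Q n) (?R n)"
      by (intro distr_cong refl sets_PiM_cong) simp
    finally show ?thesis .
  qed
  have bound: "(\<integral>\<^sup>+\<omega>. ennreal ((?Y n \<omega> - ?m n) ^ 4) \<partial>M) \<le> ennreal (11 * (16 * (real k)\<^sup>2 / real n)\<^sup>2)" if n: "0 < n" for n
  proof -
    interpret Q: prob_space "?Q n" by (intro prob_space_PiM D.prob_space_axioms)
    have sm [measurable]: "spectral_moment n k \<in> borel_measurable (?Q n)"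
      by (rule spectral_moment_measurable) simp
    have "\<bar>?m n\<bar> \<le> 1" by (rule Q.abs_integral_le_bound[OF sm spectral_moment_bounded])
    then have b2: "\<bar>spectral_moment n k x - ?m n\<bar> \<le> 2" for x
      using spectral_moment_bounded[of n k x] by linarith
    have int: "integrable (?Q n) (\<lambda>x. (spectral_moment n k x - ?m n) ^ 4)"
    proof (rule Q.bounded_integrable)
      fix x
      have "\<bar>spectral_moment n k x - ?m n\<bar> ^ 4 \<le> 2 ^ 4" by (rule power_mono[OF b2]) simp
      then show "\<bar>(spectral_moment n k x - ?m n) ^ 4\<bar> \<le> 2 ^ 4" by (simp only: power_abs)
    qed measurable
    have "(\<integral>\<^sup>+\<omega>. ennreal ((?Y n \<omega> - ?m n) ^ 4) \<partial>M) = (\<integral>\<^sup>+x. ennreal ((spectral_moment n k x - ?m n) ^ 4) \<partial>distr M (?Q n) (?R n))"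
      unfolding Y_eq by (rule nn_integral_distr[OF R_meas, symmetric]) measurable
    also have "\<dots> = ennreal (\<integral>x. (spectral_moment n k x - ?m n) ^ 4 \<partial>?Q n)"
      unfolding dist_R[OF n] using int by (intro nn_integral_eq_integral) auto
    also have "\<dots> \<le> ennreal (11 * (16 * (real k)\<^sup>2 / real n)\<^sup>2)"
      by (intro ennreal_leI spectral_moment_concentration D.real_distribution_axioms)
    finally show ?thesis .
  qed
  have Y_meas [measurable]: "?Y n \<in> borel_measurable M" for n
  proof -
    have "spectral_moment n k \<in> borel_measurable (?Q n)" by (rule spectral_moment_measurable) simp
    then show ?thesis unfolding Y_eq[abs_def] by (rule measurable_compose[OF R_meas])
  qed
  let ?Z = "\<lambda>n \<omega>. (?Y (Suc n) \<omega> - ?m (Suc n)) ^ 4"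
  have summ: "summable (\<lambda>n. 11 * (16 * (real k)\<^sup>2 / real (Suc n))\<^sup>2)"
  proof -
    have "summable (\<lambda>n. inverse (real n ^ 2))" by (rule inverse_power_summable) simp
    then have "summable (\<lambda>n. 11 * (16 * (real k)\<^sup>2)\<^sup>2 * inverse (real (Suc n) ^ 2))"
      by (intro summable_mult) (subst summable_Suc_iff)
    moreover have "11 * (a / r)\<^sup>2 = 11 * a\<^sup>2 * inverse (r ^ 2)" for a r :: real
      by (simp add: power_mult_distrib power_inverse divide_inverse)
    ultimately show ?thesis by (simp only:)
  qed
  have "(\<integral>\<^sup>+\<omega>. (\<Sum>n. ennreal (?Z n \<omega>)) \<partial>M) = (\<Sum>n. \<integral>\<^sup>+\<omega>. ennreal (?Z n \<omega>) \<partial>M)"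
    by (rule nn_integral_suminf) measurable
  also have "\<dots> \<le> (\<Sum>n. ennreal (11 * (16 * (real k)\<^sup>2 / real (Suc n))\<^sup>2))"
    by (intro suminf_le bound) auto
  also have "\<dots> < \<infinity>"
  proof -
    have "(\<Sum>n. ennreal (11 * (16 * (real k)\<^sup>2 / real (Suc n))\<^sup>2)) = ennreal (\<Sum>n. 11 * (16 * (real k)\<^sup>2 / real (Suc n))\<^sup>2)"
      by (rule suminf_ennreal2[OF _ summ]) simp
    then show ?thesis by (simp only: infinity_ennreal_def ennreal_less_top)
  qed
  finally have fin: "(\<integral>\<^sup>+\<omega>. (\<Sum>n. ennreal (?Z n \<omega>)) \<partial>M) \<noteq> \<infinity>" by simp
  have "AE \<omega> in M. (\<Sum>n. ennreal (?Z n \<omega>)) \<noteq> \<infinity>"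
    by (rule nn_integral_PInf_AE[OF _ fin]) measurable
  then show ?thesis
  proof eventually_elim
    case (elim \<omega>)
    have "summable (\<lambda>n. ?Z n \<omega>)"
      by (rule summable_suminf_not_top) (use elim in auto)
    then have "(\<lambda>n. ?Z n \<omega>) \<longlonglongrightarrow> 0" by (rule summable_LIMSEQ_zero)
    then have "(\<lambda>n. root 4 (?Z n \<omega>)) \<longlonglongrightarrow> root 4 0" by (rule tendsto_real_root)
    then have "(\<lambda>n. \<bar>?Y (Suc n) \<omega> - ?m (Suc n)\<bar>) \<longlonglongrightarrow> 0"
    proof -
      have "root 4 (z ^ 4) = \<bar>z\<bar>" for z :: real
      proof -
        have "\<bar>z ^ 4\<bar> = z ^ 4" by (simp add: power_abs)
        then show ?thesis using root_abs_power[of 4 z] by simp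
      qed
      moreover assume "(\<lambda>n. root 4 (?Z n \<omega>)) \<longlonglongrightarrow> root 4 0"
      ultimately show ?thesis by (simp only: real_root_zero)
    qed
    then have "(\<lambda>n. ?Y (Suc n) \<omega> - ?m (Suc n)) \<longlonglongrightarrow> 0" by (rule tendsto_rabs_zero_cancel)
    moreover have "(\<lambda>n. ?m (Suc n)) \<longlonglongrightarrow> limit_moment k"
      using mean_spectral_moment_tendsto[OF k] by (rule LIMSEQ_Suc)
    ultimately have "(\<lambda>n. (?Y (Suc n) \<omega> - ?m (Suc n)) + ?m (Suc n)) \<longlonglongrightarrow> 0 + limit_moment k"
      by (rule tendsto_add)
    then have "(\<lambda>n. ?Y (Suc n) \<omega>) \<longlonglongrightarrow> limit_moment k" by simp
    then show ?case by (rule LIMSEQ_imp_Suc)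
  qed
qed

end

lemma iid_canonical_weights:
  assumes D: "real_distribution D"
  shows "iid_weights (canonical_space D) D canonical_weights"
proof -
  interpret D: real_distribution D by fact
  let ?I = "{(i, j). i \<le> j} :: (nat \<times> nat) set"
  let ?P = "PiM ?I (\<lambda>_. D)"
  interpret P: prob_space ?P by (intro prob_space_PiM D.prob_space_axioms)
  let ?X = "\<lambda>(i, j). canonical_weights i j"
  have X: "?X e = (\<lambda>x. x e)" if "e \<in> ?I" for e
    using that by (auto simp: canonical_weights_def fun_eq_iff)
  have coord: "(\<lambda>x. x e) \<in> measurable ?P D" if "e \<in> ?I" for e
    using that by (rule measurable_component_singleton)
  have rv: "?X e \<in> borel_measurable ?P" if "e \<in> ?I" for e
    using coord[OF that] unfolding X[OF that] by (subst (asm) measurable_cong_sets[OF refl D.events_eq_borel])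
  have distr: "distr ?P borel (?X e) = D" if "e \<in> ?I" for e
  proof -
    have "distr ?P borel (?X e) = distr ?P D (\<lambda>x. x e)"
      unfolding X[OF that] by (intro distr_cong refl) simp
    also have "\<dots> = D" using that by (intro distr_PiM_component D.prob_space_axioms)
    finally show ?thesis .
  qed
  have "P.indep_vars (\<lambda>_. borel) ?X ?I"
  proof (rule iffD2[OF P.indep_vars_iff_distr_eq_PiM'[OF _ rv]])
    have "distr ?P (PiM ?I (\<lambda>_. borel)) (\<lambda>x. \<lambda>e\<in>?I. ?X e x) = distr ?P ?P (\<lambda>x. x)"
    proof (rule distr_cong[OF refl])
      show "sets (PiM ?I (\<lambda>_. borel :: real measure)) = sets ?P" by (intro sets_PiM_cong refl) simp
      fix x assume "x \<in> space ?P"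
      then have "x \<in> extensional ?I" by (auto simp: space_PiM PiE_iff)
      then show "(\<lambda>e\<in>?I. ?X e x) = x"
        by (auto simp: fun_eq_iff X extensional_def canonical_weights_def)
    qed
    also have "\<dots> = ?P" by (rule distr_id)
    also have "\<dots> = PiM ?I (\<lambda>e. distr ?P borel (?X e))" by (intro PiM_cong refl distr[symmetric])
    finally show "distr ?P (PiM ?I (\<lambda>_. borel)) (\<lambda>x. \<lambda>e\<in>?I. ?X e x) = PiM ?I (\<lambda>e. distr ?P borel (?X e))" .
  qed auto
  then show ?thesis
    unfolding iid_weights_def canonical_space_def
    using P.prob_space_axioms distr by (auto simp: canonical_weights_def min.commute max.commute)
qed

lemma empirical_moment:
  assumes u: "\<And>i j. 0 \<le> u i j" and sym: "\<And>i j. u i j = u j i"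
  shows "(\<integral>x. x ^ k \<partial>empirical_spectral_distribution (markov_matrix n u)) = spectral_moment n k (\<lambda>(i, j). u i j)"
proof -
  have "table_weight (\<lambda>(i, j). u i j) i j = u i j" for i j
    using u sym[of i j] by (auto simp: table_weight_def sorted_pair_def min_def max_def)
  then have "table_weight (\<lambda>(i, j). u i j) = u" by (intro ext)
  then show ?thesis
    using markov_eigenvalues(3)[of u n k] u sym
    by (simp add: empirical_spectral_integral spectral_moment_def)
qed

context heavy_tail
begin

lemma AE_weights_nonneg:
  assumes iid: "iid_weights M D U"
  shows "AE \<omega> in M. \<forall>i j. 0 \<le> U i j \<omega>"
proof -
  interpret M: prob_space M using iid by (simp add: iid_weights_def)
  have le: "AE \<omega> in M. 0 \<le> U i j \<omega>" if "i \<le> j" for i j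
  proof -
    have "U i j \<in> borel_measurable M"
      using iid that unfolding iid_weights_def M.indep_vars_def2 by auto
    moreover have "distr M borel (U i j) = D" using iid that by (simp add: iid_weights_def)
    moreover from this AE_nonneg have "AE u in distr M borel (U i j). 0 \<le> u" by (simp only:)
    ultimately show ?thesis by (intro AE_distrD[of "U i j" M borel])
  qed
  have "AE \<omega> in M. 0 \<le> U i j \<omega>" for i j
  proof (cases "i \<le> j")
    case False
    then have "AE \<omega> in M. 0 \<le> U j i \<omega>" by (intro le) simp
    moreover have "AE \<omega> in M. \<omega> \<in> space M" by simp
    ultimately show ?thesis
    proof eventually_elim
      case (elim \<omega>)
      then show ?case using iid unfolding iid_weights_def by metis
    qed
  qed (rule le)
  then show ?thesis by (simp add: AE_all_countable)
qed

lemma AE_moments: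
  assumes iid: "iid_weights M D U"
  shows "AE \<omega> in M. (\<forall>i j. 0 \<le> U i j \<omega>) \<and> (\<forall>i j. U i j \<omega> = U j i \<omega>) \<and>
    (\<forall>k>0. (\<lambda>n. \<integral>x. x ^ k \<partial>empirical_spectral_distribution (markov_matrix n (\<lambda>i j. U i j \<omega>))) \<longlonglongrightarrow> limit_moment k)"
proof -
  have "AE \<omega> in M. \<forall>k>0. (\<lambda>n. spectral_moment n k (\<lambda>(i, j). U i j \<omega>)) \<longlonglongrightarrow> limit_moment k"
    using AE_spectral_moment_tendsto[OF iid] by (subst AE_all_countable) auto
  moreover have "AE \<omega> in M. \<forall>i j. 0 \<le> U i j \<omega>" by (rule AE_weights_nonneg[OF iid])
  moreover have "AE \<omega> in M. \<omega> \<in> space M" by simp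
  ultimately show ?thesis
  proof eventually_elim
    case (elim \<omega>)
    have sym: "U i j \<omega> = U j i \<omega>" for i j using iid elim(3) unfolding iid_weights_def by metis
    have nn: "0 \<le> U i j \<omega>" for i j using elim(2) by blast
    have "(\<integral>x. x ^ k \<partial>empirical_spectral_distribution (markov_matrix n (\<lambda>i j. U i j \<omega>))) = spectral_moment n k (\<lambda>(i, j). U i j \<omega>)" for n k
      by (rule empirical_moment) (rule nn, rule sym)
    then show ?case using elim(1) nn sym by simp
  qed
qed

lemma spectra_converge:
  assumes iid: "iid_weights M D U"
    and \<mu>: "real_distribution \<mu>" "AE x in \<mu>. \<bar>x\<bar> \<le> 1" "\<And>k. 0 < k \<Longrightarrow> (\<integral>x. x ^ k \<partial>\<mu>) = limit_moment k"
  shows "spectra_converge_as M U \<mu>"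
  unfolding spectra_converge_as_def
  using AE_moments[OF iid]
proof eventually_elim
  case (elim \<omega>)
  let ?\<nu> = "\<lambda>n. empirical_spectral_distribution (markov_matrix n (\<lambda>i j. U i j \<omega>))"
  show ?case
    unfolding converges_weakly_def
  proof (intro allI impI)
    fix f :: "real \<Rightarrow> real" assume f: "continuous_on UNIV f \<and> bounded (range f)"
    \<comment> \<open>The empirical law of the empty matrix is not a probability, so the sequence
      starts at size 1.\<close>
    have "(\<lambda>n. \<integral>x. f x \<partial>?\<nu> (Suc n)) \<longlonglongrightarrow> (\<integral>x. f x \<partial>\<mu>)"
    proof (rule moments_imp_weak_convergence)
      show "real_distribution (?\<nu> (Suc n))" for n by (rule real_distribution_empirical) simp
      show "AE x in ?\<nu> (Suc n). \<bar>x\<bar> \<le> 1" for n using elim by (intro AE_empirical_bounded) blast+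
      show "(\<lambda>n. \<integral>x. x ^ k \<partial>?\<nu> (Suc n)) \<longlonglongrightarrow> (\<integral>x. x ^ k \<partial>\<mu>)" if "0 < k" for k
        using elim that unfolding \<mu>(3)[OF that] by (intro LIMSEQ_Suc) blast
    qed (use \<mu> f in auto)
    then show "(\<lambda>n. \<integral>x. f x \<partial>?\<nu> n) \<longlonglongrightarrow> (\<integral>x. f x \<partial>\<mu>)" by (rule LIMSEQ_imp_Suc)
  qed
qed

text \<open>That the numbers \<open>limit_moment k\<close> are moments of a law is not shown
  directly. One outcome of the canonical table has spectra in [-1, 1] with converging moments; by
  tightness a subsequence converges weakly, and its limit has these moments.\<close>

lemma limit_law_exists:
  "\<exists>\<mu>. real_distribution \<mu> \<and> (AE x in \<mu>. \<bar>x\<bar> \<le> 1) \<and> (\<forall>k>0. (\<integral>x. x ^ k \<partial>\<mu>) = limit_moment k)"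
proof -
  let ?U = canonical_weights and ?M = "canonical_space D"
  have iid: "iid_weights ?M D ?U" by (rule iid_canonical_weights[OF D.real_distribution_axioms])
  interpret M: prob_space ?M using iid by (simp add: iid_weights_def)
  \<comment> \<open>An almost sure property on a probability space holds for at least one
    outcome.\<close>
  obtain \<omega> where \<omega>: "\<And>i j. 0 \<le> ?U i j \<omega>" "\<And>i j. ?U i j \<omega> = ?U j i \<omega>"
    "\<And>k. 0 < k \<Longrightarrow> (\<lambda>n. \<integral>x. x ^ k \<partial>empirical_spectral_distribution (markov_matrix n (\<lambda>i j. ?U i j \<omega>))) \<longlonglongrightarrow> limit_moment k"
    using M.AE_False eventually_mono[OF AE_moments[OF iid]] eventually_happens[OF AE_moments[OF iid]] M.ae_filter_bot by blast
  define \<nu> where "\<nu> n = empirical_spectral_distribution (markov_matrix (Suc n) (\<lambda>i j. ?U i j \<omega>))" for n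
  have \<nu>: "real_distribution (\<nu> n)" "AE x in \<nu> n. \<bar>x\<bar> \<le> 1" for n
    unfolding \<nu>_def using \<omega>(1,2) by (intro real_distribution_empirical AE_empirical_bounded; simp)+
  have mom: "(\<lambda>n. \<integral>x. x ^ k \<partial>\<nu> n) \<longlonglongrightarrow> limit_moment k" if "0 < k" for k
    unfolding \<nu>_def using \<omega>(3)[OF that] by (rule LIMSEQ_Suc)
  have "tight \<nu>"
    unfolding tight_def
  proof (intro conjI allI impI)
    fix e :: real assume e: "0 < e"
    have "1 - e < measure (\<nu> n) {-2<..1}" for n
    proof -
      interpret n: real_distribution "\<nu> n" by (rule \<nu>)
      \<comment> \<open>Tightness is stated with intervals open on the left, so the left end must
        lie below -1.\<close>
      have "AE x in \<nu> n. x \<in> {-2<..1}" using \<nu>(2)[of n] by eventually_elim auto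
      then have "n.prob {-2<..1} = 1" by (subst n.prob_eq_1) auto
      then show ?thesis using e by simp
    qed
    then show "\<exists>a b. a < b \<and> (\<forall>n. 1 - e < measure (\<nu> n) {a<..b})"
      by (intro exI[where x = "- 2"] exI[where x = 1]) simp
  qed (rule \<nu>)
  then obtain r \<mu> where r: "strict_mono (r :: nat \<Rightarrow> nat)" and \<mu>: "real_distribution \<mu>" and conv: "weak_conv_m (\<nu> \<circ> id \<circ> r) \<mu>"
    using tight_imp_convergent_subsubsequence[of \<nu> id] strict_mono_id by blast
  interpret \<mu>: real_distribution \<mu> by fact
  have lim: "(\<lambda>n. \<integral>x. f x \<partial>\<nu> (r n)) \<longlonglongrightarrow> (\<integral>x. f x \<partial>\<mu>)"
    if "continuous_on UNIV f" "\<And>x. norm (f x) \<le> B" for f :: "real \<Rightarrow> real" and B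
    using weak_conv_imp_integral_bdd_continuous_conv[OF _ \<mu> conv, of f B] that \<nu>(1)
    by (simp add: continuous_on_eq_continuous_at)
  have supp: "AE x in \<mu>. \<bar>x\<bar> \<le> 1"
  proof -
    \<comment> \<open>A bounded continuous function that vanishes exactly on [-1, 1], so its
      integral detects mass outside.\<close>
    let ?f = "\<lambda>x::real. min 1 (max 0 (\<bar>x\<bar> - 1))"
    have "norm (?f x) \<le> 1" for x by simp
    then have "(\<lambda>n. \<integral>x. ?f x \<partial>\<nu> (r n)) \<longlonglongrightarrow> (\<integral>x. ?f x \<partial>\<mu>)"
      by (intro lim continuous_intros)
    moreover have "(\<integral>x. ?f x \<partial>\<nu> n) = 0" for n
      by (rule integral_eq_zero_AE) (use \<nu>(2)[of n] in \<open>auto elim!: eventually_mono\<close>)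
    ultimately have "(\<integral>x. ?f x \<partial>\<mu>) = 0" using LIMSEQ_unique[OF _ tendsto_const] by (simp add: LIMSEQ_const_iff)
    moreover have "integrable \<mu> ?f" by (rule \<mu>.integrable_const_bound[of _ 1]) auto
    ultimately have "AE x in \<mu>. ?f x = 0" by (subst (asm) integral_nonneg_eq_0_iff_AE) auto
    then show ?thesis by eventually_elim (auto simp: min_def max_def split: if_splits)
  qed
  have "(\<integral>x. x ^ k \<partial>\<mu>) = limit_moment k" if k: "0 < k" for k
  proof -
    \<comment> \<open>Powers are unbounded test functions; clamping the argument to [-1, 1] changes
      nothing on the support.\<close>
    let ?f = "\<lambda>x::real. (max (- 1) (min 1 x)) ^ k"
    have clamp: "(\<integral>x. ?f x \<partial>\<kappa>) = (\<integral>x. x ^ k \<partial>\<kappa>)" if "real_distribution \<kappa>" "AE x in \<kappa>. \<bar>x\<bar> \<le> 1" for \<kappa>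
    proof -
      interpret \<kappa>: real_distribution \<kappa> by fact
      show ?thesis
        by (rule integral_cong_AE) (use that(2) in \<open>auto elim!: eventually_mono\<close>)
    qed
    have b: "norm (?f x) \<le> 1" for x by (auto simp: power_abs intro!: power_le_one)
    have "(\<lambda>n. \<integral>x. ?f x \<partial>\<nu> (r n)) \<longlonglongrightarrow> (\<integral>x. ?f x \<partial>\<mu>)"
      by (rule lim[OF _ b]) (auto intro!: continuous_intros)
    then have "(\<lambda>n. \<integral>x. x ^ k \<partial>\<nu> (r n)) \<longlonglongrightarrow> (\<integral>x. x ^ k \<partial>\<mu>)"
      unfolding clamp[OF \<nu>] clamp[OF \<mu> supp] .
    moreover have "(\<lambda>n. \<integral>x. x ^ k \<partial>\<nu> (r n)) \<longlonglongrightarrow> limit_moment k"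
      using LIMSEQ_subseq_LIMSEQ[OF mom[OF k] r] by (simp add: comp_def)
    ultimately show ?thesis by (rule LIMSEQ_unique)
  qed
  then show ?thesis using \<mu> supp by blast
qed

end

text \<open>Reflection changes the sign of the odd moments only, so both laws have the same moments,
  and on [-1, 1] moments determine the law.\<close>

lemma symmetric_of_odd_moments:
  assumes \<mu>: "real_distribution \<mu>" "AE x in \<mu>. \<bar>x\<bar> \<le> 1" and odd: "\<And>k. odd k \<Longrightarrow> (\<integral>x. x ^ k \<partial>\<mu>) = 0"
  shows "distr \<mu> borel uminus = \<mu>"
proof -
  interpret \<mu>: real_distribution \<mu> by fact
  let ?\<nu> = "distr \<mu> borel uminus"
  have um: "(uminus :: real \<Rightarrow> real) \<in> measurable \<mu> borel" by simp
  have \<nu>: "real_distribution ?\<nu>" by (rule \<mu>.real_distribution_distr[OF um])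
  have supp: "AE x in ?\<nu>. \<bar>x\<bar> \<le> 1" using \<mu>(2) by (subst AE_distr_iff[OF um]) auto
  have mom: "(\<integral>x. x ^ k \<partial>?\<nu>) = (\<integral>x. x ^ k \<partial>\<mu>)" for k
  proof -
    have "(\<integral>x. x ^ k \<partial>?\<nu>) = (\<integral>x. (- x) ^ k \<partial>\<mu>)" by (rule integral_distr[OF um]) simp
    also have "\<dots> = (\<integral>x. x ^ k \<partial>\<mu>)"
      using odd[of k] by (cases "even k") (simp_all add: power_minus_odd)
    finally show ?thesis .
  qed
  show ?thesis
  proof (rule weak_limits_unique[OF \<nu> \<mu>(1)])
    fix f :: "real \<Rightarrow> real" assume f: "continuous_on UNIV f" "bounded (range f)"
    have m: "(\<lambda>n::nat. \<integral>x. x ^ k \<partial>?\<nu>) \<longlonglongrightarrow> (\<integral>x. x ^ k \<partial>\<mu>)" for k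
      unfolding mom by (rule tendsto_const)
    \<comment> \<open>Determinacy is the convergence criterion for a constant sequence.\<close>
    have "(\<lambda>n::nat. \<integral>x. f x \<partial>?\<nu>) \<longlonglongrightarrow> (\<integral>x. f x \<partial>\<mu>)"
      by (rule moments_imp_weak_convergence[OF \<nu> supp \<mu> m f])
    then show "(\<integral>x. f x \<partial>?\<nu>) = (\<integral>x. f x \<partial>\<mu>)" by (simp add: LIMSEQ_const_iff)
  qed
qed

theorem theorem1p4:
  "\<forall>\<alpha>::real. 0 < \<alpha> \<and> \<alpha> < 1 \<longrightarrow>
    (\<exists>\<mu>. real_distribution \<mu> \<and> distr \<mu> borel uminus = \<mu> \<and> measure \<mu> {-1..1} = 1 \<and>
      (\<forall>D \<in> heavy_tailed_laws \<alpha>.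
         spectra_converge_as (canonical_space D) canonical_weights \<mu> \<and>
         (\<forall>(M :: 'w measure) U. iid_weights M D U \<longrightarrow> spectra_converge_as M U \<mu>)))"
proof (intro allI impI)
  fix \<alpha> :: real assume \<alpha>: "0 < \<alpha> \<and> \<alpha> < 1"
  \<comment> \<open>Outside its locale \<open>limit_moment\<close> takes \<alpha> as its only
    parameter, since no definition on the way to it mentions the law. Hence one law fixes \<mu> for
    all of them.\<close>
  define mom where "mom = heavy_tail.limit_moment \<alpha>"
  have "\<exists>\<mu>. real_distribution \<mu> \<and> (AE x in \<mu>. \<bar>x\<bar> \<le> 1) \<and> (\<forall>k. odd k \<longrightarrow> (\<integral>x. x ^ k \<partial>\<mu>) = 0) \<and>
      (heavy_tailed_laws \<alpha> \<noteq> {} \<longrightarrow> (\<forall>k>0. (\<integral>x. x ^ k \<partial>\<mu>) = mom k))"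
  \<comment> \<open>Any member of the class produces \<mu>. The case split spares exhibiting one:
    for an empty class convergence is vacuous, and the point mass at 0 is symmetric and supported in
    [-1, 1].\<close>
  proof (cases "heavy_tailed_laws \<alpha> = {}")
    case True
    let ?\<mu> = "return borel (0 :: real)"
    interpret prob_space ?\<mu> by (rule prob_space_return) simp
    have "real_distribution ?\<mu>" by unfold_locales simp_all
    moreover have "(\<integral>x. x ^ k \<partial>?\<mu>) = 0" if "odd k" for k
    proof -
      have "k \<noteq> 0" using that by (cases k) auto
      then show ?thesis by (subst integral_return) (auto simp: power_0_left)
    qed
    ultimately show ?thesis using True by (intro exI[of _ ?\<mu>]) (auto simp: AE_return)
  next
    case False
    then obtain D where "D \<in> heavy_tailed_laws \<alpha>" by blast
    then interpret heavy_tail D \<alpha> using \<alpha> by unfold_locales auto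
    obtain \<mu> where \<mu>: "real_distribution \<mu>" "AE x in \<mu>. \<bar>x\<bar> \<le> 1" "\<And>k. 0 < k \<Longrightarrow> (\<integral>x. x ^ k \<partial>\<mu>) = mom k"
      using limit_law_exists unfolding mom_def by blast
    moreover have "mom k = 0" if "odd k" for k using limit_moment_odd[OF that] by (simp add: mom_def)
    moreover have "0 < k" if "odd k" for k :: nat using that by (cases k) auto
    ultimately have "\<forall>k. odd k \<longrightarrow> (\<integral>x. x ^ k \<partial>\<mu>) = 0" by metis
    then show ?thesis using \<mu> by blast
  qed
  then obtain \<mu> where \<mu>: "real_distribution \<mu>" "AE x in \<mu>. \<bar>x\<bar> \<le> 1"
    and odd: "\<forall>k. odd k \<longrightarrow> (\<integral>x. x ^ k \<partial>\<mu>) = 0"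
    and mom: "heavy_tailed_laws \<alpha> \<noteq> {} \<longrightarrow> (\<forall>k>0. (\<integral>x. x ^ k \<partial>\<mu>) = mom k)"
    by (elim exE conjE)
  interpret \<mu>: real_distribution \<mu> by fact
  have "AE x in \<mu>. x \<in> {-1..1}" using \<mu>(2) by eventually_elim auto
  then have "measure \<mu> {-1..1} = 1" by (subst \<mu>.prob_eq_1) auto
  moreover have "distr \<mu> borel uminus = \<mu>"
    by (rule symmetric_of_odd_moments[OF \<mu> odd[rule_format]])
  moreover have "spectra_converge_as (canonical_space D) canonical_weights \<mu> \<and>
         (\<forall>(M :: 'w measure) U. iid_weights M D U \<longrightarrow> spectra_converge_as M U \<mu>)" if D: "D \<in> heavy_tailed_laws \<alpha>" for D
  proof -
    interpret heavy_tail D \<alpha> using \<alpha> D by unfold_locales auto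
    have lm: "(\<integral>x. x ^ k \<partial>\<mu>) = limit_moment k" if "0 < k" for k
    proof -
      have "heavy_tailed_laws \<alpha> \<noteq> {}" using D by auto
      then show ?thesis using mom that unfolding mom_def by simp
    qed
    show ?thesis
    proof (intro conjI allI impI)
      show "spectra_converge_as (canonical_space D) canonical_weights \<mu>"
        by (rule spectra_converge[OF iid_canonical_weights[OF D.real_distribution_axioms] \<mu> lm])
      show "spectra_converge_as M U \<mu>" if "iid_weights M D U" for M :: "'w measure" and U
        by (rule spectra_converge[OF that \<mu> lm])
    qed
  qed
  ultimately show "\<exists>\<mu>. real_distribution \<mu> \<and> distr \<mu> borel uminus = \<mu> \<and> measure \<mu> {-1..1} = 1 \<and>
      (\<forall>D \<in> heavy_tailed_laws \<alpha>.
         spectra_converge_as (canonical_space D) canonical_weights \<mu> \<and>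
         (\<forall>(M :: 'w measure) U. iid_weights M D U \<longrightarrow> spectra_converge_as M U \<mu>))"
    using \<mu>(1) by blast
qed

end
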